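(* Let $n\ge1$, let $\mathfrak p_0\in A=\mathbb F_q[T]$ be monic irreducible of degree $r$ with $\gcd(n,r)=1$, let $t\in\mathbb F_{q^r}$ be a root of $\mathfrak p_0$, let $\phi$ be the Drinfeld module with $\phi_T=t+\tau^n$, and let $\mathfrak p\neq\mathfrak p_0$ be a monic irreducible element of $A$ of degree $d$. Put $\kappa=A/\mathfrak p$, $M=\phi[\mathfrak p]$, $E=\operatorname{End}_\kappa(M)$, $\pi=\tau^r$, $c=\mathfrak p_0\bmod\mathfrak p\in\kappa^\times$. Let $m\mid n$, $R_0=\kappa[\pi^m|_M]$, $R=\operatorname{Cent}_E(R_0)$, $L=\mathbb F_{q^m}\subseteq R$ (scalar multiplications), and let $K\subseteq R$ be the image of $L\otimes_{\mathbb F_q}\kappa$ under multiplication. Assume $\gcd(m,d)=1$. Then: (1) $K\cong\mathbb F_{q^{md}}$ is a field. (2) Conjugation by $\pi$, $x\mapsto\pi x\pi^{-1}$, preserves $K$ and induces the automorphism $\sigma\in\operatorname{Aut}(K)$ acting as the identity on $\kappa$ and as $\zeta\mapsto\zeta^{[r]}$ on $L$. Explicitly, $\sigma=\operatorname{Frob}^e|_K$, where $\operatorname{Frob}\colon x\mapsto x^q$ is the $q$-power Frobenius automorphism and $e$ is determined by $e\equiv r\pmod m$, $e\equiv0\pmod d$. The automorphism $\sigma$ has order $m$ and fixed field $\kappa$. (3) Let $K[y;\sigma]$ be the twisted polynomial ring with $yx=\sigma(x)y$ for $x\in K$. The assignment $y\mapsto\pi$ induces an isomorphism $K[y;\sigma]/(y^n-c)\xrightarrow{\sim}R$,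 with $R=\bigoplus_{i=0}^{n-1}K\pi^i$, and the modulus $y^n-c$ is central in $K[y;\sigma]$.
   Context: $q$ is a prime power, $A=\mathbb F_q[T]$, and $\overline{\mathbb F}_q$ is a fixed algebraic closure containing all finite fields considered. For $i\ge0$ write $[i]=q^i$, so $\beta^{[i]}=\beta^{q^i}$. Twisted polynomials in $\tau$ satisfy $\tau a=a^q\tau$ and act on $\overline{\mathbb F}_q$ with $\tau$ acting as $x\mapsto x^q$ and constants by multiplication. The Drinfeld module $\phi$ is the $\mathbb F_q$-algebra homomorphism $A\to\mathbb F_{q^r}\{\tau\}$, $a\mapsto\phi_a$, determined by $\phi_T=t+\tau^n$. Its $\mathfrak p$-torsion is $M=\phi[\mathfrak p]=\{v\in\overline{\mathbb F}_q:\phi_{\mathfrak p}(v)=0\}$, on which $a\in A$ acts by $v\mapsto\phi_a(v)$; this makes $M$ a $\kappa$-vector space of dimension $n$. The element $\pi=\tau^r$ acts on $M$ as the $\kappa$-linear operator $v\mapsto v^{[r]}$ (invertible, lying in $R$), and $\zeta\in\mathbb F_{q^n}\supseteq L$ acts $\kappa$-linearly by $v\mapsto\zeta v$. $\kappa$ is identified with the $\kappa$-scalars in $E$; $\operatorname{Cent}_E(R_0)$ is the centralizer of $R_0$ in $E$. *)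

theory Defs
  imports "HOL-Algebra.Algebra" "HOL-Algebra.Algebraic_Closure_Type"
    "HOL-Number_Theory.Cong" "HOL-Library.Cardinality" "HOL-Computational_Algebra.Polynomial"
begin

text \<open>
  The finite field \<open>F\<^sub>q\<close> is a type \<^typ>\<open>'f::{field, finite}\<close>, so that \<open>q = CARD('f)\<close>, the ring
  \<open>A = F\<^sub>q[T]\<close> is the type \<^typ>\<open>'f poly\<close>, and the fixed algebraic closure of \<open>F\<^sub>q\<close> is
  \<^typ>\<open>'f alg_closure\<close>, with embedding \<^const>\<open>to_ac\<close>.
\<close>

subsection \<open>General ring-theoretic notions\<close>

definition ring_centralizer :: "('a, 'm) ring_scheme \<Rightarrow> 'a set \<Rightarrow> 'a set" where
  "ring_centralizer R B =
     {a \<in> carrier R. \<forall>x\<in>B. a \<otimes>\<^bsub>R\<^esub> x = x \<otimes>\<^bsub>R\<^esub> a}"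

definition ring_AutoGroup :: "('a, 'm) ring_scheme \<Rightarrow> ('a \<Rightarrow> 'a) monoid" where
  "ring_AutoGroup R =
     BijGroup (carrier R) \<lparr>carrier := ring_iso R R \<inter> Bij (carrier R)\<rparr>"

text \<open>
  The ring \<open>R[y;s]\<close> of twisted polynomials \<open>\<Sum> a\<^sub>i y\<^sup>i\<close>, coefficients on the left, with
  \<open>y a = s(a) y\<close>, hence \<open>(a y\<^sup>i) (b y\<^sup>j) = a s\<^sup>i(b) y\<^sup>i\<^sup>+\<^sup>j\<close>. Only the multiplication
  differs from that of \<^const>\<open>UP\<close>. The constant \<open>a\<close> is \<open>up_ring.monom _ a 0\<close>, and the variable
  \<open>y\<close> is \<open>up_ring.monom _ \<one> 1\<close>.
\<close>

definition twisted_UP :: "('a, 'm) ring_scheme \<Rightarrow> ('a \<Rightarrow> 'a) \<Rightarrow> ('a, nat \<Rightarrow> 'a) up_ring" where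
  "twisted_UP R s = UP R \<lparr>monoid.mult :=
     (\<lambda>f\<in>up R. \<lambda>g\<in>up R. \<lambda>k. \<Oplus>\<^bsub>R\<^esub>i\<in>{..k}. f i \<otimes>\<^bsub>R\<^esub> (s ^^ i) (g (k - i)))\<rparr>"

text \<open>
  The image of \<open>U \<otimes> V\<close> in \<open>R\<close> under multiplication: every tensor is a finite sum of pure tensors.
\<close>

definition tensor_image :: "('a, 'm) ring_scheme \<Rightarrow> 'a set \<Rightarrow> 'a set \<Rightarrow> 'a set" where
  "tensor_image R U V =
     {\<Oplus>\<^bsub>R\<^esub>i\<in>{..<N}. x i \<otimes>\<^bsub>R\<^esub> y i | (N::nat) x y. x \<in> {..<N} \<rightarrow> U \<and> y \<in> {..<N} \<rightarrow> V}"

definition is_internal_direct_sum ::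
    "('a, 'm) ring_scheme \<Rightarrow> 'i set \<Rightarrow> ('i \<Rightarrow> 'a set) \<Rightarrow> bool" where
  "is_internal_direct_sum R I S \<longleftrightarrow>
     (\<forall>i\<in>I. additive_subgroup (S i) R) \<and>
     bij_betw (\<lambda>f. \<Oplus>\<^bsub>R\<^esub>i\<in>I. f i) (\<Pi>\<^sub>E i\<in>I. S i) (carrier R)"

text \<open>Endomorphisms of a module are made extensional, so that equality is equality on the module.\<close>

definition module_End :: "('a, 'm) ring_scheme \<Rightarrow> ('a, 'b, 'n) module_scheme \<Rightarrow> ('b \<Rightarrow> 'b) ring"
  where
  "module_End R M =
     \<lparr>carrier = {f \<in> carrier M \<rightarrow>\<^sub>E carrier M.
        (\<forall>v\<in>carrier M. \<forall>w\<in>carrier M. f (v \<oplus>\<^bsub>M\<^esub> w) = f v \<oplus>\<^bsub>M\<^esub> f w) \<and>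
        (\<forall>a\<in>carrier R. \<forall>v\<in>carrier M. f (a \<odot>\<^bsub>M\<^esub> v) = a \<odot>\<^bsub>M\<^esub> f v)},
      monoid.mult = compose (carrier M),
      one = (\<lambda>v\<in>carrier M. v),
      ring.zero = (\<lambda>v\<in>carrier M. \<zero>\<^bsub>M\<^esub>),
      add = (\<lambda>f g. \<lambda>v\<in>carrier M. f v \<oplus>\<^bsub>M\<^esub> g v)\<rparr>"

definition scalar_op :: "('a, 'b, 'n) module_scheme \<Rightarrow> 'a \<Rightarrow> 'b \<Rightarrow> 'b" where
  "scalar_op M a = (\<lambda>v\<in>carrier M. a \<odot>\<^bsub>M\<^esub> v)"

subsection \<open>Finite fields and twisted polynomials in \<open>\<tau>\<close>\<close>

text \<open>The subfield with \<open>q\<^sup>i\<close> elements of the algebraic closure (for \<open>i \<ge> 1\<close>).\<close>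

definition GF :: "nat \<Rightarrow> 'f::{field, finite} alg_closure ring" where
  "GF i = ring_of_type_algebra \<lparr>carrier := {x. x ^ (CARD('f) ^ i) = x}\<rparr>"

text \<open>The ring \<open>F{\<tau>}\<close> over the field \<open>F\<close> with \<open>q\<^sup>r\<close> elements, where \<open>\<tau> a = a\<^sup>q \<tau>\<close>.\<close>

definition tau_ring ::
    "nat \<Rightarrow> ('f::{field, finite} alg_closure, nat \<Rightarrow> 'f alg_closure) up_ring" where
  "tau_ring r = twisted_UP (GF r) (\<lambda>x. x ^ CARD('f))"

definition tau_var :: "nat \<Rightarrow> nat \<Rightarrow> 'f::{field, finite} alg_closure" where
  "tau_var r = up_ring.monom (tau_ring r) 1 1"

definition tau_act ::
    "(nat \<Rightarrow> 'f::{field, finite} alg_closure) \<Rightarrow> 'f alg_closure \<Rightarrow> 'f alg_closure" where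
  "tau_act f v = (\<Sum>i | f i \<noteq> 0. f i * v ^ (CARD('f) ^ i))"

subsection \<open>The Drinfeld module and its torsion\<close>

text \<open>
  \<open>\<phi>\<close> is the homomorphism of \<open>F\<^sub>q\<close>-algebras from \<open>A\<close> to \<^term>\<open>tau_ring r\<close> with
  \<open>\<phi>(T) = t + \<tau>\<^sup>n\<close>.
\<close>

definition is_drinfeld_module ::
    "nat \<Rightarrow> 'f::{field, finite} alg_closure \<Rightarrow> nat \<Rightarrow>
      ('f poly \<Rightarrow> nat \<Rightarrow> 'f alg_closure) \<Rightarrow> bool" where
  "is_drinfeld_module r t n \<phi> \<longleftrightarrow>
     \<phi> \<in> ring_hom ring_of_type_algebra (tau_ring r) \<and>
     (\<forall>a. \<phi> [:a:] = up_ring.monom (tau_ring r) (to_ac a) 0) \<and>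
     \<phi> [:0, 1:] = up_ring.monom (tau_ring r) t 0 \<oplus>\<^bsub>tau_ring r\<^esub> tau_var r [^]\<^bsub>tau_ring r\<^esub> n"

text \<open>
  The \<open>p\<close>-torsion of \<open>\<phi>\<close> as a module over \<open>A/p\<close>: a residue class \<open>C\<close> acts through any of its
  elements. The fields \<^const>\<open>monoid.mult\<close> and \<^const>\<open>one\<close> play no role for a module.
\<close>

definition drinfeld_torsion ::
    "('f::{field, finite} poly \<Rightarrow> nat \<Rightarrow> 'f alg_closure) \<Rightarrow> 'f poly \<Rightarrow>
      ('f poly set, 'f alg_closure) module" where
  "drinfeld_torsion \<phi> p =
     \<lparr>carrier = {v. tau_act (\<phi> p) v = 0}, monoid.mult = (*), one = 1, ring.zero = 0, add = (+),
      module.smult = (\<lambda>C v. the_elem ((\<lambda>a. tau_act (\<phi> a) v) ` C))\<rparr>"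

end

theory Submission
  imports Defs
begin

text \<open>
  Why the theorem holds. Write \<open>\<Phi> = t + \<tau>\<^sup>n\<close>. Multiplication by an element of the field \<open>k\<^sub>n\<close> with \<open>q\<^sup>n\<close>
  elements commutes with \<open>\<tau>\<^sup>n\<close>, hence with \<open>\<Phi>\<close>, so the torsion \<open>M\<close> is a module over \<open>k\<^sub>n[T]\<close>, where \<open>T\<close> acts
  as \<open>\<Phi>\<close>, and \<open>\<pi> = \<tau>\<^sup>r\<close> acts semilinearly over this ring: \<open>\<pi> \<zeta> = \<zeta>^(q^r) \<pi>\<close>. The whole proof is a comparison
  of \<open>E\<close> with the sums of \<open>P\<^sub>i(\<Phi>) \<pi>\<^sup>i\<close> over \<open>i < n\<close>, where \<open>P\<^sub>i\<close> runs over the polynomials over \<open>k\<^sub>n\<close> of degree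
  less than \<open>d\<close>.

  These sums are pairwise distinct (\<open>op_sum_eq_iff\<close>). Indeed, as \<open>n\<close> is prime to \<open>r\<close>, multiplication by a
  generator of \<open>k\<^sub>n\<close> over \<open>k\<^sub>1\<close> separates the \<open>n\<close> summands (\<open>frob_independent\<close>), and a nonzero \<open>P(\<Phi>)\<close> with
  \<open>deg P < d\<close> has at most \<open>q^(n deg P)\<close> zeros, too few to vanish on \<open>M\<close> (\<open>faithful\<close>); \<open>M\<close> has exactly
  \<open>q\<^sup>n\<^sup>d\<close> elements because \<open>\<phi>\<^sub>p\<close> is a separable additive polynomial (\<open>card_torsion\<close>). On the other hand
  \<open>M\<close> is generated by \<open>n\<close> elements over \<open>A/p\<close>, so \<open>E\<close> has at most \<open>(q\<^sup>n\<^sup>d)\<^sup>n\<close> elements (\<open>card_endos_le\<close>), and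
  this is the number of the sums. So every element of \<open>E\<close> is such a sum, in exactly one way
  (\<open>endos_eq_op_sum\<close>).

  The structure of \<open>R\<close> can now be read off. An element of \<open>E\<close> commutes with \<open>\<pi>\<^sup>m\<close> iff its coefficients are
  fixed by \<open>\<zeta> \<mapsto> \<zeta>^(q^(rm))\<close>, that is, iff they lie in \<open>k\<^sub>m\<close> (\<open>op_sum_commutes\<close>). Hence \<open>R\<close> is the direct sum of
  the \<open>K \<pi>\<^sup>i\<close> for \<open>i < n\<close>, where \<open>K\<close> consists of the operators \<open>P(\<Phi>)\<close> with \<open>P\<close> over \<open>k\<^sub>m\<close>
  (\<open>basis_Cent_ring\<close>). Together with the identity \<open>\<pi>\<^sup>n = p\<^sub>0(\<Phi>)\<close> (\<open>aact_p0\<close>) this basis gives the presentation of \<open>R\<close> as a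
  quotient of a twisted polynomial ring by a purely ring-theoretic argument (\<open>quotient_iso\<close>).

  Finally let \<open>\<theta>\<close> be a root of \<open>p\<close>. As \<open>m\<close> is prime to \<open>d\<close>, the polynomial \<open>p\<close> stays irreducible over
  \<open>k\<^sub>m\<close>, so \<open>P(\<Phi>)\<close> vanishes on \<open>M\<close> iff \<open>P(\<theta>) = 0\<close> (\<open>pact_zero_iff_poly_theta\<close>). Hence \<open>P(\<Phi>) \<mapsto> P(\<theta>)\<close>
  identifies \<open>K\<close> with the field with \<open>q\<^sup>m\<^sup>d\<close> elements (\<open>from_value_iso\<close>), and conjugation by \<open>\<pi>\<close>, which
  raises the coefficients of \<open>P\<close> to the power \<open>q\<^sup>r\<close>, becomes the power of the Frobenius that agrees
  with \<open>q\<^sup>r\<close> on \<open>k\<^sub>m\<close> and fixes \<open>\<theta>\<close>.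
\<close>


section \<open>Frobenius maps on the algebraic closure of a finite field\<close>

lemma prime_CHAR_finite: "Factorial_Ring.prime CHAR('f::{field, finite})"
  by (rule prime_CHAR_semidom) (simp add: finite_imp_CHAR_pos)

text \<open>
  The additive group has a subgroup of order \<open>l\<close> by Sylow, and \<open>l\<close> kills its nonzero elements. So the
  number of elements of a finite field is a power of the characteristic, which makes \<open>x \<mapsto> x\<^sup>q\<close> additive.
\<close>
lemma prime_dvd_CARD_imp_eq_CHAR:
  assumes l: "Factorial_Ring.prime l" "l dvd CARD('f::{field, finite})"
  shows "l = CHAR('f)"
proof -
  define G where "G = \<lparr>carrier = (UNIV :: 'f set), monoid.mult = (+), one = (0::'f)\<rparr>"
  have "group G"
    by (rule groupI) (auto simp: G_def add.assoc intro: exI[of _ "- x" for x])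
  then interpret group G .
  from l obtain k where "Coset.order G = l ^ 1 * k"
    by (auto simp: Coset.order_def G_def elim: dvdE)
  then obtain H where H: "subgroup H G" "card H = l"
    using sylow_thm[OF l(1) \<open>group G\<close>, of 1 k] by (auto simp: G_def)
  then interpret HG: group "G\<lparr>carrier := H\<rparr>"
    by (simp add: subgroup.subgroup_is_group)
  have "card H > 1"
    using H l prime_gt_1_nat by auto
  then obtain x where x: "x \<in> H" "x \<noteq> 0"
    by (metis card_le_Suc0_iff_eq card_eq_0_iff leD not_one_less_zero One_nat_def)
  have pow: "x [^]\<^bsub>G\<lparr>carrier := H\<rparr>\<^esub> k = of_nat k * x" for k :: nat
    by (induction k) (auto simp: G_def nat_pow_def algebra_simps)
  have "x [^]\<^bsub>G\<lparr>carrier := H\<rparr>\<^esub> Coset.order (G\<lparr>carrier := H\<rparr>) = \<one>\<^bsub>G\<lparr>carrier := H\<rparr>\<^esub>"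
    using x by (intro HG.pow_order_eq_1) simp
  then have "of_nat l * x = 0"
    unfolding pow using H by (simp add: Coset.order_def G_def)
  with x have "of_nat l = (0::'f)"
    by simp
  then have "CHAR('f) dvd l"
    using of_nat_eq_0_iff_char_dvd by blast
  then show ?thesis
    using l(1) prime_CHAR_finite[where 'f='f] by (metis primes_dvd_imp_eq)
qed

lemma CARD_eq_CHAR_power: "\<exists>k. CARD('f::{field, finite}) = CHAR('f) ^ k"
proof -
  let ?p = "CHAR('f)"
  have p: "Factorial_Ring.prime ?p" by (rule prime_CHAR_finite)
  obtain k m where k: "CARD('f) = ?p ^ k * m" "\<not> ?p dvd m"
    using p by (metis (no_types, lifting) finite_UNIV_card_ge_0 finite less_numeral_extra(3)
        multiplicity_decompose' not_prime_unit zero_less_iff_neq_zero mult.commute)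
  have "m = 1"
    using k prime_dvd_CARD_imp_eq_CHAR[where 'f='f] by (metis dvd_triv_right dvd_trans prime_factor_nat)
  with k show ?thesis by auto
qed

lemma CARD_gt_1: "CARD('f::{field, finite}) > 1"
proof -
  have "card {0::'f, 1} \<le> CARD('f)" by (rule card_mono) auto
  then show ?thesis by simp
qed

lemma of_nat_CARD: "of_nat (CARD('f::{field, finite})) = (0 :: 'f alg_closure)"
proof -
  obtain k where k: "CARD('f) = CHAR('f) ^ k" using CARD_eq_CHAR_power by blast
  then have "k > 0" using CARD_gt_1[where 'f='f] by (cases k) auto
  with k have "CHAR('f) dvd CARD('f)" by simp
  then show ?thesis
    by (metis CHAR_alg_closure of_nat_eq_0_iff_char_dvd)
qed

definition frob :: "nat \<Rightarrow> 'f::{field, finite} alg_closure \<Rightarrow> 'f alg_closure" where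
  "frob i x = x ^ (CARD('f) ^ i)"

lemma frob_0 [simp]: "frob 0 x = x"
  and frob_zero [simp]: "frob i 0 = 0"
  and frob_one [simp]: "frob i 1 = 1"
  and frob_mult: "frob i (x * y) = frob i x * frob i y"
  and frob_power: "frob i (x ^ k) = frob i x ^ k"
  and frob_eq_0_iff [simp]: "frob i x = 0 \<longleftrightarrow> x = 0"
  by (auto simp: frob_def power_mult_distrib simp flip: power_mult) (simp add: mult.commute)

lemma frob_frob: "frob i (frob j x) = frob (i + j) x"
  by (simp add: frob_def power_add mult.commute flip: power_mult)

lemma frob_add: "frob i (x + y) = frob i x + frob i y"
  for x :: "'f::{field, finite} alg_closure"
proof -
  obtain k where "CARD('f) = CHAR('f) ^ k" using CARD_eq_CHAR_power by blast
  then have "CARD('f) ^ i = CHAR('f alg_closure) ^ (k * i)" by (simp add: power_mult)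
  then show ?thesis
    unfolding frob_def by (intro freshmans_dream') (simp_all add: prime_CHAR_finite)
qed

lemma frob_minus: "frob i (- x) = - frob i x"
  by (metis add.right_inverse frob_add frob_zero neg_eq_iff_add_eq_0)

lemma frob_diff: "frob i (x - y) = frob i x - frob i y"
  using frob_add[of i x "- y"] by (simp add: frob_minus)

lemma frob_sum: "frob i (sum f A) = (\<Sum>x\<in>A. frob i (f x))"
  by (induction A rule: infinite_finite_induct) (auto simp: frob_add)

lemma frob_eq_iff [simp]: "frob i x = frob i y \<longleftrightarrow> x = y"
  by (metis frob_diff frob_eq_0_iff right_minus_eq)

lemma finite_field_power_CARD: "(a::'f::{field, finite}) ^ CARD('f) = a"
proof (cases "a = 0")
  case False
  let ?U = "UNIV - {0::'f}"
  \<comment> \<open>Multiplication by \<open>a\<close> permutes the nonzero elements.\<close>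
  have "(\<Prod>x\<in>?U. a * x) = \<Prod>?U"
    using False
    by (intro prod.reindex_bij_witness[of _ "\<lambda>x. x / a" "\<lambda>x. a * x"]) auto
  moreover have "(\<Prod>x\<in>?U. a * x) = a ^ card ?U * \<Prod>?U"
    by (simp add: prod.distrib)
  moreover have "\<Prod>?U \<noteq> 0"
    by simp
  ultimately have "a ^ card ?U = 1"
    by simp
  moreover have "CARD('f) = Suc (card ?U)"
    using CARD_gt_1[where 'f='f] by (simp add: card_Diff_singleton)
  ultimately show ?thesis
    by (metis mult.right_neutral power_Suc)
qed (use CARD_gt_1[where 'f='f] in auto)

lemma to_ac_power: "to_ac (a ^ k) = to_ac a ^ k"
  by (induction k) auto

lemma frob_to_ac [simp]: "frob i (to_ac a) = to_ac a"
proof (induction i)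
  case (Suc i)
  have "frob (Suc i) (to_ac a) = frob i (frob 1 (to_ac a))"
    by (simp add: frob_frob)
  also have "frob 1 (to_ac a) = to_ac a"
    by (simp add: frob_def finite_field_power_CARD flip: to_ac_power)
  finally show ?case using Suc by simp
qed simp

lemma frob_multiple: "frob i x = x \<Longrightarrow> frob (k * i) x = x"
  by (induction k) (auto simp flip: frob_frob)

lemma frob_gcd:
  assumes "frob a x = x" "frob b x = x"
  shows "frob (gcd a b) x = x"
proof (cases "a = 0")
  case False
  then obtain u v where "a * u = b * v + gcd a b"
    using bezout_nat by blast
  then have "frob (u * a) x = frob (gcd a b) (frob (v * b) x)"
    by (simp add: frob_frob mult.commute add.commute)
  then show ?thesis
    using assms by (simp add: frob_multiple)
qed (use assms in auto)

text \<open>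
  A root of multiplicity at least two would be a root of the derivative. This counts the elements of the
  finite subfields and of the torsion.
\<close>
lemma card_roots_of_const_pderiv:
  fixes P :: "'a::alg_closed_field poly"
  assumes "pderiv P = [:c:]" "c \<noteq> 0"
  shows "card {x. poly P x = 0} = Polynomial.degree P"
proof -
  have [simp]: "P \<noteq> 0" using assms by auto
  obtain A where A: "size A = Polynomial.degree P"
      "P = smult (Polynomial.lead_coeff P) (\<Prod>x\<in>#A. [:-x, 1:])"
    using alg_closed_imp_factorization[of P] by auto
  have "proots P = proots (smult (Polynomial.lead_coeff P) (\<Prod>x\<in>#A. [:-x, 1:]))"
    using A(2) by (rule arg_cong)
  also have "\<dots> = proots (\<Prod>x\<in>#A. [:-x, 1:])"
    by (rule proots_smult) simp
  also have "\<dots> = A"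
  proof (induction A)
    case (add x A)
    have "(\<Prod>x\<in>#A. [:-x, 1:]) \<noteq> 0" by auto
    then show ?case
      using add by (simp add: proots_mult del: mult_pCons_left)
  qed simp
  finally have "proots P = A" .
  have "count (proots P) x \<le> 1" for x
  proof (rule ccontr)
    assume "\<not> count (proots P) x \<le> 1"
    then have "[:-x, 1:] ^ 2 dvd P"
      by (simp add: order_divides)
    then obtain Q where Q: "P = [:-x, 1:] * ([:-x, 1:] * Q)"
      unfolding power2_eq_square dvd_def mult.assoc by blast
    have "poly (pderiv P) x = 0"
      unfolding Q pderiv_mult by simp
    with assms show False by simp
  qed
  then have one: "count (proots P) x = 1" if "x \<in># proots P" for x
    using that by (metis count_greater_eq_one_iff le_antisym)
  have "size (proots P) = card (set_mset (proots P))"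
    unfolding size_multiset_overloaded_eq using one by simp
  also have "set_mset (proots P) = {x. poly P x = 0}"
    by simp
  finally show ?thesis
    using A(1) \<open>proots P = A\<close> by simp
qed

section \<open>The finite subfields\<close>

lemma carrier_GF: "carrier (GF i :: 'f::{field, finite} alg_closure ring) = {x. frob i x = x}"
  by (simp add: GF_def frob_def)

lemma GF_simps [simp]:
  fixes a b :: "'f::{field, finite} alg_closure"
  shows "a \<oplus>\<^bsub>GF i\<^esub> b = a + b" "a \<otimes>\<^bsub>GF i\<^esub> b = a * b" "\<zero>\<^bsub>GF i\<^esub> = (0 :: 'f alg_closure)" "\<one>\<^bsub>GF i\<^esub> = (1 :: 'f alg_closure)"
  by (simp_all add: GF_def ring_of_type_algebra_def)

lemma pderiv_frobenius_monom:
  "i > 0 \<Longrightarrow> pderiv (Polynomial.monom (1 :: 'f::{field, finite} alg_closure) (CARD('f) ^ i)) = 0"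
  by (cases i) (auto simp: pderiv_monom of_nat_CARD)

lemma card_carrier_GF:
  assumes "i > 0"
  shows "card (carrier (GF i :: 'f::{field, finite} alg_closure ring)) = CARD('f) ^ i"
proof -
  let ?P = "Polynomial.monom (1 :: 'f alg_closure) (CARD('f) ^ i) + [:0, -1:]"
  have "CARD('f) ^ i > 1"
    using assms CARD_gt_1[where 'f='f] one_less_power by blast
  then have "Polynomial.degree ?P = CARD('f) ^ i"
    by (subst degree_add_eq_left) (auto simp: degree_monom_eq)
  moreover have "pderiv ?P = [:-1:]"
    using assms by (simp add: pderiv_add pderiv_frobenius_monom pderiv_pCons)
  ultimately show ?thesis
    using card_roots_of_const_pderiv[of ?P "-1"] by (simp add: carrier_GF frob_def poly_monom)
qed

lemma finite_carrier_GF: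
  "i > 0 \<Longrightarrow> finite (carrier (GF i :: 'f::{field, finite} alg_closure ring))"
  using card_carrier_GF[of i, where 'f='f] CARD_gt_1[where 'f='f] by (auto intro: card_ge_0_finite)

lemma carrier_GF_1: "carrier (GF 1) = range (to_ac :: 'f::{field, finite} \<Rightarrow> 'f alg_closure)"
proof (rule card_subset_eq[symmetric])
  show "range (to_ac :: 'f \<Rightarrow> 'f alg_closure) \<subseteq> carrier (GF 1)"
    by (auto simp: carrier_GF)
  show "card (range (to_ac :: 'f \<Rightarrow> 'f alg_closure)) = card (carrier (GF 1 :: 'f alg_closure ring))"
    by (simp add: card_carrier_GF card_image inj_to_ac)
qed (simp add: finite_carrier_GF)

text \<open>
  In other words, \<open>x\<close> has degree \<open>n\<close> over the field with \<open>q\<close> elements.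
\<close>
definition frob_period :: "'f::{field, finite} alg_closure \<Rightarrow> nat \<Rightarrow> bool" where
  "frob_period x n \<longleftrightarrow> (\<forall>i. frob i x = x \<longleftrightarrow> n dvd i)"

lemma frob_periodI:
  assumes "frob n x = x" "n > 0" "\<And>k. 0 < k \<Longrightarrow> k < n \<Longrightarrow> frob k x \<noteq> x"
  shows "frob_period x n"
  unfolding frob_period_def
proof (intro allI iffI)
  fix i assume "n dvd i"
  then show "frob i x = x"
    using assms(1) by (auto simp: frob_multiple mult.commute elim: dvdE)
next
  fix i assume "frob i x = x"
  then have "frob (gcd n i) x = x"
    using assms(1) by (simp add: frob_gcd)
  moreover have "gcd n i \<le> n" "gcd n i > 0"
    using assms(2) by (auto simp: gcd_le1_nat)
  ultimately have "gcd n i = n"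
    using assms(3) by (metis le_neq_implies_less)
  then show "n dvd i"
    by (metis gcd_dvd2)
qed

lemma frob_period_eq_iff:
  assumes "frob_period x n"
  shows "frob i x = frob j x \<longleftrightarrow> [i = j] (mod n)"
proof -
  have *: "frob i x = frob j x \<longleftrightarrow> [i = j] (mod n)" if "i \<le> j" for i j
  proof -
    have "frob i x = frob j x \<longleftrightarrow> frob (j - i) x = x"
      using that by (metis frob_eq_iff frob_frob le_add_diff_inverse)
    also have "\<dots> \<longleftrightarrow> n dvd (j - i)"
      using assms by (auto simp: frob_period_def)
    also have "\<dots> \<longleftrightarrow> [i = j] (mod n)"
      using that by (metis cong_altdef_nat cong_sym_eq)
    finally show ?thesis .
  qed
  show ?thesis
    using *[of i j] *[of j i] by (metis cong_sym_eq nle_le)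
qed

lemma frob_cong:
  assumes "frob n x = x" "[i = j] (mod n)"
  shows "frob i x = frob j x"
proof -
  have *: "frob i x = frob j x" if "i \<le> j" "[i = j] (mod n)" for i j
  proof -
    from that obtain k where "j = i + n * k"
      by (metis cong_le_nat cong_sym_eq mult.commute add.commute)
    then show ?thesis
      using assms(1) by (simp add: frob_frob[symmetric] frob_multiple mult.commute)
  qed
  then show ?thesis
    using assms(2) by (metis cong_sym nle_le)
qed

lemma inj_on_frob_multiples:
  assumes "frob_period x n" "coprime a n"
  shows "inj_on (\<lambda>i. frob (a * i) x) {..<n}"
proof (rule inj_onI)
  fix i j assume ij: "i \<in> {..<n}" "j \<in> {..<n}" "frob (a * i) x = frob (a * j) x"
  then have "[i = j] (mod n)"
    using assms by (simp add: frob_period_eq_iff cong_mult_lcancel_nat)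
  with ij show "i = j"
    by (simp add: cong_less_modulus_unique_nat)
qed

lemma sum_powers_less: "(q::nat) > 1 \<Longrightarrow> (\<Sum>k\<in>{0<..<n}. q ^ k) < q ^ n"
proof (induction n)
  case (Suc n)
  have "(\<Sum>k\<in>{0<..<Suc n}. q ^ k) \<le> q ^ n + (\<Sum>k\<in>{0<..<n}. q ^ k)"
  proof (cases "n = 0")
    case False
    then have "{0<..<Suc n} = insert n {0<..<n}" by auto
    then show ?thesis by simp
  next
    case True
    then have "{0<..<Suc n} = {}" by auto
    then show ?thesis by simp
  qed
  also have "\<dots> < q ^ n + q ^ n"
    using Suc by simp
  also have "\<dots> \<le> q ^ Suc n"
    using Suc.prems by (simp flip: mult_2)
  finally show ?case .
qed auto

text \<open>
  The fields with \<open>q\<^sup>k\<close> elements for \<open>0 < k < n\<close> are too small to cover the field with \<open>q\<^sup>n\<close> elements.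
\<close>
lemma exists_frob_period:
  assumes "n > 0"
  shows "\<exists>x :: 'f::{field, finite} alg_closure. frob_period x n"
proof -
  let ?G = "\<lambda>i. carrier (GF i :: 'f alg_closure ring)"
  have "card (\<Union>k\<in>{0<..<n}. ?G k) \<le> (\<Sum>k\<in>{0<..<n}. card (?G k))"
    by (rule card_UN_le) simp
  also have "\<dots> = (\<Sum>k\<in>{0<..<n}. CARD('f) ^ k)"
    by (simp add: card_carrier_GF)
  also have "\<dots> < card (?G n)"
    using assms CARD_gt_1[where 'f='f] by (simp add: card_carrier_GF sum_powers_less)
  finally have "\<not> ?G n \<subseteq> (\<Union>k\<in>{0<..<n}. ?G k)"
    by (metis card_mono finite_UN_I finite_carrier_GF finite_greaterThanLessThan
        greaterThanLessThan_iff leD)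
  then obtain x where "x \<in> ?G n" "x \<notin> (\<Union>k\<in>{0<..<n}. ?G k)"
    by blast
  then show ?thesis
    using assms by (intro exI[of _ x] frob_periodI) (auto simp: carrier_GF)
qed

lemma field_GF:
  assumes "i > 0"
  shows "field (GF i :: 'f::{field, finite} alg_closure ring)"
proof -
  interpret F: field "ring_of_type_algebra :: 'f alg_closure ring"
    by (rule field_from_type_algebra)
  have inv: "frob i (inverse x) = inverse x" if "frob i x = x" for x :: "'f alg_closure"
    using that by (simp add: frob_def power_inverse)
  show ?thesis
  proof (rule cring.cring_fieldI2)
    show "cring (GF i :: 'f alg_closure ring)"
      by (rule cringI; (rule abelian_groupI comm_monoidI)?)
        (auto simp: GF_def[folded frob_def] ring_of_type_algebra_def frob_add frob_mult
          algebra_simps frob_minus intro: exI[of _ "- x" for x])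
  qed (auto simp: GF_def[folded frob_def] ring_of_type_algebra_def frob_add frob_mult
          intro!: exI[of _ "inverse x" for x] inv)
qed


section \<open>Polynomials over finite fields\<close>

text \<open>
  The hypothesis on \<open>J\<close> says that it is an ideal. An element of least degree generates it and divides
  the irreducible \<open>p\<close>; since it also divides \<open>a\<close>, which \<open>p\<close> does not, it is a unit.
\<close>
lemma one_in_poly_ideal:
  fixes J :: "'a::field poly set"
  assumes "Factorial_Ring.irreducible p" "p \<in> J" "a \<in> J" "\<not> p dvd a"
    and closed: "\<And>x y z. x \<in> J \<Longrightarrow> y \<in> J \<Longrightarrow> x - z * y \<in> J"
  shows "1 \<in> J"
proof -
  have "a \<noteq> 0" using assms(4) by auto
  then obtain h where h: "h \<in> J" "h \<noteq> 0"
      and min: "\<And>x. x \<in> J \<Longrightarrow> x \<noteq> 0 \<Longrightarrow> Polynomial.degree h \<le> Polynomial.degree x"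
    using ex_has_least_nat[of "\<lambda>h. h \<in> J \<and> h \<noteq> 0" a Polynomial.degree] assms(3) by auto
  have dvd: "h dvd x" if "x \<in> J" for x
  proof -
    have "x mod h \<in> J"
      using closed[OF that h(1), of "x div h"] by (simp add: minus_div_mult_eq_mod)
    then have "x mod h = 0"
      using min[of "x mod h"] degree_mod_less'[OF h(2), of x] by fastforce
    then show ?thesis by auto
  qed
  then obtain k where k: "p = h * k"
    using assms(2) by (auto elim: dvdE)
  have "\<not> k dvd 1"
  proof
    assume "k dvd 1"
    then have "p dvd h"
      unfolding k by (metis dvd_def mult.assoc mult.right_neutral mult_dvd_mono dvd_refl)
    with dvd[OF assms(3)] assms(4) show False
      by (metis dvd_trans)
  qed
  then have "h dvd 1"
    using assms(1) k by (auto simp: Factorial_Ring.irreducible_def)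
  then obtain g where "1 = h * g" by (auto elim: dvdE)
  moreover have "0 - (- g) * h \<in> J"
    using closed[OF closed[OF h(1) h(1), of 1] h(1), of "- g"] by simp
  ultimately show ?thesis
    by (simp add: mult.commute)
qed

abbreviation lift_poly :: "'f::{field, finite} poly \<Rightarrow> 'f alg_closure poly" where
  "lift_poly \<equiv> map_poly to_ac"

lemma lift_poly_simps [simp]:
  "lift_poly (pCons a P) = pCons (to_ac a) (lift_poly P)"
  "lift_poly (P + Q) = lift_poly P + lift_poly Q"
  "lift_poly (- P) = - lift_poly P"
  "lift_poly (P - Q) = lift_poly P - lift_poly Q"
  "lift_poly (P * Q) = lift_poly P * lift_poly Q"
  "lift_poly 1 = 1"
  "Polynomial.degree (lift_poly P) = Polynomial.degree P"
  "Polynomial.coeff (lift_poly P) i = to_ac (Polynomial.coeff P i)"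
  by (auto intro!: poly_eqI degree_map_poly simp: coeff_map_poly coeff_pCons coeff_mult to_ac_sum
      split: nat.splits)

lemma lift_poly_eq_0_iff [simp]: "lift_poly P = 0 \<longleftrightarrow> P = 0"
  by (simp add: poly_eq_iff)

text \<open>
  For \<open>k > 0\<close> a polynomial has all its coefficients in the field with \<open>q\<^sup>k\<close> elements iff it satisfies
  \<open>frob_poly k P = P\<close>. This equation expresses below that \<open>P\<close> is defined over that field.
\<close>
definition frob_poly ::
    "nat \<Rightarrow> 'f::{field, finite} alg_closure poly \<Rightarrow> 'f alg_closure poly" where
  "frob_poly k = map_poly (frob k)"

lemma frob_poly_simps [simp]:
  "frob_poly k (pCons a P) = pCons (frob k a) (frob_poly k P)"
  "frob_poly k 0 = 0"
  "frob_poly k (P + Q) = frob_poly k P + frob_poly k Q"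
  "frob_poly k (- P) = - frob_poly k P"
  "frob_poly k (P - Q) = frob_poly k P - frob_poly k Q"
  "frob_poly k (P * Q) = frob_poly k P * frob_poly k Q"
  "frob_poly k (Polynomial.smult a P) = Polynomial.smult (frob k a) (frob_poly k P)"
  "frob_poly k (lift_poly R) = lift_poly R"
  "Polynomial.degree (frob_poly k P) = Polynomial.degree P"
  "Polynomial.coeff (frob_poly k P) i = frob k (Polynomial.coeff P i)"
  by (auto intro!: poly_eqI degree_map_poly simp: frob_poly_def coeff_map_poly coeff_pCons coeff_mult
      frob_sum frob_mult frob_add frob_minus frob_diff split: nat.splits)

lemma frob_poly_eq_iff: "frob_poly k P = P \<longleftrightarrow> (\<forall>i. frob k (Polynomial.coeff P i) = Polynomial.coeff P i)"
  by (metis frob_poly_simps(10) poly_eqI)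

lemma frob_poly_dvd: "frob_poly m P = P \<Longrightarrow> m dvd n \<Longrightarrow> frob_poly n P = P"
  unfolding frob_poly_eq_iff by (metis dvd_def frob_multiple mult.commute)

lemma poly_frob_poly: "poly (frob_poly k P) (frob k x) = frob k (poly P x)"
  by (induction P) (auto simp: frob_add frob_mult)

lemma irreducible_dvd_of_common_root:
  fixes p a :: "'f::{field, finite} poly"
  assumes "Factorial_Ring.irreducible p" "poly (lift_poly p) x = 0" "poly (lift_poly a) x = 0"
  shows "p dvd a"
proof (rule ccontr)
  assume "\<not> p dvd a"
  then have "1 \<in> {a :: 'f poly. poly (lift_poly a) x = 0}"
    using assms by (intro one_in_poly_ideal[of p _ a]) auto
  then show False by simp
qed

lemma card_bounded_polys:
  fixes G :: "'a::zero set"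
  assumes "finite G" "0 \<in> G" "d > 0"
  shows "card {P. Polynomial.degree P < d \<and> range (Polynomial.coeff P) \<subseteq> G} = card G ^ d"
    and "finite {P. Polynomial.degree P < d \<and> range (Polynomial.coeff P) \<subseteq> G}"
proof -
  let ?A = "{P. Polynomial.degree P < d \<and> range (Polynomial.coeff P) \<subseteq> G}"
  let ?f = "\<lambda>P. restrict (Polynomial.coeff P) {..<d}"
  have "bij_betw ?f ?A ({..<d} \<rightarrow>\<^sub>E G)"
    unfolding bij_betw_def
  proof (intro conjI inj_onI equalityI subsetI)
    fix P Q assume PQ: "P \<in> ?A" "Q \<in> ?A" "?f P = ?f Q"
    show "P = Q"
    proof (rule poly_eqI)
      fix i
      show "Polynomial.coeff P i = Polynomial.coeff Q i"
        using PQ(1,2) fun_cong[OF PQ(3), of i] by (cases "i < d") (auto simp: coeff_eq_0)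
    qed
  next
    fix g assume g: "g \<in> {..<d} \<rightarrow>\<^sub>E G"
    define P where "P = Abs_poly (\<lambda>i. if i < d then g i else 0)"
    have P: "Polynomial.coeff P i = (if i < d then g i else 0)" for i
      unfolding P_def by (subst coeff_Abs_poly[of "d"]) auto
    have "Polynomial.degree P < d"
      using assms(3) by (auto intro!: degree_lessI simp: P)
    then have "P \<in> ?A" "g = ?f P"
      using g assms(2) by (auto simp: P fun_eq_iff PiE_iff extensional_def)
    then show "g \<in> ?f ` ?A" by blast
  qed (auto split: if_splits)
  moreover have "card ({..<d} \<rightarrow>\<^sub>E G) = card G ^ d" "finite ({..<d} \<rightarrow>\<^sub>E G)"
    using assms by (simp_all add: card_PiE finite_PiE)
  ultimately show "card ?A = card G ^ d" "finite ?A"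
    by (auto simp: bij_betw_same_card bij_betw_finite)
qed

text \<open>
  The \<open>q\<^sup>d\<close> polynomials of degree less than \<open>d\<close> take distinct values at \<open>x\<close>, so \<open>x\<close> does not lie in
  a field with fewer than \<open>q\<^sup>d\<close> elements; and among the first \<open>d + 1\<close> conjugates of \<open>x\<close> two coincide, because
  \<open>p\<close> has at most \<open>d\<close> roots.
\<close>
lemma frob_period_root:
  fixes p :: "'f::{field, finite} poly"
  assumes irr: "Factorial_Ring.irreducible p" and x: "poly (lift_poly p) x = 0"
  shows "frob_period x (Polynomial.degree p)"
proof -
  define d where "d = Polynomial.degree p"
  have "p \<noteq> 0" using irr by auto
  have "d > 0"
    unfolding d_def
  proof (rule Nat.gr0I)
    assume "Polynomial.degree p = 0"
    then obtain a where "p = [:a:]" by (auto elim: degree_eq_zeroE)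
    with x \<open>p \<noteq> 0\<close> show False by simp
  qed
  have no: "frob k x \<noteq> x" if k: "0 < k" "k < d" for k
  proof
    assume fx: "frob k x = x"
    let ?A = "{P :: 'f poly. Polynomial.degree P < d \<and> range (Polynomial.coeff P) \<subseteq> UNIV}"
    let ?f = "\<lambda>a. poly (lift_poly a) x"
    have img: "?f ` ?A \<subseteq> carrier (GF k)"
      using poly_frob_poly[of k "lift_poly a" x for a] fx by (auto simp: carrier_GF)
    have "CARD('f) ^ k < CARD('f) ^ d"
      using k CARD_gt_1[where 'f='f] by simp
    then have less: "card (carrier (GF k :: 'f alg_closure ring)) < card ?A"
      using card_bounded_polys(1)[of "UNIV :: 'f set" d] \<open>d > 0\<close> k by (simp add: card_carrier_GF)
    have "\<not> inj_on ?f ?A"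
    proof
      assume "inj_on ?f ?A"
      from card_inj_on_le[OF this img finite_carrier_GF[OF k(1)]] less show False
        by simp
    qed
    then obtain a b where ab: "a \<in> ?A" "b \<in> ?A" "?f a = ?f b" "a \<noteq> b"
      by (auto simp: inj_on_def)
    then have "p dvd (a - b)"
      by (intro irreducible_dvd_of_common_root[OF irr x]) simp
    moreover have "Polynomial.degree (a - b) < d"
      using ab degree_diff_less by blast
    ultimately show False
      using ab(4) dvd_imp_degree_le[of p "a - b"] by (simp add: d_def)
  qed
  have img: "(\<lambda>i. frob i x) ` {..d} \<subseteq> {y. poly (lift_poly p) y = 0}"
    using poly_frob_poly[of i "lift_poly p" x for i] x by auto
  have fin: "finite {y. poly (lift_poly p) y = 0}"
    using \<open>p \<noteq> 0\<close> by (intro poly_roots_finite) simp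
  have less: "card {y. poly (lift_poly p) y = 0} < card {..d}"
    using card_poly_roots_bound[of "lift_poly p"] \<open>p \<noteq> 0\<close> by (simp add: d_def)
  have "\<not> inj_on (\<lambda>i. frob i x) {..d}"
    using card_inj_on_le[OF _ img fin] less leD by blast
  then obtain i j where ij: "i \<le> d" "j \<le> d" "frob i x = frob j x" "i < j"
    unfolding inj_on_def by (metis atMost_iff linorder_neqE_nat)
  then have "frob i (frob (j - i) x) = frob i x"
    by (simp add: frob_frob)
  then have eq: "frob (j - i) x = x"
    by simp
  with no[of "j - i"] ij have "j - i = d"
    by (metis diff_le_self le_neq_implies_less le_trans zero_less_diff)
  with eq show ?thesis
    using no \<open>d > 0\<close> unfolding d_def[symmetric] by (intro frob_periodI) auto
qed


section \<open>The action of polynomials through \<open>t + \<tau>\<^sup>n\<close>\<close>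

definition Phi ::
    "nat \<Rightarrow> 'f::{field, finite} alg_closure \<Rightarrow> 'f alg_closure \<Rightarrow> 'f alg_closure" where
  "Phi n t v = t * v + frob n v"

text \<open>
  Substitution of \<open>t + \<tau>\<^sup>n\<close> for the variable, with the coefficients on the left. They are arbitrary
  elements of the algebraic closure, so this extends the Drinfeld module beyond \<open>F\<^sub>q[T]\<close>.
\<close>
definition act ::
    "nat \<Rightarrow> 'f::{field, finite} alg_closure \<Rightarrow> 'f alg_closure poly \<Rightarrow> 'f alg_closure \<Rightarrow> 'f alg_closure"
  where
  "act n t P v = (\<Sum>j\<le>Polynomial.degree P. Polynomial.coeff P j * (Phi n t ^^ j) v)"

lemma Phi_add: "Phi n t (v + w) = Phi n t v + Phi n t w"
  by (simp add: Phi_def frob_add algebra_simps)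

lemma Phi_semilinear: "frob n a = a \<Longrightarrow> Phi n t (a * v) = a * Phi n t v"
  by (simp add: Phi_def frob_mult algebra_simps)

lemma Phi_zero [simp]: "Phi n t 0 = 0"
  by (simp add: Phi_def)

lemma frob_Phi: "frob k (Phi n t v) = Phi n (frob k t) (frob k v)"
  by (simp add: Phi_def frob_add frob_mult frob_frob add.commute)

lemma act_altdef:
  "Polynomial.degree P \<le> N \<Longrightarrow> act n t P v = (\<Sum>j\<le>N. Polynomial.coeff P j * (Phi n t ^^ j) v)"
  unfolding act_def by (intro sum.mono_neutral_left) (auto simp: coeff_eq_0)

lemma act_pCons: "act n t (pCons a P) v = a * v + act n t P (Phi n t v)"
proof -
  have "act n t (pCons a P) v =
      (\<Sum>j\<le>Suc (Polynomial.degree P). Polynomial.coeff (pCons a P) j * (Phi n t ^^ j) v)"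
    by (rule act_altdef) (rule degree_pCons_le)
  also have "\<dots> = a * v + act n t P (Phi n t v)"
    by (subst sum.atMost_Suc_shift) (simp add: act_def funpow_swap1)
  finally show ?thesis .
qed

lemma act_0 [simp]: "act n t 0 v = 0"
  by (simp add: act_def)

lemma act_add_left: "act n t (P + Q) v = act n t P v + act n t Q v"
  by (induction P Q arbitrary: v rule: poly_induct2) (simp_all add: act_pCons algebra_simps)

lemma act_smult: "act n t (Polynomial.smult a P) v = a * act n t P v"
  by (induction P arbitrary: v) (simp_all add: act_pCons algebra_simps)

lemma act_minus_left: "act n t (- P) v = - act n t P v"
  using act_smult[of n t "-1" P v] by simp

lemma act_diff_left: "act n t (P - Q) v = act n t P v - act n t Q v"
  using act_add_left[of n t P "- Q"] by (simp add: act_minus_left)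

lemma act_add_right: "act n t P (v + w) = act n t P v + act n t P w"
  by (induction P arbitrary: v w) (simp_all add: act_pCons Phi_add algebra_simps)

lemma act_zero_right [simp]: "act n t P 0 = 0"
  by (induction P) (simp_all add: act_pCons)

lemma act_minus_right: "act n t P (- v) = - act n t P v"
  using act_add_right[of n t P v "- v"] by (simp add: eq_neg_iff_add_eq_0 add.commute)

lemma act_sum_right: "act n t P (sum f A) = (\<Sum>x\<in>A. act n t P (f x))"
  by (induction A rule: infinite_finite_induct) (auto simp: act_add_right)

lemma act_scalar: "frob n a = a \<Longrightarrow> act n t P (a * v) = a * act n t P v"
  by (induction P arbitrary: v) (simp_all add: act_pCons Phi_semilinear distrib_left)

lemma act_Phi: "frob_poly n Q = Q \<Longrightarrow> act n t Q (Phi n t v) = Phi n t (act n t Q v)"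
  by (induction Q arbitrary: v) (simp_all add: act_pCons Phi_add Phi_semilinear)

text \<open>
  Constants from the field with \<open>q\<^sup>n\<close> elements commute with \<open>\<tau>\<^sup>n\<close> and hence with \<open>t + \<tau>\<^sup>n\<close>,
  so polynomials with such coefficients act multiplicatively.
\<close>
lemma act_mult: "frob_poly n Q = Q \<Longrightarrow> act n t (P * Q) v = act n t P (act n t Q v)"
proof (induction P arbitrary: v)
  case (pCons a P)
  then show ?case
    by (simp add: act_add_left act_smult act_pCons act_Phi)
qed simp

lemma frob_act: "frob k (act n t P v) = act n (frob k t) (frob_poly k P) (frob k v)"
  by (induction P arbitrary: v) (simp_all add: act_pCons frob_add frob_mult frob_Phi)

lemma act_mult_linear: "act n t (G * [:- t, 1:]) v = act n (frob n t) G (frob n v)"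
proof (induction G arbitrary: v)
  case (pCons a G)
  have "act n t (pCons a G * [:- t, 1:]) v =
      act n t (Polynomial.smult a [:- t, 1:]) v + act n t (G * [:- t, 1:]) (Phi n t v)"
    by (simp add: act_add_left act_pCons del: smult_pCons mult_pCons_right)
  also have "\<dots> = a * frob n v + act n (frob n t) G (frob n (Phi n t v))"
    by (simp add: pCons.IH act_smult act_pCons del: smult_pCons mult_pCons_right)
      (simp add: Phi_def)
  finally show ?case
    by (simp add: act_pCons frob_Phi)
qed simp

text \<open>
  The linear factor of the root \<open>t\<close> acts as \<open>\<tau>\<^sup>n\<close>, and moving \<open>\<tau>\<^sup>n\<close> to the right replaces \<open>t\<close> by
  its conjugate in the remaining factors.
\<close>
lemma act_prod_conjugates:
  "act n t (\<Prod>i<k. [:- frob (n * i) t, 1:]) v = frob (n * k) v"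
proof (induction k arbitrary: t v)
  case 0
  then show ?case by (simp add: act_pCons flip: one_pCons) (simp add: one_pCons act_pCons)
next
  case (Suc k)
  have eq: "(\<Prod>i<Suc k. [:- frob (n * i) t, 1:]) =
      (\<Prod>i<k. [:- frob (n * i) (frob n t), 1:]) * [:- t, 1:]"
    by (subst prod.lessThan_Suc_shift)
      (simp add: frob_frob add.commute mult.commute[of "[:- t, 1:]"]
        del: mult_pCons_left mult_pCons_right)
  show ?case
    by (subst eq, subst act_mult_linear, subst Suc.IH) (simp add: frob_frob add.commute)
qed

lemma poly_eq_prod_distinct_roots:
  fixes P :: "'a::field poly"
  assumes "Polynomial.lead_coeff P = 1" "Polynomial.degree P = k"
    and "inj_on x {..<k}" "\<And>i. i < k \<Longrightarrow> poly P (x i) = 0"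
  shows "P = (\<Prod>i<k. [:- x i, 1:])"
proof (cases "k = 0")
  case True
  then show ?thesis
    using assms(1,2) by (auto elim!: degree_eq_zeroE simp: one_pCons)
next
  case False
  have "Polynomial.lead_coeff (\<Prod>i<k. [:- x i, 1:]) = 1"
    by (subst lead_coeff_prod) simp
  moreover have "Polynomial.degree (\<Prod>i<k. [:- x i, 1:]) = k"
    by (subst degree_prod_eq_sum_degree) auto
  ultimately show ?thesis
    using assms False
    by (intro poly_eqI_degree_lead_coeff[where n = k and A = "x ` {..<k}"])
      (auto simp: card_image poly_prod)
qed

text \<open>
  The additive polynomial in \<open>v\<close> through which \<open>P\<close> acts; its derivative is the constant \<open>P(t)\<close>,
  because \<open>\<tau>\<^sup>n\<close> has derivative zero.
\<close>
lemma act_as_poly: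
  fixes t :: "'f::{field, finite} alg_closure"
  assumes "n > 0"
  shows "P \<noteq> 0 \<Longrightarrow> \<exists>G. Polynomial.degree G = CARD('f) ^ (n * Polynomial.degree P) \<and>
      (\<forall>v. poly G v = act n t P v) \<and> pderiv G = [:poly P t:]"
proof (induction P)
  case (pCons a P)
  let ?F = "[:0, t:] + Polynomial.monom 1 (CARD('f) ^ n)"
  have big: "CARD('f) ^ k > 1" if "k > 0" for k
    using CARD_gt_1[where 'f='f] that one_less_power by blast
  show ?case
  proof (cases "P = 0")
    case True
    then show ?thesis
      using pCons by (intro exI[of _ "[:0, a:]"]) (auto simp: act_pCons pderiv_pCons)
  next
    case False
    then obtain G where G: "Polynomial.degree G = CARD('f) ^ (n * Polynomial.degree P)"
        "\<And>v. poly G v = act n t P v" "pderiv G = [:poly P t:]"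
      using pCons by auto
    have F: "Polynomial.degree ?F = CARD('f) ^ n"
      using big[OF assms] by (subst degree_add_eq_right) (auto simp: degree_monom_eq)
    have deg: "Polynomial.degree (pcompose G ?F) = CARD('f) ^ (n * Polynomial.degree (pCons a P))"
      using False by (simp add: degree_pcompose F G algebra_simps power_add)
    have "Polynomial.degree ([:0, a:] + pcompose G ?F) = Polynomial.degree (pcompose G ?F)"
      using big[of "n * Polynomial.degree (pCons a P)"] assms False
      by (intro degree_add_eq_right) (simp only: deg, auto)
    moreover have "pderiv ([:0, a:] + pcompose G ?F) = [:poly (pCons a P) t:]"
      using assms by (simp add: pderiv_add pderiv_pcompose G pderiv_frobenius_monom pderiv_pCons)
    moreover have "poly ([:0, a:] + pcompose G ?F) v = act n t (pCons a P) v" for v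
      by (simp add: poly_pcompose G act_pCons poly_monom Phi_def frob_def mult.commute)
    ultimately show ?thesis
      using deg by auto
  qed
qed simp

lemma card_act_kernel:
  fixes t :: "'f::{field, finite} alg_closure"
  assumes "n > 0" "poly P t \<noteq> 0"
  shows "card {v. act n t P v = 0} = CARD('f) ^ (n * Polynomial.degree P)"
proof -
  have "P \<noteq> 0" using assms by auto
  from act_as_poly[OF assms(1) this, of t] card_roots_of_const_pderiv assms(2) show ?thesis
    by (metis (no_types, lifting) Collect_cong)
qed

lemma card_act_kernel_le:
  fixes t :: "'f::{field, finite} alg_closure"
  assumes "n > 0" "P \<noteq> 0"
  shows "finite {v. act n t P v = 0}"
    and "card {v. act n t P v = 0} \<le> CARD('f) ^ (n * Polynomial.degree P)"
proof -
  obtain G where G: "Polynomial.degree G = CARD('f) ^ (n * Polynomial.degree P)"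
      "\<And>v. poly G v = act n t P v"
    using act_as_poly[OF assms, of t] by auto
  have "G \<noteq> 0"
    using G(1) by auto
  then show "finite {v. act n t P v = 0}"
      "card {v. act n t P v = 0} \<le> CARD('f) ^ (n * Polynomial.degree P)"
    using poly_roots_finite[of G] card_poly_roots_bound[of G] by (simp_all add: G)
qed


section \<open>Endomorphisms of the torsion\<close>

definition polys_below :: "nat \<Rightarrow> nat \<Rightarrow> 'f::{field, finite} alg_closure poly set" where
  "polys_below m d = {P. Polynomial.degree P < d \<and> frob_poly m P = P}"

lemma polys_below_altdef:
  "polys_below m d =
    {P :: 'f::{field, finite} alg_closure poly.
      Polynomial.degree P < d \<and> range (Polynomial.coeff P) \<subseteq> carrier (GF m)}"
  by (auto simp: polys_below_def frob_poly_eq_iff carrier_GF)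

lemma card_polys_below:
  assumes "m > 0" "d > 0"
  shows "card (polys_below m d :: 'f::{field, finite} alg_closure poly set) = CARD('f) ^ (m * d)"
    and "finite (polys_below m d :: 'f alg_closure poly set)"
  using card_bounded_polys[of "carrier (GF m :: 'f alg_closure ring)" d] assms
    finite_carrier_GF[OF assms(1), where 'f='f] card_carrier_GF[OF assms(1), where 'f='f]
  unfolding polys_below_altdef by (simp_all add: carrier_GF power_mult)

text \<open>
  Division with remainder by the monic \<open>p\<close> does not leave the field of the coefficients of \<open>P\<close>.
\<close>
lemma reduce_modulo:
  fixes p :: "'f::{field, finite} poly"
  assumes "Polynomial.lead_coeff p = 1" "Polynomial.degree p > 0" "frob_poly m P = P"
  shows "\<exists>S\<in>polys_below m (Polynomial.degree p). \<exists>Q. frob_poly m Q = Q \<and> P = S + Q * lift_poly p"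
  using assms(3)
proof (induction P)
  case 0
  then show ?case
    using assms(2) by (intro bexI[of _ 0] exI[of _ 0]) (auto simp: polys_below_def)
next
  case (pCons a P)
  then have a: "frob m a = a" and "frob_poly m P = P"
    by auto
  with pCons.IH obtain S Q where S: "Polynomial.degree S < Polynomial.degree p" "frob_poly m S = S"
      and Q: "frob_poly m Q = Q" "P = S + Q * lift_poly p"
    by (auto simp: polys_below_def)
  \<comment> \<open>Multiplying the remainder \<open>S\<close> by the variable can produce a term of degree \<open>deg p\<close>; subtract it.\<close>
  define c where "c = Polynomial.coeff (pCons a S) (Polynomial.degree p)"
  define S' where "S' = pCons a S - Polynomial.smult c (lift_poly p)"
  have c: "frob m c = c"
    using a S(2) unfolding c_def by (metis frob_poly_simps(1) frob_poly_simps(10))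
  have "Polynomial.degree S' < Polynomial.degree p"
  proof (intro degree_lessI allI impI)
    fix i assume i: "Polynomial.degree p \<le> i"
    show "Polynomial.coeff S' i = 0"
    proof (cases "i = Polynomial.degree p")
      case True
      then show ?thesis using assms(1) by (simp add: S'_def c_def)
    next
      case False
      with i have "i > Polynomial.degree p" by simp
      moreover have "Polynomial.degree (pCons a S) \<le> Polynomial.degree p"
        using S(1) degree_pCons_le[of a S] by linarith
      ultimately have "Polynomial.coeff (pCons a S) i = 0" "Polynomial.coeff p i = 0"
        by (auto intro!: coeff_eq_0)
      then show ?thesis by (simp add: S'_def)
    qed
  qed (use assms(2) in auto)
  moreover have "frob_poly m S' = S'"
    using a S(2) c by (simp add: S'_def)
  moreover have "pCons a P = S' + pCons c Q * lift_poly p"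
    unfolding S'_def Q(2) by (simp add: algebra_simps)
  moreover have "frob_poly m (pCons c Q) = pCons c Q"
    using Q(1) c by simp
  ultimately show ?case
    unfolding polys_below_def by blast
qed

lemma monic_dvd_antisym:
  fixes a b :: "'a::field poly"
  assumes "Polynomial.lead_coeff a = 1" "Polynomial.lead_coeff b = 1" "a dvd b" "b dvd a"
  shows "a = b"
proof -
  obtain k where k: "b = a * k" using assms(3) by (auto elim: dvdE)
  have "a \<noteq> 0" "b \<noteq> 0" using assms(1,2) by auto
  then have "k \<noteq> 0" using k by auto
  have "Polynomial.degree b = Polynomial.degree a"
    using assms(3,4) \<open>a \<noteq> 0\<close> \<open>b \<noteq> 0\<close> by (simp add: dvd_imp_degree_le le_antisym)
  then have "Polynomial.degree k = 0"
    using k \<open>a \<noteq> 0\<close> \<open>k \<noteq> 0\<close> by (simp add: degree_mult_eq)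
  moreover have "Polynomial.lead_coeff k = 1"
    using assms(1,2) k by (simp add: lead_coeff_mult)
  ultimately have "k = 1"
    by (auto elim!: degree_eq_zeroE simp: one_pCons)
  then show ?thesis using k by simp
qed

text \<open>
  The Drinfeld module enters only through its value \<open>t + \<tau>\<^sup>n\<close> at \<open>T\<close>, so its torsion can be studied with
  plain functions on the algebraic closure.
\<close>
locale drinfeld_setting =
  fixes n r d :: nat and t :: "'f::{field, finite} alg_closure" and p\<^sub>0 p :: "'f poly"
  assumes n_pos: "n > 0"
    and monic_p0: "Polynomial.lead_coeff p\<^sub>0 = 1"
    and irreducible_p0: "Factorial_Ring.irreducible p\<^sub>0"
    and degree_p0: "Polynomial.degree p\<^sub>0 = r"
    and coprime_n_r: "coprime n r"
    and root_p0: "poly (lift_poly p\<^sub>0) t = 0"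
    and monic_p: "Polynomial.lead_coeff p = 1"
    and irreducible_p: "Factorial_Ring.irreducible p"
    and degree_p: "Polynomial.degree p = d"
    and p_neq_p0: "p \<noteq> p\<^sub>0"
begin

abbreviation pact :: "'f alg_closure poly \<Rightarrow> 'f alg_closure \<Rightarrow> 'f alg_closure" where
  "pact \<equiv> act n t"

abbreviation aact :: "'f poly \<Rightarrow> 'f alg_closure \<Rightarrow> 'f alg_closure" where
  "aact a \<equiv> act n t (lift_poly a)"

definition torsion :: "'f alg_closure set" where
  "torsion = {v. aact p v = 0}"

lemma frob_t: "frob r t = t"
  using frob_period_root[OF irreducible_p0 root_p0] by (simp add: frob_period_def degree_p0)

lemma frob_t_multiple: "frob (r * i) t = t"
  using frob_multiple[OF frob_t, of i] by (simp add: mult.commute)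

lemma irreducible_degree_pos:
  assumes "Factorial_Ring.irreducible a" shows "Polynomial.degree (a :: 'f poly) > 0"
proof (rule Nat.gr0I)
  assume "Polynomial.degree a = 0"
  with assms have "a dvd 1"
    by (metis is_unit_iff_degree not_irreducible_zero)
  with assms show False
    by (simp add: irreducible_not_unit)
qed

lemma r_pos: "r > 0" and d_pos: "d > 0"
  using irreducible_degree_pos irreducible_p0 irreducible_p degree_p0 degree_p by auto

text \<open>
  The coefficient of \<open>\<tau>\<^sup>0\<close> in \<open>\<phi>\<^sub>p\<close> is \<open>p(t)\<close>; that it does not vanish means that the additive
  polynomial \<open>\<phi>\<^sub>p\<close> is separable.
\<close>
lemma p_t_nonzero: "poly (lift_poly p) t \<noteq> 0"
proof
  assume "poly (lift_poly p) t = 0"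
  then have "p dvd p\<^sub>0" "p\<^sub>0 dvd p"
    using irreducible_dvd_of_common_root irreducible_p irreducible_p0 root_p0 by blast+
  then have "p = p\<^sub>0"
    using monic_p monic_p0 by (intro monic_dvd_antisym) auto
  with p_neq_p0 show False ..
qed

lemma card_torsion: "card torsion = CARD('f) ^ (n * d)"
  using card_act_kernel[OF n_pos p_t_nonzero] by (simp add: torsion_def degree_p)

lemma finite_torsion: "finite torsion"
  by (rule card_ge_0_finite) (simp add: card_torsion)

lemma aact_mult: "aact (a * b) v = aact a (aact b v)"
  by (simp add: act_mult)

lemma pact_aact: "frob_poly n P = P \<Longrightarrow> pact P (aact a v) = aact a (pact P v)"
  by (metis act_mult frob_poly_simps(8) mult.commute)

lemma frob_aact: "frob (r * i) (aact a v) = aact a (frob (r * i) v)"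
  by (simp add: frob_act frob_t_multiple)

lemma frob_pact: "frob (r * i) (pact P v) = pact (frob_poly (r * i) P) (frob (r * i) v)"
  by (simp add: frob_act frob_t_multiple)

lemma torsion_zero: "0 \<in> torsion"
  and torsion_add: "v \<in> torsion \<Longrightarrow> w \<in> torsion \<Longrightarrow> v + w \<in> torsion"
  and torsion_minus: "v \<in> torsion \<Longrightarrow> - v \<in> torsion"
  and torsion_scalar: "frob n z = z \<Longrightarrow> v \<in> torsion \<Longrightarrow> z * v \<in> torsion"
  and torsion_pact: "frob_poly n P = P \<Longrightarrow> v \<in> torsion \<Longrightarrow> pact P v \<in> torsion"
  and torsion_frob: "v \<in> torsion \<Longrightarrow> frob (r * i) v \<in> torsion"
  by (simp_all add: torsion_def act_add_right act_minus_right act_scalar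
      flip: pact_aact frob_aact)

lemma torsion_aact: "v \<in> torsion \<Longrightarrow> aact a v \<in> torsion"
  by (rule torsion_pact) simp

lemma torsion_sum: "(\<And>i. i \<in> A \<Longrightarrow> f i \<in> torsion) \<Longrightarrow> sum f A \<in> torsion"
  by (induction A rule: infinite_finite_induct) (auto simp: torsion_zero torsion_add)

lemma frob_torsion: "frob (r * i) ` torsion = torsion"
proof (rule endo_inj_surj[OF finite_torsion])
  show "inj_on (frob (r * i)) torsion"
    by (rule inj_onI) simp
qed (auto simp: torsion_frob)

text \<open>
  The conjugates of \<open>t\<close> under \<open>\<tau>\<^sup>n\<close> are all the roots of \<open>p\<^sub>0\<close>, because \<open>n\<close> is prime to \<open>r\<close>.
\<close>
lemma aact_p0: "aact p\<^sub>0 v = frob (n * r) v"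
proof -
  have "lift_poly p\<^sub>0 = (\<Prod>i<r. [:- frob (n * i) t, 1:])"
  proof (rule poly_eq_prod_distinct_roots)
    show "inj_on (\<lambda>i. frob (n * i) t) {..<r}"
      using frob_period_root[OF irreducible_p0 root_p0] coprime_n_r
      by (intro inj_on_frob_multiples) (simp_all add: degree_p0)
    show "poly (lift_poly p\<^sub>0) (frob (n * i) t) = 0" for i
      using poly_frob_poly[of "n * i" "lift_poly p\<^sub>0" t] by (simp add: root_p0)
  qed (use monic_p0 degree_p0 in auto)
  then show ?thesis
    by (simp only: act_prod_conjugates)
qed

text \<open>
  A nonzero polynomial of degree \<open>k\<close> acts as an additive polynomial of degree \<open>q\<^sup>n\<^sup>k\<close>, which has
  fewer than \<open>q\<^sup>n\<^sup>d\<close> zeros if \<open>k < d\<close>.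
\<close>
lemma faithful:
  assumes "Polynomial.degree P < d" "\<And>v. v \<in> torsion \<Longrightarrow> pact P v = 0"
  shows "P = 0"
proof (rule ccontr)
  assume "P \<noteq> 0"
  have "card torsion \<le> card {v. pact P v = 0}"
    using assms(2) by (intro card_mono card_act_kernel_le(1)[OF n_pos \<open>P \<noteq> 0\<close>]) auto
  also have "\<dots> \<le> CARD('f) ^ (n * Polynomial.degree P)"
    by (rule card_act_kernel_le(2)[OF n_pos \<open>P \<noteq> 0\<close>])
  also have "\<dots> < CARD('f) ^ (n * d)"
    using assms(1) n_pos CARD_gt_1[where 'f='f] by simp
  finally show False
    by (simp add: card_torsion)
qed

text \<open>
  Moved past the \<open>i\<close>-th power of \<open>\<pi>\<close>, a generator \<open>\<zeta>\<close> of the field with \<open>q\<^sup>n\<close> elements becomes its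
  conjugate \<open>\<zeta>^(q^(ri))\<close>. These conjugates are distinct for \<open>i < n\<close>, as \<open>r\<close> is prime to \<open>n\<close>, so
  precomposing with the powers of \<open>\<zeta>\<close> separates the summands.
\<close>
lemma frob_independent:
  assumes P: "\<And>i. i < n \<Longrightarrow> frob_poly n (P i) = P i"
    and zero: "\<And>v. v \<in> torsion \<Longrightarrow> (\<Sum>i<n. pact (P i) (frob (r * i) v)) = 0"
    and i: "i < n" and v: "v \<in> torsion"
  shows "pact (P i) v = 0"
proof -
  obtain z :: "'f alg_closure" where z: "frob_period z n"
    using exists_frob_period n_pos by blast
  then have zn: "frob n z = z" by (simp add: frob_period_def)
  have inj: "inj_on (\<lambda>i. frob (r * i) z) {..<n}"
    using coprime_n_r by (intro inj_on_frob_multiples z) (simp add: coprime_commute)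
  have "v \<in> frob (r * i) ` torsion"
    using v by (simp add: frob_torsion)
  then obtain w where w: "w \<in> torsion" "v = frob (r * i) w"
    by blast
  define u where "u = (\<lambda>i. pact (P i) (frob (r * i) w))"
  have pow: "(\<Sum>i<n. frob (r * i) z ^ k * u i) = 0" for k
  proof -
    have fz: "frob n (z ^ k) = z ^ k"
      by (simp add: frob_power zn)
    then have "0 = (\<Sum>i<n. pact (P i) (frob (r * i) (z ^ k * w)))"
      using zero[OF torsion_scalar] w by simp
    also have "\<dots> = (\<Sum>i<n. frob (r * i) z ^ k * u i)"
    proof (rule sum.cong)
      fix i
      have "frob n (frob (r * i) z) = frob (r * i) z"
        by (metis add.commute frob_frob zn)
      then have "frob n (frob (r * i) z ^ k) = frob (r * i) z ^ k"
        by (simp add: frob_power)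
      then show "pact (P i) (frob (r * i) (z ^ k * w)) = frob (r * i) z ^ k * u i"
        by (simp add: frob_mult frob_power u_def act_scalar)
    qed simp
    finally show ?thesis by simp
  qed
  have poly0: "(\<Sum>i<n. poly g (frob (r * i) z) * u i) = 0" for g
  proof -
    have "(\<Sum>i<n. poly g (frob (r * i) z) * u i) =
        (\<Sum>k\<le>Polynomial.degree g. Polynomial.coeff g k * (\<Sum>i<n. frob (r * i) z ^ k * u i))"
      unfolding poly_altdef sum_distrib_left sum_distrib_right
      by (subst sum.swap) (simp add: mult.assoc)
    then show ?thesis by (simp add: pow)
  qed
  \<comment> \<open>By linearity powers of the conjugates may be replaced by any polynomial; this one isolates index \<open>i\<close>.\<close>
  define g where "g = (\<Prod>j\<in>{..<n} - {i}. [:- frob (r * j) z, 1:])"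
  have "(\<Sum>j<n. poly g (frob (r * j) z) * u j) = poly g (frob (r * i) z) * u i"
    using i by (subst sum.remove[of _ i]) (auto simp: g_def poly_prod intro!: sum.neutral)
  with poly0[of g] have "poly g (frob (r * i) z) * u i = 0" by simp
  moreover have "poly g (frob (r * i) z) \<noteq> 0"
    using inj i by (auto simp: g_def poly_prod inj_on_def)
  ultimately show ?thesis
    by (simp add: u_def w)
qed

definition op_sum :: "(nat \<Rightarrow> 'f alg_closure poly) \<Rightarrow> 'f alg_closure \<Rightarrow> 'f alg_closure" where
  "op_sum P = (\<lambda>v\<in>torsion. \<Sum>i<n. pact (P i) (frob (r * i) v))"

text \<open>
  Commuting with every \<open>\<phi>\<^sub>a\<close> is linearity over \<open>A/p\<close>. Functions are undefined off the torsion, as in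
  \<^const>\<open>module_End\<close>.
\<close>
definition endos :: "('f alg_closure \<Rightarrow> 'f alg_closure) set" where
  "endos = {f \<in> torsion \<rightarrow>\<^sub>E torsion.
     (\<forall>v\<in>torsion. \<forall>w\<in>torsion. f (v + w) = f v + f w) \<and>
     (\<forall>a. \<forall>v\<in>torsion. f (aact a v) = aact a (f v))}"

lemma op_sum_in_endos:
  assumes "\<And>i. i < n \<Longrightarrow> frob_poly n (P i) = P i"
  shows "op_sum P \<in> endos"
  unfolding endos_def
proof (intro CollectI conjI ballI allI)
  show "op_sum P \<in> torsion \<rightarrow>\<^sub>E torsion"
    unfolding op_sum_def using assms
    by (auto intro!: torsion_sum torsion_pact torsion_frob)
  show "op_sum P (v + w) = op_sum P v + op_sum P w" if "v \<in> torsion" "w \<in> torsion" for v w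
    using that by (simp add: op_sum_def torsion_add frob_add act_add_right sum.distrib)
  show "op_sum P (aact a v) = aact a (op_sum P v)" if "v \<in> torsion" for a v
    using that assms
    by (simp add: op_sum_def torsion_aact frob_aact pact_aact act_sum_right)
qed

lemma op_sum_eq_iff:
  assumes P: "\<And>i. i < n \<Longrightarrow> P i \<in> polys_below n d" and Q: "\<And>i. i < n \<Longrightarrow> Q i \<in> polys_below n d"
    and eq: "op_sum P = op_sum Q" and i: "i < n"
  shows "P i = Q i"
proof -
  have "pact (P i - Q i) v = 0" if "v \<in> torsion" for v
  proof (rule frob_independent[of "\<lambda>i. P i - Q i", OF _ _ i that])
    show "frob_poly n (P i - Q i) = P i - Q i" if "i < n" for i
      using P[OF that] Q[OF that] by (simp add: polys_below_def)
    show "(\<Sum>i<n. pact (P i - Q i) (frob (r * i) v)) = 0" if "v \<in> torsion" for v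
      using fun_cong[OF eq, of v] that by (simp add: op_sum_def act_diff_left sum_subtractf)
  qed
  moreover have "Polynomial.degree (P i - Q i) < d"
    using P[OF i] Q[OF i] by (auto simp: polys_below_def intro: degree_diff_less)
  ultimately have "P i - Q i = 0"
    by (intro faithful)
  then show ?thesis by simp
qed

text \<open>
  \<open>W\<close> is a submodule of dimension \<open>k\<close> over \<open>A/p\<close>, measured by its number of elements, and \<open>vs\<close> generates it,
  in the sense that a homomorphism on \<open>W\<close> is determined by its values on \<open>vs\<close>. In this form
  generation bounds the number of endomorphisms.
\<close>
definition generating_list :: "nat \<Rightarrow> 'f alg_closure set \<Rightarrow> 'f alg_closure list \<Rightarrow> bool" where
  "generating_list k W vs \<longleftrightarrow>
     W \<subseteq> torsion \<and> 0 \<in> W \<and> (\<forall>v\<in>W. \<forall>w\<in>W. v - w \<in> W) \<and> (\<forall>a. \<forall>v\<in>W. aact a v \<in> W) \<and>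
     card W = CARD('f) ^ (d * k) \<and> length vs = k \<and> set vs \<subseteq> torsion \<and>
     (\<forall>f\<in>endos. \<forall>g\<in>endos. (\<forall>v\<in>set vs. f v = g v) \<longrightarrow> (\<forall>w\<in>W. f w = g w))"

lemma generating_listD:
  assumes "generating_list k W vs"
  shows "W \<subseteq> torsion" "0 \<in> W" "\<And>v w. v \<in> W \<Longrightarrow> w \<in> W \<Longrightarrow> v - w \<in> W"
    and "\<And>a v. v \<in> W \<Longrightarrow> aact a v \<in> W" "card W = CARD('f) ^ (d * k)"
    and "length vs = k" "set vs \<subseteq> torsion"
    and "\<And>f g w. f \<in> endos \<Longrightarrow> g \<in> endos \<Longrightarrow> (\<And>v. v \<in> set vs \<Longrightarrow> f v = g v) \<Longrightarrow> w \<in> W \<Longrightarrow> f w = g w"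
  using assms unfolding generating_list_def by simp_all

text \<open>
  Over the field \<open>A/p\<close> a generating family can be chosen greedily: a vector outside a proper
  submodule \<open>W\<close> enlarges it by the factor \<open>q\<^sup>d\<close>, because a polynomial prime to \<open>p\<close> that maps \<open>v\<close>
  into \<open>W\<close> already forces \<open>v\<close> to lie in \<open>W\<close>.
\<close>
lemma exists_generating_list: "k \<le> n \<Longrightarrow> \<exists>W vs. generating_list k W vs"
proof (induction k)
  case 0
  have zero: "f 0 = 0" if "f \<in> endos" for f
  proof -
    have "f (0 + 0) = f 0 + f 0"
      using that torsion_zero unfolding endos_def by blast
    then show ?thesis by (simp only: add_0_left add_cancel_right_right)
  qed
  have "generating_list 0 {0} []"
    unfolding generating_list_def by (auto simp: torsion_zero dest!: zero)
  then show ?case by blast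
next
  case (Suc k)
  then obtain W vs where gen: "generating_list k W vs"
    by (auto dest: Suc_leD)
  note W = generating_listD(1-5)[OF gen] and vs = generating_listD(6,7)[OF gen]
    and det = generating_listD(8)[OF gen]
  have "finite W" using W(1) finite_torsion finite_subset by blast
  have "d * k < n * d"
    using Suc.prems d_pos by (simp add: mult.commute)
  then have "card W < card torsion"
    using W(5) CARD_gt_1[where 'f='f] by (simp add: card_torsion)
  then have "W \<noteq> torsion" by blast
  with W(1) obtain v where v: "v \<in> torsion" "v \<notin> W" by blast
  let ?D = "{a :: 'f poly. Polynomial.degree a < d \<and> range (Polynomial.coeff a) \<subseteq> UNIV}"
  let ?h = "\<lambda>(w, a). w + aact a v"
  have inD: "a = 0" if a: "aact a v \<in> W" "Polynomial.degree a < d" for a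
  proof (rule ccontr)
    assume "a \<noteq> 0"
    then have "\<not> p dvd a"
      using a(2) dvd_imp_degree_le degree_p by force
    moreover have "aact (x - z * y) v \<in> W" if "aact x v \<in> W" "aact y v \<in> W" for x y z
      using W(3)[OF that(1) W(4)[OF that(2), of z]]
      by (simp add: act_diff_left act_mult)
    moreover have "aact p v \<in> W"
      using v(1) W(2) by (simp add: torsion_def)
    ultimately have "1 \<in> {a. aact a v \<in> W}"
      using a(1) by (intro one_in_poly_ideal[OF irreducible_p, of _ a]) auto
    then show False
      using v(2) by (simp add: one_pCons act_pCons)
  qed
  have inj: "inj_on ?h (W \<times> ?D)"
  proof (rule inj_onI, clarify)
    fix w a w' a'
    assume A: "w \<in> W" "w' \<in> W" "Polynomial.degree a < d" "Polynomial.degree a' < d"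
      "w + aact a v = w' + aact a' v"
    then have "aact (a - a') v = w' - w"
      by (simp add: act_diff_left algebra_simps)
    then have "a - a' = 0"
      using A W(3) by (intro inD) (auto intro: degree_diff_less)
    with A show "w = w' \<and> a = a'" by simp
  qed
  let ?W' = "?h ` (W \<times> ?D)"
  have mod: "w + aact a v \<in> ?W'" if "w \<in> W" for w a
  proof -
    have "a = a mod p + (a div p) * p" by simp
    then have "aact a v = aact (a mod p) v + aact (a div p) (aact p v)"
      by (metis act_add_left aact_mult lift_poly_simps(2))
    then have "aact a v = aact (a mod p) v"
      using v(1) by (simp add: torsion_def)
    moreover have "Polynomial.degree (a mod p) < d"
      using degree_mod_less'[of p a] d_pos degree_p monic_p by (cases "a mod p = 0"; cases "p = 0") auto
    ultimately show ?thesis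
      using that by (intro image_eqI[of _ _ "(w, a mod p)"]) auto
  qed
  show ?case
    unfolding generating_list_def
  proof (intro exI[of _ ?W'] exI[of _ "v # vs"] conjI ballI allI impI)
    show "?W' \<subseteq> torsion"
      using W(1) v(1) by (auto intro!: torsion_add torsion_aact)
    show "0 \<in> ?W'"
      using mod[OF W(2), of 0] by simp
    show "x - y \<in> ?W'" if xy: "x \<in> ?W'" "y \<in> ?W'" for x y
    proof -
      from xy obtain w a w' a' where "x = w + aact a v" "w \<in> W" "y = w' + aact a' v" "w' \<in> W"
        by auto
      then show ?thesis
        using mod[OF W(3)[of w w'], of "a - a'"] by (simp add: act_diff_left algebra_simps)
    qed
    show "aact a x \<in> ?W'" if x: "x \<in> ?W'" for a x
    proof -
      from x obtain w b where "x = w + aact b v" "w \<in> W"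
        by auto
      then show ?thesis
        using mod[OF W(4), of w a "a * b"] by (simp add: act_add_right act_mult)
    qed
    show "card ?W' = CARD('f) ^ (d * Suc k)"
      using card_bounded_polys(1)[of "UNIV :: 'f set" d] d_pos
      unfolding card_image[OF inj] card_cartesian_product W(5) by (simp add: power_add)
    show "length (v # vs) = Suc k" "set (v # vs) \<subseteq> torsion"
      using vs v by auto
    show "f x = g x"
      if fg: "f \<in> endos" "g \<in> endos" "\<forall>u\<in>set (v # vs). f u = g u" and x: "x \<in> ?W'" for f g x
    proof -
      from x obtain w a where wa: "x = w + aact a v" "w \<in> W" by auto
      have "f x = f w + aact a (f v)" "g x = g w + aact a (g v)"
        using fg(1,2) wa W(1) v(1) by (auto simp: endos_def torsion_aact subset_iff)
      then show ?thesis
        using det[OF fg(1,2) _ wa(2)] fg(3) by simp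
    qed
  qed
qed

lemma card_endos_le:
  "finite endos" "card endos \<le> (CARD('f) ^ (n * d)) ^ n"
proof -
  obtain W vs where gen: "generating_list n W vs"
    using exists_generating_list by blast
  note W = generating_listD(1,5)[OF gen] and vs = generating_listD(6,7)[OF gen]
    and det = generating_listD(8)[OF gen]
  have "W = torsion"
    using W by (intro card_subset_eq finite_torsion) (simp_all add: card_torsion mult.commute)
  let ?L = "{xs. set xs \<subseteq> torsion \<and> length xs = n}"
  have "inj_on (\<lambda>f. map f vs) endos"
  proof (rule inj_onI)
    fix f g assume fg: "f \<in> endos" "g \<in> endos" "map f vs = map g vs"
    then have "f w = g w" if "w \<in> torsion" for w
      using det[OF fg(1,2), of w] that by (simp add: \<open>W = torsion\<close>)
    moreover have "f \<in> extensional torsion" "g \<in> extensional torsion"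
      using fg by (auto simp: endos_def PiE_def)
    ultimately show "f = g"
      by (intro extensionalityI)
  qed
  moreover have "(\<lambda>f. map f vs) ` endos \<subseteq> ?L"
    using vs by (auto simp: endos_def PiE_def Pi_def subset_iff)
  moreover have "finite ?L" "card ?L = (CARD('f) ^ (n * d)) ^ n"
    using finite_lists_length_eq[OF finite_torsion] card_lists_length_eq[OF finite_torsion]
    by (simp_all add: card_torsion)
  ultimately show "finite endos" "card endos \<le> (CARD('f) ^ (n * d)) ^ n"
    using inj_on_finite[of _ endos ?L] card_inj_on_le[of _ endos ?L] by auto
qed

text \<open>
  There are as many families of coefficients as the dimension of the endomorphism ring allows, so
  injectivity of \<^const>\<open>op_sum\<close> implies surjectivity.
\<close>
theorem endos_eq_op_sum:
  assumes "f \<in> endos"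
  obtains P where "\<And>i. i < n \<Longrightarrow> P i \<in> polys_below n d" "f = op_sum P"
proof -
  let ?T = "{..<n} \<rightarrow>\<^sub>E (polys_below n d :: 'f alg_closure poly set)"
  have sub: "op_sum ` ?T \<subseteq> endos"
    by (auto intro!: op_sum_in_endos simp: polys_below_def PiE_def Pi_def)
  have "inj_on op_sum ?T"
  proof (rule inj_onI)
    fix P Q assume PQ: "P \<in> ?T" "Q \<in> ?T" "op_sum P = op_sum Q"
    show "P = Q"
    proof (rule PiE_ext[OF PQ(1,2)])
      fix i assume "i \<in> {..<n}"
      then show "P i = Q i"
        using PQ by (intro op_sum_eq_iff[of P Q]) (auto dest: PiE_mem)
    qed
  qed
  then have "card (op_sum ` ?T) = (CARD('f) ^ (n * d)) ^ n"
    by (simp add: card_image card_PiE card_polys_below n_pos d_pos)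
  then have "op_sum ` ?T = endos"
    using sub card_endos_le by (intro card_seteq) auto
  with assms obtain P where "P \<in> ?T" "f = op_sum P" by blast
  then show ?thesis
    using that[of P] by auto
qed

text \<open>
  Conjugation by \<open>\<pi>\<^sup>m\<close> raises the coefficients to the power \<open>q\<^sup>r\<^sup>m\<close>, so by uniqueness of the
  representation the coefficients are fixed by this map. They lie in the field with \<open>q\<^sup>n\<close> elements, and
  \<open>gcd(rm, n) = m\<close> since \<open>r\<close> is prime to \<open>n\<close> and \<open>m\<close> divides \<open>n\<close>.
\<close>
lemma op_sum_commutes:
  assumes P: "\<And>i. i < n \<Longrightarrow> P i \<in> polys_below n d"
    and comm: "\<And>v. v \<in> torsion \<Longrightarrow> op_sum P (frob (r * m) v) = frob (r * m) (op_sum P v)"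
    and m: "m dvd n" and i: "i < n"
  shows "P i \<in> polys_below m d"
proof -
  define Q where "Q = (\<lambda>i. frob_poly (r * m) (P i))"
  have Q: "Q i \<in> polys_below n d" if "i < n" for i
    using P[OF that]
    by (auto simp: polys_below_def Q_def frob_poly_eq_iff frob_frob)
      (metis add.commute frob_frob frob_poly_eq_iff)
  have "op_sum P = op_sum Q"
  proof
    fix v
    show "op_sum P v = op_sum Q v"
    proof (cases "v \<in> torsion")
      case True
      then have "v \<in> frob (r * m) ` torsion"
        by (simp add: frob_torsion)
      then obtain w where w: "w \<in> torsion" "v = frob (r * m) w" by blast
      have "op_sum P v = frob (r * m) (\<Sum>i<n. pact (P i) (frob (r * i) w))"
        using w comm[OF w(1)] by (simp add: op_sum_def)
      also have "\<dots> = (\<Sum>i<n. pact (Q i) (frob (r * i) v))"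
        by (simp add: frob_sum frob_pact Q_def w frob_frob add.commute)
      finally show ?thesis
        using True by (simp add: op_sum_def)
    qed (simp add: op_sum_def)
  qed
  then have "Q i = P i"
    using op_sum_eq_iff[of P Q i] P Q i by simp
  then have "frob (r * m) (Polynomial.coeff (P i) j) = Polynomial.coeff (P i) j" for j
    by (simp add: Q_def frob_poly_eq_iff)
  moreover have "frob n (Polynomial.coeff (P i) j) = Polynomial.coeff (P i) j" for j
    using P[OF i] by (simp add: polys_below_def frob_poly_eq_iff)
  moreover have "gcd (r * m) n = m"
    using m coprime_n_r
    by (metis coprime_commute gcd_mult_left_left_cancel gcd_nat.absorb1)
  ultimately have "frob_poly m (P i) = P i"
    unfolding frob_poly_eq_iff by (metis frob_gcd)
  then show ?thesis
    using P[OF i] by (simp add: polys_below_def)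
qed

text \<open>
  A root of \<open>p\<close>. Evaluation at \<open>\<theta>\<close> turns operators on the torsion into elements of the algebraic closure.
\<close>
definition \<theta> :: "'f alg_closure" where
  "\<theta> = (SOME x. poly (lift_poly p) x = 0)"

lemma poly_p_theta: "poly (lift_poly p) \<theta> = 0"
  unfolding \<theta>_def using alg_closed_imp_poly_has_root[of "lift_poly p"] d_pos degree_p
  by (intro someI_ex[of "\<lambda>x. poly (lift_poly p) x = 0"]) auto

lemma frob_period_theta: "frob_period \<theta> d"
  using frob_period_root[OF irreducible_p poly_p_theta] by (simp add: degree_p)

text \<open>
  The elements \<open>\<theta>^(q^(mk))\<close> for \<open>k < d\<close> are \<open>d\<close> distinct roots of \<open>P\<close>, because \<open>\<theta>\<close> has period
  \<open>d\<close> and \<open>m\<close> is prime to \<open>d\<close>.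
\<close>
lemma poly_theta_faithful:
  assumes "coprime m d" "P \<in> polys_below m d" "poly P \<theta> = 0"
  shows "P = 0"
proof (rule ccontr)
  assume "P \<noteq> 0"
  have "poly P (frob (m * k) \<theta>) = 0" for k
  proof -
    have "frob_poly (m * k) P = P"
      using assms(2) frob_poly_dvd[of m P "m * k"] by (simp add: polys_below_def)
    then show ?thesis
      using poly_frob_poly[of "m * k" P \<theta>] assms(3) by simp
  qed
  then have "(\<lambda>k. frob (m * k) \<theta>) ` {..<d} \<subseteq> {x. poly P x = 0}"
    by auto
  then have "card ((\<lambda>k. frob (m * k) \<theta>) ` {..<d}) \<le> card {x. poly P x = 0}"
    by (intro card_mono poly_roots_finite \<open>P \<noteq> 0\<close>)
  also have "\<dots> \<le> Polynomial.degree P"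
    by (rule card_poly_roots_bound) fact
  finally show False
    using assms(2) card_image[OF inj_on_frob_multiples[OF frob_period_theta assms(1)]]
    by (simp add: polys_below_def)
qed

text \<open>
  Since \<open>m\<close> is prime to \<open>d\<close>, the polynomial \<open>p\<close> stays irreducible over the field with \<open>q\<^sup>m\<close>
  elements: both the annihilator of the torsion and that of \<open>\<theta>\<close> are generated by \<open>p\<close>.
\<close>
lemma pact_zero_iff_poly_theta:
  assumes "coprime m d" "m dvd n" "frob_poly m P = P"
  shows "(\<forall>v\<in>torsion. pact P v = 0) \<longleftrightarrow> poly P \<theta> = 0"
proof -
  obtain S Q where S: "S \<in> polys_below m d" and Q: "P = S + Q * lift_poly p"
    using reduce_modulo[OF monic_p _ assms(3)] d_pos degree_p by auto
  have "pact P v = pact S v" if "v \<in> torsion" for v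
    using that by (simp add: Q act_add_left act_mult torsion_def)
  moreover have "poly P \<theta> = poly S \<theta>"
    by (simp add: Q poly_p_theta)
  moreover have "(\<forall>v\<in>torsion. pact S v = 0) \<longleftrightarrow> S = 0"
    using S faithful[of S] by (auto simp: polys_below_def)
  moreover have "poly S \<theta> = 0 \<longleftrightarrow> S = 0"
    using poly_theta_faithful[OF assms(1) S] by auto
  ultimately show ?thesis by simp
qed

end


section \<open>Twisted polynomial rings\<close>

lemma abelian_group_mult_update: "abelian_group R \<Longrightarrow> abelian_group (R\<lparr>monoid.mult := f\<rparr>)"
  by (simp add: abelian_group_def abelian_monoid_def abelian_group_axioms_def)

locale twisted_polynomials = ring R for R (structure) +
  fixes s :: "'a \<Rightarrow> 'a"
  assumes s_hom: "s \<in> ring_hom R R"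
begin

abbreviation S :: "('a, nat \<Rightarrow> 'a) up_ring" where
  "S \<equiv> twisted_UP R s"

lemma s_closed: "a \<in> carrier R \<Longrightarrow> s a \<in> carrier R"
  using s_hom by (rule ring_hom_closed)

lemma s_pow_closed [simp, intro]: "a \<in> carrier R \<Longrightarrow> (s ^^ i) a \<in> carrier R"
  by (induction i) (auto simp: s_closed)

lemma s_pow_add: "a \<in> carrier R \<Longrightarrow> b \<in> carrier R \<Longrightarrow> (s ^^ i) (a \<oplus> b) = (s ^^ i) a \<oplus> (s ^^ i) b"
  by (induction i) (auto simp: ring_hom_add[OF s_hom])

lemma s_pow_mult:
  "a \<in> carrier R \<Longrightarrow> b \<in> carrier R \<Longrightarrow> (s ^^ i) (a \<otimes> b) = (s ^^ i) a \<otimes> (s ^^ i) b"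
  by (induction i) (auto simp: ring_hom_mult[OF s_hom])

lemma s_pow_one [simp]: "(s ^^ i) \<one> = \<one>"
  by (induction i) (auto simp: ring_hom_one[OF s_hom])

lemma s_pow_zero [simp]: "(s ^^ i) \<zero> = \<zero>"
  by (induction i) (auto simp: ring_hom_zero[OF s_hom ring_axioms ring_axioms])

lemma carrier_S: "carrier S = up R"
  and zero_S: "\<zero>\<^bsub>S\<^esub> = (\<lambda>i. \<zero>)"
  and one_S: "\<one>\<^bsub>S\<^esub> = (\<lambda>i. if i = 0 then \<one> else \<zero>)"
  and add_S: "f \<in> up R \<Longrightarrow> g \<in> up R \<Longrightarrow> f \<oplus>\<^bsub>S\<^esub> g = (\<lambda>i. f i \<oplus> g i)"
  and mult_S: "f \<in> up R \<Longrightarrow> g \<in> up R \<Longrightarrow>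
    f \<otimes>\<^bsub>S\<^esub> g = (\<lambda>k. \<Oplus>i\<in>{..k}. f i \<otimes> (s ^^ i) (g (k - i)))"
  and monom_S: "a \<in> carrier R \<Longrightarrow> up_ring.monom S a i = (\<lambda>j. if j = i then a else \<zero>)"
  by (simp_all add: twisted_UP_def UP_def)

lemma upI: "(\<And>i. f i \<in> carrier R) \<Longrightarrow> (\<And>i. i > n \<Longrightarrow> f i = \<zero>) \<Longrightarrow> f \<in> up R"
  by (rule mem_upI) auto

lemma monom_in_up: "a \<in> carrier R \<Longrightarrow> up_ring.monom S a i \<in> up R"
  by (rule upI[of _ i]) (auto simp: monom_S)

lemma S_add_closed: "f \<in> up R \<Longrightarrow> g \<in> up R \<Longrightarrow> f \<oplus>\<^bsub>S\<^esub> g \<in> up R"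
  by (simp add: add_S up_add_closed)

lemma S_mult_closed:
  assumes f: "f \<in> up R" and g: "g \<in> up R"
  shows "f \<otimes>\<^bsub>S\<^esub> g \<in> up R"
proof -
  obtain n m where n: "bound \<zero> n f" and m: "bound \<zero> m g"
    using f g by blast
  show ?thesis
  proof (rule upI[of _ "n + m"])
    show "(f \<otimes>\<^bsub>S\<^esub> g) k \<in> carrier R" for k
      unfolding mult_S[OF f g] using mem_upD[OF f] mem_upD[OF g] by (intro finsum_closed) auto
    show "(f \<otimes>\<^bsub>S\<^esub> g) k = \<zero>" if k: "n + m < k" for k
    proof -
      have "f i \<otimes> (s ^^ i) (g (k - i)) = \<zero>" for i
      proof (cases "n < i")
        case True
        then show ?thesis
          using bound.bound[OF n True] mem_upD[OF g] by simp
      next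
        case False
        with k have "m < k - i" by simp
        then show ?thesis
          using bound.bound[OF m, of "k - i"] mem_upD[OF f] by simp
      qed
      then show ?thesis
        unfolding mult_S[OF f g] by simp
    qed
  qed
qed

text \<open>
  Identities that are additive in each twisted polynomial need to be checked on monomials only. Associativity,
  multiplicativity of evaluations and centrality are proved in this way.
\<close>
lemma up_induct [consumes 1, case_names add monom]:
  assumes "f \<in> up R"
    and add: "\<And>f g. f \<in> up R \<Longrightarrow> g \<in> up R \<Longrightarrow> Q f \<Longrightarrow> Q g \<Longrightarrow> Q (f \<oplus>\<^bsub>S\<^esub> g)"
    and monom: "\<And>a i. a \<in> carrier R \<Longrightarrow> Q (up_ring.monom S a i)"
  shows "Q f"
proof -
  have "\<forall>f\<in>up R. (\<forall>k\<ge>N. f k = \<zero>) \<longrightarrow> Q f" for N :: nat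
  proof (induction N)
    case 0
    have "f = up_ring.monom S \<zero> 0" if "\<forall>k. f k = \<zero>" for f :: "nat \<Rightarrow> 'a"
      using that by (auto simp: monom_S)
    then show ?case
      using monom[of \<zero> 0] by auto
  next
    case (Suc N)
    show ?case
    proof (intro ballI impI)
      fix f assume f: "f \<in> up R" "\<forall>k\<ge>Suc N. f k = \<zero>"
      have f': "f(N := \<zero>) \<in> up R"
        using f mem_upD[OF f(1)] by (intro upI[of _ N]) auto
      moreover have "\<forall>k\<ge>N. (f(N := \<zero>)) k = \<zero>"
        using f(2) by auto
      ultimately have "Q (f(N := \<zero>))"
        using Suc by blast
      then have "Q (f(N := \<zero>) \<oplus>\<^bsub>S\<^esub> up_ring.monom S (f N) N)"
        using f' mem_upD[OF f(1)] by (intro add monom monom_in_up) auto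
      moreover have "f(N := \<zero>) \<oplus>\<^bsub>S\<^esub> up_ring.monom S (f N) N = f"
        using mem_upD[OF f(1)] by (subst add_S[OF f' monom_in_up]) (auto simp: monom_S)
      ultimately show "Q f" by simp
    qed
  qed
  moreover obtain n where "bound \<zero> n f"
    using assms(1) by blast
  then have "\<forall>k\<ge>Suc n. f k = \<zero>"
    by (auto simp: bound_def)
  ultimately show ?thesis
    using assms(1) by blast
qed

lemma S_l_distr:
  assumes "f \<in> up R" "g \<in> up R" "h \<in> up R"
  shows "(f \<oplus>\<^bsub>S\<^esub> g) \<otimes>\<^bsub>S\<^esub> h = f \<otimes>\<^bsub>S\<^esub> h \<oplus>\<^bsub>S\<^esub> g \<otimes>\<^bsub>S\<^esub> h"
proof -
  note [simp] = mem_upD[OF assms(1)] mem_upD[OF assms(2)] mem_upD[OF assms(3)]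
  have "(f \<oplus>\<^bsub>S\<^esub> g) \<otimes>\<^bsub>S\<^esub> h = (\<lambda>k. \<Oplus>i\<in>{..k}. f i \<otimes> (s ^^ i) (h (k - i)) \<oplus> g i \<otimes> (s ^^ i) (h (k - i)))"
    using assms by (simp add: mult_S S_add_closed) (simp add: add_S l_distr cong: finsum_cong)
  also have "\<dots> = f \<otimes>\<^bsub>S\<^esub> h \<oplus>\<^bsub>S\<^esub> g \<otimes>\<^bsub>S\<^esub> h"
    unfolding add_S[OF S_mult_closed[OF assms(1,3)] S_mult_closed[OF assms(2,3)]]
    using assms by (simp add: mult_S finsum_addf Pi_def)
  finally show ?thesis .
qed

lemma S_r_distr:
  assumes "f \<in> up R" "g \<in> up R" "h \<in> up R"
  shows "h \<otimes>\<^bsub>S\<^esub> (f \<oplus>\<^bsub>S\<^esub> g) = h \<otimes>\<^bsub>S\<^esub> f \<oplus>\<^bsub>S\<^esub> h \<otimes>\<^bsub>S\<^esub> g"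
proof -
  note [simp] = mem_upD[OF assms(1)] mem_upD[OF assms(2)] mem_upD[OF assms(3)]
  have "h \<otimes>\<^bsub>S\<^esub> (f \<oplus>\<^bsub>S\<^esub> g) = (\<lambda>k. \<Oplus>i\<in>{..k}. h i \<otimes> (s ^^ i) (f (k - i)) \<oplus> h i \<otimes> (s ^^ i) (g (k - i)))"
    using assms by (simp add: mult_S S_add_closed)
      (simp add: add_S s_pow_add r_distr cong: finsum_cong)
  also have "\<dots> = h \<otimes>\<^bsub>S\<^esub> f \<oplus>\<^bsub>S\<^esub> h \<otimes>\<^bsub>S\<^esub> g"
    unfolding add_S[OF S_mult_closed[OF assms(3,1)] S_mult_closed[OF assms(3,2)]]
    using assms by (simp add: mult_S finsum_addf Pi_def)
  finally show ?thesis .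
qed

lemma monom_mult_monom:
  assumes "a \<in> carrier R" "b \<in> carrier R"
  shows "up_ring.monom S a i \<otimes>\<^bsub>S\<^esub> up_ring.monom S b j = up_ring.monom S (a \<otimes> (s ^^ i) b) (i + j)"
proof
  fix k
  have "(up_ring.monom S a i \<otimes>\<^bsub>S\<^esub> up_ring.monom S b j) k =
      (\<Oplus>l\<in>{..k}. if i = l then a \<otimes> (s ^^ l) (if k - l = j then b else \<zero>) else \<zero>)"
    using assms by (simp add: mult_S monom_in_up) (auto simp: monom_S intro!: finsum_cong')
  also have "\<dots> = (if i \<le> k then a \<otimes> (s ^^ i) (if k - i = j then b else \<zero>) else \<zero>)"
  proof (cases "i \<le> k")
    case True
    then show ?thesis
      using assms by (subst finsum_singleton) auto
  next
    case False
    then have "(\<Oplus>l\<in>{..k}. if i = l then a \<otimes> (s ^^ l) (if k - l = j then b else \<zero>) else \<zero>) =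
        (\<Oplus>l\<in>{..k}. \<zero>)"
      by (intro finsum_cong') auto
    with False show ?thesis by simp
  qed
  also have "\<dots> = up_ring.monom S (a \<otimes> (s ^^ i) b) (i + j) k"
    using assms by (auto simp: monom_S)
  finally show "(up_ring.monom S a i \<otimes>\<^bsub>S\<^esub> up_ring.monom S b j) k =
      up_ring.monom S (a \<otimes> (s ^^ i) b) (i + j) k" .
qed

lemma S_assoc:
  assumes "f \<in> up R" "g \<in> up R" "h \<in> up R"
  shows "(f \<otimes>\<^bsub>S\<^esub> g) \<otimes>\<^bsub>S\<^esub> h = f \<otimes>\<^bsub>S\<^esub> (g \<otimes>\<^bsub>S\<^esub> h)"
  using assms(1)
proof (induction rule: up_induct)
  case (add f f')
  then show ?case
    using assms(2,3) by (simp add: S_l_distr S_mult_closed)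
next
  case (monom a i)
  show ?case
    using assms(2)
  proof (induction rule: up_induct)
    case (add g g')
    then show ?case
      using assms(3) monom by (simp add: S_l_distr S_r_distr S_mult_closed monom_in_up)
  next
    case (monom b j)
    show ?case
      using assms(3)
    proof (induction rule: up_induct)
      case (add h h')
      then show ?case
        using monom \<open>a \<in> carrier R\<close> by (simp add: S_r_distr S_mult_closed monom_in_up)
    next
      case (monom c k)
      then show ?case
        using \<open>a \<in> carrier R\<close> \<open>b \<in> carrier R\<close>
        by (simp add: monom_mult_monom s_pow_mult funpow_add m_assoc add.assoc)
    qed
  qed
qed

lemma one_S_monom: "\<one>\<^bsub>S\<^esub> = up_ring.monom S \<one> 0"
  by (simp add: one_S monom_S)

lemma abelian_group_S: "abelian_group S"
proof -
  interpret U: UP_ring R "UP R"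
    by unfold_locales simp
  interpret U: ring "UP R" by (rule U.UP_ring)
  show ?thesis
    unfolding twisted_UP_def by (rule abelian_group_mult_update) (rule U.abelian_group_axioms)
qed

theorem ring_S: "ring S"
proof (rule ringI)
  show "abelian_group S" by (rule abelian_group_S)
  have l_one: "\<one>\<^bsub>S\<^esub> \<otimes>\<^bsub>S\<^esub> f = f" if "f \<in> up R" for f
    using that
    by (induction rule: up_induct) (simp_all add: one_S_monom S_r_distr monom_in_up monom_mult_monom)
  have r_one: "f \<otimes>\<^bsub>S\<^esub> \<one>\<^bsub>S\<^esub> = f" if "f \<in> up R" for f
    using that
    by (induction rule: up_induct) (simp_all add: one_S_monom S_l_distr monom_in_up monom_mult_monom)
  show "Group.monoid S"
    by (rule monoidI)
      (simp_all add: carrier_S S_mult_closed S_assoc l_one r_one, simp add: one_S_monom monom_in_up)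
qed (simp_all add: carrier_S S_l_distr S_r_distr)

lemma monom_one_pow: "up_ring.monom S \<one> 1 [^]\<^bsub>S\<^esub> (k::nat) = up_ring.monom S \<one> k"
  by (induction k) (simp_all add: nat_pow_def one_S_monom monom_mult_monom)

end

text \<open>
  A ring \<open>R\<close> which is a free left module over a subring \<open>C\<close> on the powers
  \<open>1, \<dots>, \<pi>\<^sup>n\<^sup>-\<^sup>1\<close> of a unit normalising \<open>C\<close>, with \<open>\<pi>\<^sup>n\<close> central in \<open>C\<close>.
\<close>
locale cyclic_extension = ring R for R (structure) +
  fixes C :: "'a set" and \<pi> c :: 'a and n :: nat
  assumes C_subring: "subring C R"
    and \<pi>_unit: "\<pi> \<in> Units R"
    and conj_closed: "x \<in> C \<Longrightarrow> \<pi> \<otimes> x \<otimes> inv \<pi> \<in> C"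
    and n_pos: "n > 0"
    and c_in: "c \<in> C"
    and \<pi>_pow: "\<pi> [^] n = c"
    and c_comm: "x \<in> C \<Longrightarrow> c \<otimes> x = x \<otimes> c"
    and basis: "bij_betw (\<lambda>f. \<Oplus>i\<in>{..<n}. f i \<otimes> \<pi> [^] i) ({..<n} \<rightarrow>\<^sub>E C) (carrier R)"
begin

abbreviation K :: "('a, 'b) ring_scheme" where
  "K \<equiv> R\<lparr>carrier := C\<rparr>"

text \<open>The automorphism \<open>\<sigma>\<close> of the coefficients.\<close>
definition twist :: "'a \<Rightarrow> 'a" where
  "twist = (\<lambda>x\<in>C. \<pi> \<otimes> x \<otimes> inv \<pi>)"

lemma C_carrier [simp]: "x \<in> C \<Longrightarrow> x \<in> carrier R"
  using subringE(1)[OF C_subring] by blast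

lemma \<pi>_closed [simp]: "\<pi> \<in> carrier R" "inv \<pi> \<in> carrier R"
  using \<pi>_unit by (simp_all add: Units_closed)

lemma twist_hom: "twist \<in> ring_hom K K"
proof (rule ring_hom_memI; simp add: twist_def conj_closed subringE[OF C_subring])
  show "\<pi> \<otimes> (x \<otimes> y) \<otimes> inv \<pi> = \<pi> \<otimes> x \<otimes> inv \<pi> \<otimes> (\<pi> \<otimes> y \<otimes> inv \<pi>)"
    if "x \<in> C" "y \<in> C" for x y
  proof -
    have "\<pi> \<otimes> x \<otimes> inv \<pi> \<otimes> (\<pi> \<otimes> y \<otimes> inv \<pi>) = \<pi> \<otimes> x \<otimes> (inv \<pi> \<otimes> \<pi>) \<otimes> (y \<otimes> inv \<pi>)"
      using that by (simp add: m_assoc del: Units_l_inv)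
    then show ?thesis
      using that \<pi>_unit by (simp add: m_assoc)
  qed
qed (use \<pi>_unit in \<open>simp_all add: l_distr r_distr\<close>)

sublocale K: ring K
  by (rule subring_is_ring[OF C_subring])

sublocale T: twisted_polynomials K twist
  by unfold_locales (rule twist_hom)

abbreviation S :: "('a, nat \<Rightarrow> 'a) up_ring" where
  "S \<equiv> twisted_UP K twist"

sublocale S: ring S
  by (rule T.ring_S)

lemma up_K: "f \<in> up K \<Longrightarrow> f i \<in> C"
  using mem_upD[of f K i] by simp

lemma twist_pow_in [simp]: "x \<in> C \<Longrightarrow> (twist ^^ i) x \<in> C"
  using T.s_pow_closed[of x i] by simp

lemma \<pi>_mult: "x \<in> C \<Longrightarrow> \<pi> \<otimes> x = twist x \<otimes> \<pi>"
  using \<pi>_unit by (simp add: twist_def m_assoc)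

lemma \<pi>_pow_mult: "x \<in> C \<Longrightarrow> \<pi> [^] i \<otimes> x = (twist ^^ i) x \<otimes> \<pi> [^] (i::nat)"
proof (induction i)
  case (Suc i)
  let ?z = "(twist ^^ i) x"
  have z: "?z \<in> C" using Suc.prems by simp
  have pow: "\<pi> [^] Suc i = \<pi> \<otimes> \<pi> [^] i"
    by (rule nat_pow_Suc2) simp
  have "\<pi> [^] Suc i \<otimes> x = \<pi> \<otimes> (\<pi> [^] i \<otimes> x)"
    unfolding pow using Suc.prems by (simp add: m_assoc)
  also have "\<dots> = (\<pi> \<otimes> ?z) \<otimes> \<pi> [^] i"
    using Suc z by (simp add: m_assoc)
  also have "\<pi> \<otimes> ?z = twist ?z \<otimes> \<pi>"
    using z by (rule \<pi>_mult)
  also have "twist ?z \<otimes> \<pi> \<otimes> \<pi> [^] i = (twist ^^ Suc i) x \<otimes> \<pi> [^] Suc i"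
    unfolding pow using z T.s_closed[of ?z] by (simp add: m_assoc)
  finally show ?case .
qed simp

lemma twist_pow_c: "(twist ^^ i) c = c"
proof (induction i)
  case (Suc i)
  have "\<pi> \<otimes> c \<otimes> inv \<pi> = \<pi> [^] n \<otimes> \<pi> \<otimes> inv \<pi>"
    unfolding \<pi>_pow[symmetric] by (metis \<pi>_closed(1) nat_pow_Suc nat_pow_Suc2)
  also have "\<dots> = c"
    using \<pi>_unit c_in by (simp add: \<pi>_pow m_assoc)
  finally show ?case
    using Suc c_in by (simp add: twist_def)
qed simp

text \<open>
  Conjugation by \<open>\<pi>\<^sup>n = c\<close> is trivial on \<open>C\<close>. Therefore \<open>y\<^sup>n\<close> commutes with the coefficients.
\<close>
lemma twist_pow_n:
  assumes "x \<in> C" shows "(twist ^^ n) x = x"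
proof -
  have "c \<in> Units R"
    using \<pi>_unit \<pi>_pow by (metis Units_pow_closed)
  moreover have "(twist ^^ n) x \<otimes> c = x \<otimes> c"
    using \<pi>_pow_mult[OF assms, of n] c_comm[OF assms] by (simp add: \<pi>_pow)
  ultimately show ?thesis
    using assms by (metis C_carrier Units_closed Units_inv_closed Units_r_inv twist_pow_in m_assoc r_one)
qed

text \<open>
  Evaluation \<open>y \<mapsto> \<pi>\<close>. It is multiplicative because \<open>\<pi>\<close> satisfies the commutation rule of \<open>y\<close>.
\<close>
definition ev :: "(nat \<Rightarrow> 'a) \<Rightarrow> 'a" where
  "ev f = (\<Oplus>i\<in>{i. f i \<noteq> \<zero>}. f i \<otimes> \<pi> [^] i)"

lemma finite_support: "f \<in> up K \<Longrightarrow> finite {i. f i \<noteq> \<zero>}"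
proof -
  assume "f \<in> up K"
  then obtain m where "bound \<zero>\<^bsub>K\<^esub> m f" by blast
  then have "{i. f i \<noteq> \<zero>} \<subseteq> {..m}"
    by (auto simp: bound_def not_less[symmetric])
  then show ?thesis using finite_subset by blast
qed

lemma ev_altdef:
  assumes "f \<in> up K" "finite A" "{i. f i \<noteq> \<zero>} \<subseteq> A"
  shows "ev f = (\<Oplus>i\<in>A. f i \<otimes> \<pi> [^] i)"
  unfolding ev_def using assms up_K[OF assms(1)]
  by (intro add.finprod_mono_neutral_cong_left) auto

lemma ev_closed [simp]: "f \<in> up K \<Longrightarrow> ev f \<in> carrier R"
  unfolding ev_def by (intro finsum_closed) (auto simp: up_K)

lemma ev_add: "f \<in> up K \<Longrightarrow> g \<in> up K \<Longrightarrow> ev (f \<oplus>\<^bsub>S\<^esub> g) = ev f \<oplus> ev g"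
proof -
  assume fg: "f \<in> up K" "g \<in> up K"
  let ?A = "{i. f i \<noteq> \<zero>} \<union> {i. g i \<noteq> \<zero>}"
  have A: "finite ?A" using fg by (simp add: finite_support)
  have "{i. (f \<oplus>\<^bsub>S\<^esub> g) i \<noteq> \<zero>} \<subseteq> ?A"
    using fg by (auto simp: T.add_S)
  then have "ev (f \<oplus>\<^bsub>S\<^esub> g) = (\<Oplus>i\<in>?A. (f \<oplus>\<^bsub>S\<^esub> g) i \<otimes> \<pi> [^] i)"
    using fg A by (intro ev_altdef T.S_add_closed)
  also have "\<dots> = (\<Oplus>i\<in>?A. f i \<otimes> \<pi> [^] i \<oplus> g i \<otimes> \<pi> [^] i)"
    using fg by (intro finsum_cong') (auto simp: T.add_S up_K l_distr)
  also have "\<dots> = (\<Oplus>i\<in>?A. f i \<otimes> \<pi> [^] i) \<oplus> (\<Oplus>i\<in>?A. g i \<otimes> \<pi> [^] i)"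
    using fg by (intro finsum_addf) (auto simp: up_K)
  also have "\<dots> = ev f \<oplus> ev g"
    using fg A by (simp add: ev_altdef[of _ ?A])
  finally show ?thesis .
qed

lemma ev_monom: "x \<in> C \<Longrightarrow> ev (up_ring.monom S x i) = x \<otimes> \<pi> [^] i"
proof -
  assume x: "x \<in> C"
  then have "ev (up_ring.monom S x i) = (\<Oplus>j\<in>{i}. up_ring.monom S x i j \<otimes> \<pi> [^] j)"
    by (intro ev_altdef T.monom_in_up) (auto simp: T.monom_S)
  also have "\<dots> = x \<otimes> \<pi> [^] i"
    using x by (simp add: T.monom_S)
  finally show ?thesis .
qed

lemma ev_mult:
  assumes "f \<in> up K" "g \<in> up K"
  shows "ev (f \<otimes>\<^bsub>S\<^esub> g) = ev f \<otimes> ev g"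
  using assms(1)
proof (induction rule: T.up_induct)
  case (add f f')
  then show ?case
    using assms(2) by (simp add: T.S_l_distr ev_add T.S_mult_closed T.S_add_closed l_distr)
next
  case (monom x i)
  show ?case
    using assms(2)
  proof (induction rule: T.up_induct)
    case (add g g')
    then show ?case
      using monom T.monom_in_up[of x i]
      by (simp add: T.S_r_distr ev_add T.S_mult_closed T.S_add_closed r_distr)
  next
    case (monom z j)
    with \<open>x \<in> carrier K\<close> have xz: "x \<in> C" "z \<in> C" by simp_all
    have "x \<otimes> \<pi> [^] i \<otimes> (z \<otimes> \<pi> [^] j) = x \<otimes> (\<pi> [^] i \<otimes> z) \<otimes> \<pi> [^] j"
      using xz by (simp add: m_assoc)
    also have "\<dots> = x \<otimes> (twist ^^ i) z \<otimes> \<pi> [^] (i + j)"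
      using xz by (simp add: \<pi>_pow_mult m_assoc nat_pow_mult)
    finally show ?case
      using xz T.monom_mult_monom[of x z i j] subringE(6)[OF C_subring]
      by (simp add: ev_monom)
  qed
qed

lemma ev_hom: "ring_hom_ring S R ev"
proof (rule ring_hom_ringI)
  show "ev \<one>\<^bsub>S\<^esub> = \<one>"
    using ev_monom[of \<one> 0] subringE(3)[OF C_subring] T.one_S_monom by simp
qed (simp_all add: S.ring_axioms ring_axioms T.carrier_S ev_add ev_mult)

sublocale ev: ring_hom_ring S R ev
  by (rule ev_hom)

lemma ev_below:
  assumes "f \<in> up K" "\<And>i. i \<ge> n \<Longrightarrow> f i = \<zero>"
  shows "ev f = (\<Oplus>i\<in>{..<n}. f i \<otimes> \<pi> [^] i)"
  using assms by (intro ev_altdef) (auto simp: not_less[symmetric])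

lemma ev_surj: "ev ` carrier S = carrier R"
proof
  show "carrier R \<subseteq> ev ` carrier S"
  proof
    fix x assume "x \<in> carrier R"
    then obtain f where f: "f \<in> {..<n} \<rightarrow>\<^sub>E C" "x = (\<Oplus>i\<in>{..<n}. f i \<otimes> \<pi> [^] i)"
      using basis by (auto simp: bij_betw_def)
    define g where "g = (\<lambda>i. if i < n then f i else \<zero>)"
    have fC: "f i \<in> C" if "i < n" for i
      using f(1) that by auto
    have g: "g \<in> up K"
      using fC subringE(2)[OF C_subring] by (intro T.upI[of _ n]) (auto simp: g_def)
    have "ev g = (\<Oplus>i\<in>{..<n}. g i \<otimes> \<pi> [^] i)"
      by (rule ev_below[OF g]) (simp add: g_def)
    also have "\<dots> = x"
      unfolding f(2) by (intro finsum_cong') (auto simp: g_def fC)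
    finally show "x \<in> ev ` carrier S"
      using g by (auto simp: T.carrier_S)
  qed
qed (auto simp: T.carrier_S)

definition modulus :: "nat \<Rightarrow> 'a" where
  "modulus = up_ring.monom S \<one> 1 [^]\<^bsub>S\<^esub> n \<ominus>\<^bsub>S\<^esub> up_ring.monom S c 0"

lemma one_in_C [simp]: "\<one> \<in> C" and mult_in_C [simp]: "x \<in> C \<Longrightarrow> z \<in> C \<Longrightarrow> x \<otimes> z \<in> C"
  and zero_in_C [simp]: "\<zero> \<in> C"
  using subringE[OF C_subring] by auto

lemma monom_closed [simp]: "x \<in> C \<Longrightarrow> up_ring.monom S x i \<in> carrier S"
  by (simp add: T.carrier_S T.monom_in_up)

lemma monom_mult:
  "x \<in> C \<Longrightarrow> z \<in> C \<Longrightarrow>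
    up_ring.monom S x i \<otimes>\<^bsub>S\<^esub> up_ring.monom S z j = up_ring.monom S (x \<otimes> (twist ^^ i) z) (i + j)"
  using T.monom_mult_monom[of x z i j] by simp

lemma modulus_altdef: "modulus = up_ring.monom S \<one> n \<ominus>\<^bsub>S\<^esub> up_ring.monom S c 0"
  using T.monom_one_pow[of n] by (simp add: modulus_def)

lemma modulus_closed [simp]: "modulus \<in> carrier S"
  by (simp add: modulus_altdef c_in)

lemma ev_modulus: "ev modulus = \<zero>"
proof -
  have "ev modulus = ev (up_ring.monom S \<one> n) \<ominus> ev (up_ring.monom S c 0)"
    by (simp add: modulus_altdef c_in a_minus_def)
  then show ?thesis
    using c_in by (simp add: ev_monom \<pi>_pow r_neg a_minus_def)
qed

lemma central_if_commutes_with_monoms: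
  assumes g: "g \<in> carrier S"
    and comm: "\<And>x i. x \<in> C \<Longrightarrow> g \<otimes>\<^bsub>S\<^esub> up_ring.monom S x i = up_ring.monom S x i \<otimes>\<^bsub>S\<^esub> g"
    and f: "f \<in> carrier S"
  shows "g \<otimes>\<^bsub>S\<^esub> f = f \<otimes>\<^bsub>S\<^esub> g"
proof -
  have "f \<in> up K" using f by (simp add: T.carrier_S)
  then show ?thesis
  proof (induction rule: T.up_induct)
    case (add f f')
    then show ?case
      using g by (simp add: T.S_l_distr T.S_r_distr T.carrier_S)
  qed (simp add: comm)
qed

lemma modulus_central: "modulus \<in> ring_centralizer S (carrier S)"
proof -
  have comm: "modulus \<otimes>\<^bsub>S\<^esub> up_ring.monom S x i = up_ring.monom S x i \<otimes>\<^bsub>S\<^esub> modulus" if x: "x \<in> C" for x i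
  proof -
    have "(twist ^^ i) \<one> = \<one>" using T.s_pow_one[of i] by simp
    then show ?thesis
      using x c_in c_comm[OF x]
      by (simp add: modulus_altdef a_minus_def S.l_distr S.r_distr S.l_minus S.r_minus
          monom_mult twist_pow_n twist_pow_c add.commute[of i n] del: T.s_pow_one)
  qed
  show ?thesis
    unfolding ring_centralizer_def using central_if_commutes_with_monoms[OF modulus_closed comm] by simp
qed

text \<open>
  A leading term \<open>a y\<^sup>N\<close> with \<open>N \<ge> n\<close> is congruent to \<open>a c y\<^sup>N\<^sup>-\<^sup>n\<close>, so every class has a
  representative of degree less than \<open>n\<close>.
\<close>
lemma reduce_mod_modulus:
  "f \<in> up K \<Longrightarrow> (\<forall>k\<ge>N. f k = \<zero>) \<Longrightarrow>
    \<exists>g\<in>up K. (\<forall>k\<ge>n. g k = \<zero>) \<and> f \<ominus>\<^bsub>S\<^esub> g \<in> Idl\<^bsub>S\<^esub> {modulus}"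
proof (induction N arbitrary: f)
  case 0
  interpret I: ideal "Idl\<^bsub>S\<^esub> {modulus}" S
    by (rule S.genideal_ideal) simp
  have "f \<ominus>\<^bsub>S\<^esub> f = \<zero>\<^bsub>S\<^esub>"
    using 0(1) by (simp add: a_minus_def S.r_neg T.carrier_S)
  then have "f \<ominus>\<^bsub>S\<^esub> f \<in> Idl\<^bsub>S\<^esub> {modulus}"
    using I.zero_closed by (simp only:)
  then show ?case
    using 0 by (meson le0)
next
  case (Suc N)
  interpret I: ideal "Idl\<^bsub>S\<^esub> {modulus}" S
    by (rule S.genideal_ideal) simp
  show ?case
  proof (cases "N < n")
    case True
    have "f \<ominus>\<^bsub>S\<^esub> f = \<zero>\<^bsub>S\<^esub>"
      using Suc.prems(1) by (simp add: a_minus_def S.r_neg T.carrier_S)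
    then have "f \<ominus>\<^bsub>S\<^esub> f \<in> Idl\<^bsub>S\<^esub> {modulus}"
      using I.zero_closed by (simp only:)
    moreover have "\<forall>k\<ge>n. f k = \<zero>"
      using Suc.prems(2) True by simp
    ultimately show ?thesis
      using Suc.prems(1) by blast
  next
    case False
    let ?a = "f N"
    let ?f1 = "f(N := \<zero>)"
    let ?m = "up_ring.monom S (?a \<otimes> c) (N - n)"
    let ?h = "up_ring.monom S ?a (N - n) \<otimes>\<^bsub>S\<^esub> modulus"
    have fC: "f i \<in> C" for i using Suc.prems(1) by (simp add: up_K)
    have f1: "?f1 \<in> up K"
      using fC Suc.prems(2) by (intro T.upI[of _ N]) auto
    have f: "f = ?f1 \<oplus>\<^bsub>S\<^esub> up_ring.monom S ?a N"
      using f1 fC T.monom_in_up[of ?a N] by (auto simp: T.add_S T.monom_S)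
    have h: "?h = up_ring.monom S ?a N \<ominus>\<^bsub>S\<^esub> ?m"
    proof -
      have "(twist ^^ (N - n)) \<one> = \<one>" using T.s_pow_one[of "N - n"] by simp
      then show ?thesis
        using False fC c_in
        by (simp add: modulus_altdef a_minus_def S.r_distr S.r_minus monom_mult twist_pow_c
            del: T.s_pow_one)
    qed
    let ?f2 = "?f1 \<oplus>\<^bsub>S\<^esub> ?m"
    have [simp]: "?f1 \<in> carrier S" "?m \<in> carrier S" "up_ring.monom S ?a N \<in> carrier S"
      using f1 fC c_in by (simp_all add: T.carrier_S T.monom_in_up)
    have f2: "?f2 \<in> up K"
      using f1 fC c_in by (intro T.S_add_closed T.monom_in_up) simp_all
    moreover have "\<forall>k\<ge>N. ?f2 k = \<zero>"
      using Suc.prems(2) f1 fC c_in False n_pos T.monom_in_up[of "?a \<otimes> c" "N - n"]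
      by (auto simp: T.add_S T.monom_S)
    ultimately obtain g where g: "g \<in> up K" "\<forall>k\<ge>n. g k = \<zero>" "?f2 \<ominus>\<^bsub>S\<^esub> g \<in> Idl\<^bsub>S\<^esub> {modulus}"
      using Suc.IH by blast
    have gS: "g \<in> carrier S" using g by (simp add: T.carrier_S)
    have fS: "f \<in> carrier S" using Suc.prems(1) by (simp add: T.carrier_S)
    have "?m \<in> carrier S"
      using fC c_in by (intro monom_closed) simp
    then have mm: "?m \<ominus>\<^bsub>S\<^esub> ?m = \<zero>\<^bsub>S\<^esub>"
      unfolding a_minus_def by (rule S.r_neg)
    have hI: "?h \<in> Idl\<^bsub>S\<^esub> {modulus}"
      using fC by (intro I.I_l_closed S.genideal_self') simp_all
    have "f \<ominus>\<^bsub>S\<^esub> g = (?f2 \<ominus>\<^bsub>S\<^esub> g) \<oplus>\<^bsub>S\<^esub> ?h"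
    proof -
      have "(?f2 \<ominus>\<^bsub>S\<^esub> g) \<oplus>\<^bsub>S\<^esub> (up_ring.monom S ?a N \<ominus>\<^bsub>S\<^esub> ?m) =
          (?f1 \<oplus>\<^bsub>S\<^esub> up_ring.monom S ?a N) \<ominus>\<^bsub>S\<^esub> g \<oplus>\<^bsub>S\<^esub> (?m \<ominus>\<^bsub>S\<^esub> ?m)"
        using gS by (simp add: a_minus_def S.a_ac)
      also have "\<dots> = f \<ominus>\<^bsub>S\<^esub> g"
        unfolding f[symmetric] mm using gS fS by (intro S.r_zero S.minus_closed)
      finally show ?thesis using h by simp
    qed
    then have "f \<ominus>\<^bsub>S\<^esub> g \<in> Idl\<^bsub>S\<^esub> {modulus}"
      using I.a_closed[OF g(3) hI] by simp
    then show ?thesis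
      using g by blast
  qed
qed

text \<open>
  The value of a representative of degree less than \<open>n\<close> is its expansion in the basis \<open>1, \<dots>, \<pi>\<^sup>n\<^sup>-\<^sup>1\<close>; if
  the value is zero, so is the representative.
\<close>
lemma kernel_ev: "a_kernel S R ev = Idl\<^bsub>S\<^esub> {modulus}"
proof
  have mem: "f \<in> a_kernel S R ev \<longleftrightarrow> f \<in> carrier S \<and> ev f = \<zero>" for f
    unfolding a_kernel_def' by simp
  show sub: "Idl\<^bsub>S\<^esub> {modulus} \<subseteq> a_kernel S R ev"
  proof (rule S.genideal_minimal[OF ev.kernel_is_ideal])
    show "{modulus} \<subseteq> a_kernel S R ev"
      using mem[of modulus] ev_modulus modulus_closed by blast
  qed
  interpret I: ideal "Idl\<^bsub>S\<^esub> {modulus}" S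
    by (rule S.genideal_ideal) simp
  show "a_kernel S R ev \<subseteq> Idl\<^bsub>S\<^esub> {modulus}"
  proof
    fix f assume "f \<in> a_kernel S R ev"
    then have f: "f \<in> carrier S" "ev f = \<zero>"
      using mem by blast+
    then have "f \<in> up K" by (simp add: T.carrier_S)
    moreover from this obtain m where "bound \<zero>\<^bsub>K\<^esub> m f"
      by blast
    then have "\<forall>k\<ge>Suc m. f k = \<zero>"
      by (auto simp: bound_def)
    ultimately obtain g where g: "g \<in> up K" "\<forall>k\<ge>n. g k = \<zero>" "f \<ominus>\<^bsub>S\<^esub> g \<in> Idl\<^bsub>S\<^esub> {modulus}"
      using reduce_mod_modulus by blast
    have gS: "g \<in> carrier S" using g by (simp add: T.carrier_S)
    have "ev (f \<ominus>\<^bsub>S\<^esub> g) = \<zero>"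
      using g(3) sub mem by blast
    then have "ev g = \<zero>"
      using f gS by (simp add: a_minus_def) 
    then have "(\<Oplus>i\<in>{..<n}. g i \<otimes> \<pi> [^] i) = \<zero>"
      using ev_below[OF g(1)] g(2) by simp
    then have "(\<Oplus>i\<in>{..<n}. restrict g {..<n} i \<otimes> \<pi> [^] i) =
        (\<Oplus>i\<in>{..<n}. restrict (\<lambda>i. \<zero>) {..<n} i \<otimes> \<pi> [^] i)"
      using up_K[OF g(1)] by (simp cong: finsum_cong)
    then have "restrict g {..<n} = restrict (\<lambda>i. \<zero>) {..<n}"
      using basis up_K[OF g(1)] by (auto simp: bij_betw_def inj_on_def)
    then have "g i = \<zero>" for i
      using g(2) by (cases "i < n") (auto dest: fun_cong[of _ _ i])
    then have "g = \<zero>\<^bsub>S\<^esub>"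
      by (auto simp: T.zero_S)
    then show "f \<in> Idl\<^bsub>S\<^esub> {modulus}"
      using g(3) f(1) by (simp add: a_minus_def)
  qed
qed

theorem quotient_iso:
  "\<exists>\<psi>\<in>ring_iso (S Quot (Idl\<^bsub>S\<^esub> {modulus})) R.
     (\<forall>x\<in>C. \<psi> ((Idl\<^bsub>S\<^esub> {modulus}) +>\<^bsub>S\<^esub> up_ring.monom S x 0) = x) \<and>
     \<psi> ((Idl\<^bsub>S\<^esub> {modulus}) +>\<^bsub>S\<^esub> up_ring.monom S \<one> 1) = \<pi>"
proof (intro bexI conjI ballI)
  let ?h = "\<lambda>U. the_elem (ev ` U)"
  show "?h \<in> ring_iso (S Quot (Idl\<^bsub>S\<^esub> {modulus})) R"
    using ev.FactRing_iso_set[OF ev_surj] by (simp add: kernel_ev)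
  show "?h ((Idl\<^bsub>S\<^esub> {modulus}) +>\<^bsub>S\<^esub> up_ring.monom S x 0) = x" if "x \<in> C" for x
    using ev.the_elem_simp[of "up_ring.monom S x 0"] that by (simp add: kernel_ev ev_monom)
  show "?h ((Idl\<^bsub>S\<^esub> {modulus}) +>\<^bsub>S\<^esub> up_ring.monom S \<one> 1) = \<pi>"
    using ev.the_elem_simp[of "up_ring.monom S \<one> 1"] by (simp add: kernel_ev ev_monom)
qed

end


text \<open>
  Right multiplication by the unit \<open>\<pi>\<^sup>i\<close> is injective, so coefficients in \<open>C\<close> and summands in
  \<open>C \<pi>\<^sup>i\<close> determine each other.
\<close>
lemma (in cyclic_extension) internal_direct_sum:
  "is_internal_direct_sum R {..<n} (\<lambda>i. (\<lambda>x. x \<otimes> \<pi> [^] i) ` C)"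
proof -
  let ?S = "\<lambda>i::nat. (\<lambda>x. x \<otimes> \<pi> [^] i) ` C"
  have inj: "x = z" if "x \<in> C" "z \<in> C" "x \<otimes> \<pi> [^] (i::nat) = z \<otimes> \<pi> [^] i" for x z i
  proof -
    have "\<pi> [^] i \<in> Units R" using \<pi>_unit by (rule Units_pow_closed)
    then show ?thesis
      using that by (metis C_carrier Units_closed Units_inv_closed Units_r_inv m_assoc r_one)
  qed
  have "additive_subgroup (?S i) R" for i
  proof (rule additive_subgroup.intro, rule add.subgroupI)
    show "?S i \<subseteq> carrier R" by auto
    show "?S i \<noteq> {}" using zero_in_C by blast
    show "\<ominus> u \<in> ?S i" if "u \<in> ?S i" for u
    proof -
      from that obtain x where "x \<in> C" "u = x \<otimes> \<pi> [^] i" by blast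
      then show ?thesis
        using subringE(5)[OF C_subring] by (intro image_eqI[of _ _ "\<ominus> x"]) (simp_all add: l_minus)
    qed
    show "u \<oplus> w \<in> ?S i" if "u \<in> ?S i" "w \<in> ?S i" for u w
    proof -
      from that obtain x z where "x \<in> C" "u = x \<otimes> \<pi> [^] i" "z \<in> C" "w = z \<otimes> \<pi> [^] i" by blast
      then show ?thesis
        using subringE(7)[OF C_subring] by (intro image_eqI[of _ _ "x \<oplus> z"]) (simp_all add: l_distr)
    qed
  qed
  moreover have "bij_betw (\<lambda>f. \<Oplus>i\<in>{..<n}. f i) (\<Pi>\<^sub>E i\<in>{..<n}. ?S i) (carrier R)"
  proof -
    let ?T = "\<lambda>f. \<lambda>i\<in>{..<n}. f i \<otimes> \<pi> [^] i"
    have T: "bij_betw ?T ({..<n} \<rightarrow>\<^sub>E C) (\<Pi>\<^sub>E i\<in>{..<n}. ?S i)"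
      unfolding bij_betw_def
    proof (intro conjI inj_onI equalityI subsetI)
      fix f g assume fg: "f \<in> {..<n} \<rightarrow>\<^sub>E C" "g \<in> {..<n} \<rightarrow>\<^sub>E C" "?T f = ?T g"
      show "f = g"
      proof (rule PiE_ext[OF fg(1,2)])
        fix i assume i: "i \<in> {..<n}"
        then show "f i = g i"
          using fun_cong[OF fg(3), of i] fg(1,2) by (intro inj[of "f i" "g i" i]) auto
      qed
    next
      fix g assume g: "g \<in> (\<Pi>\<^sub>E i\<in>{..<n}. ?S i)"
      then have "\<forall>i\<in>{..<n}. \<exists>x\<in>C. g i = x \<otimes> \<pi> [^] i"
        by (auto dest!: PiE_mem)
      then obtain f where f: "\<And>i. i < n \<Longrightarrow> f i \<in> C" "\<And>i. i < n \<Longrightarrow> g i = f i \<otimes> \<pi> [^] i"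
        by (metis lessThan_iff)
      have "g = ?T (restrict f {..<n})"
        using g f(2) by (auto simp: fun_eq_iff PiE_def extensional_def)
      then show "g \<in> ?T ` ({..<n} \<rightarrow>\<^sub>E C)"
        using f(1) by (intro image_eqI[of _ _ "restrict f {..<n}"]) auto
    next
      fix g assume "g \<in> ?T ` ({..<n} \<rightarrow>\<^sub>E C)"
      then obtain f where f: "f \<in> {..<n} \<rightarrow>\<^sub>E C" "g = ?T f" by blast
      show "g \<in> (\<Pi>\<^sub>E i\<in>{..<n}. ?S i)"
        unfolding f(2) by (intro restrict_PiE_iff[THEN iffD2] ballI imageI PiE_mem[OF f(1)])
    qed
    have "bij_betw ((\<lambda>f. \<Oplus>i\<in>{..<n}. f i) \<circ> ?T) ({..<n} \<rightarrow>\<^sub>E C) (carrier R)"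
    proof (rule bij_betw_cong[THEN iffD2, OF _ basis])
      fix f assume "f \<in> {..<n} \<rightarrow>\<^sub>E C"
      then show "((\<lambda>f. \<Oplus>i\<in>{..<n}. f i) \<circ> ?T) f = (\<Oplus>i\<in>{..<n}. f i \<otimes> \<pi> [^] i)"
        unfolding comp_def by (intro finsum_cong') (auto dest!: PiE_mem)
    qed
    then show ?thesis
      using bij_betw_comp_iff[OF T] by blast
  qed
  ultimately show ?thesis
    unfolding is_internal_direct_sum_def by blast
qed

section \<open>Centralizers and automorphism groups of rings\<close>

context ring
begin

lemma subring_centralizer:
  assumes "B \<subseteq> carrier R"
  shows "subring (ring_centralizer R B) R"
proof (rule subringI)
  fix x assume x: "x \<in> ring_centralizer R B"
  then show "\<ominus> x \<in> ring_centralizer R B"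
    using assms by (auto simp: ring_centralizer_def l_minus r_minus subset_iff)
  fix y assume y: "y \<in> ring_centralizer R B"
  show "x \<otimes> y \<in> ring_centralizer R B"
    unfolding ring_centralizer_def
  proof (intro CollectI conjI ballI)
    fix b assume b: "b \<in> B"
    then have "x \<otimes> y \<otimes> b = x \<otimes> (b \<otimes> y)"
      using x y assms by (auto simp: ring_centralizer_def m_assoc subset_iff)
    also have "\<dots> = b \<otimes> (x \<otimes> y)"
      using x y b assms by (auto simp: ring_centralizer_def m_assoc[symmetric] subset_iff)
    finally show "x \<otimes> y \<otimes> b = b \<otimes> (x \<otimes> y)" .
  qed (use x y in \<open>auto simp: ring_centralizer_def\<close>)
  show "x \<oplus> y \<in> ring_centralizer R B"
    using x y assms by (auto simp: ring_centralizer_def l_distr r_distr subset_iff)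
qed (use assms in \<open>auto simp: ring_centralizer_def subset_iff\<close>)

text \<open>
  If \<open>a\<close> commutes with \<open>B\<close>, then \<open>B\<close> lies in the centralizer of \<open>a\<close>, which is a subring.
\<close>
lemma centralizer_generate_ring:
  assumes "B \<subseteq> carrier R"
  shows "ring_centralizer R (generate_ring R B) = ring_centralizer R B"
proof
  show "ring_centralizer R (generate_ring R B) \<subseteq> ring_centralizer R B"
    by (auto simp: ring_centralizer_def intro: generate_ring.incl)
  show "ring_centralizer R B \<subseteq> ring_centralizer R (generate_ring R B)"
  proof
    fix a assume a: "a \<in> ring_centralizer R B"
    then have aR: "a \<in> carrier R" by (simp add: ring_centralizer_def)
    have "subring (ring_centralizer R {a}) R"
      using aR by (intro subring_centralizer) simp
    moreover have "B \<subseteq> ring_centralizer R {a}"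
      using a assms by (auto simp: ring_centralizer_def)
    ultimately have "generate_ring R B \<subseteq> ring_centralizer R {a}"
      by (rule generate_ring_min_subring1[OF assms])
    then show "a \<in> ring_centralizer R (generate_ring R B)"
      using aR by (auto simp: ring_centralizer_def)
  qed
qed

lemma group_ring_AutoGroup: "group (ring_AutoGroup R)"
proof -
  let ?A = "ring_iso R R \<inter> Bij (carrier R)"
  have "subgroup ?A (BijGroup (carrier R))"
  proof (rule subgroup.intro)
    show "?A \<subseteq> carrier (BijGroup (carrier R))"
      by (simp add: BijGroup_def)
    show "f \<otimes>\<^bsub>BijGroup (carrier R)\<^esub> g \<in> ?A" if "f \<in> ?A" "g \<in> ?A" for f g
    proof -
      have "g \<in> ring_iso R R" "f \<in> ring_iso R R" using that by auto
      then have "f \<circ> g \<in> ring_iso R R" by (rule ring_iso_set_trans)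
      then have "compose (carrier R) f g \<in> ring_iso R R"
        by (rule ring_iso_restrict) (simp add: compose_def)
      then show ?thesis
        using that by (simp add: BijGroup_def compose_Bij)
    qed
    have "(\<lambda>x\<in>carrier R. x) \<in> ring_iso R R"
      using ring_iso_set_refl[of R] by (rule ring_iso_restrict) simp
    then show "\<one>\<^bsub>BijGroup (carrier R)\<^esub> \<in> ?A"
      by (simp add: BijGroup_def id_Bij)
    show "inv\<^bsub>BijGroup (carrier R)\<^esub> f \<in> ?A" if "f \<in> ?A" for f
    proof -
      have f: "f \<in> ring_iso R R" "f \<in> Bij (carrier R)" using that by auto
      have "restrict (inv_into (carrier R) f) (carrier R) \<in> ring_iso R R"
        using ring_iso_set_sym[OF ring_axioms f(1)] by (rule ring_iso_restrict) simp
      then show ?thesis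
        using f(2) by (simp add: inv_BijGroup restrict_inv_into_Bij)
    qed
  qed
  then show ?thesis
    unfolding ring_AutoGroup_def by (intro subgroup.subgroup_is_group group_BijGroup)
qed

lemma ring_AutoGroup_pow:
  assumes "f \<in> carrier (ring_AutoGroup R)"
  shows "f [^]\<^bsub>ring_AutoGroup R\<^esub> (k::nat) = (\<lambda>x\<in>carrier R. (f ^^ k) x)"
proof -
  interpret G: group "ring_AutoGroup R" by (rule group_ring_AutoGroup)
  have fB: "f \<in> Bij (carrier R)" using assms by (simp add: ring_AutoGroup_def)
  then have fc: "f x \<in> carrier R" if "x \<in> carrier R" for x
    using that Bij_imp_funcset by blast
  have mult: "g \<otimes>\<^bsub>ring_AutoGroup R\<^esub> h = compose (carrier R) g h"
    if "g \<in> Bij (carrier R)" "h \<in> Bij (carrier R)" for g h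
    using that by (simp add: ring_AutoGroup_def BijGroup_def)
  show ?thesis
  proof (induction k)
    case 0
    show ?case by (simp add: ring_AutoGroup_def BijGroup_def)
  next
    case (Suc k)
    have "f [^]\<^bsub>ring_AutoGroup R\<^esub> k \<in> Bij (carrier R)"
      using G.nat_pow_closed[OF assms, of k] by (simp add: ring_AutoGroup_def)
    then have "f [^]\<^bsub>ring_AutoGroup R\<^esub> Suc k = compose (carrier R) (f [^]\<^bsub>ring_AutoGroup R\<^esub> k) f"
      unfolding G.nat_pow_Suc using mult fB by blast
    also have "\<dots> = (\<lambda>x\<in>carrier R. (f ^^ Suc k) x)"
      unfolding Suc.IH by (intro ext) (simp add: compose_def fc funpow_Suc_right del: funpow.simps)
    finally show ?case .
  qed
qed

end

text \<open>
  Surjectivity comes for free on a finite ring.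
\<close>
lemma ring_AutoGroupI:
  assumes "f \<in> ring_hom R R" "f \<in> extensional (carrier R)" "inj_on f (carrier R)" "finite (carrier R)"
  shows "f \<in> carrier (ring_AutoGroup R)"
proof -
  have "f ` carrier R \<subseteq> carrier R"
    using ring_hom_closed[OF assms(1)] by blast
  then have "bij_betw f (carrier R) (carrier R)"
    using assms(3,4) by (simp add: bij_betw_def endo_inj_surj)
  then show ?thesis
    using assms(1,2) by (simp add: ring_AutoGroup_def ring_iso_def Bij_def)
qed

section \<open>The endomorphism ring of the torsion\<close>

context drinfeld_setting
begin

text \<open>
  The ring of \<open>A/p\<close>-linear endomorphisms, without residue classes as scalars.
\<close>
definition End_ring :: "('f alg_closure \<Rightarrow> 'f alg_closure) ring" where
  "End_ring = \<lparr>carrier = endos, monoid.mult = compose torsion, one = (\<lambda>v\<in>torsion. v),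
     ring.zero = (\<lambda>v\<in>torsion. 0), add = (\<lambda>f g. \<lambda>v\<in>torsion. f v + g v)\<rparr>"

lemma End_ring_simps [simp]:
  "carrier End_ring = endos"
  "f \<otimes>\<^bsub>End_ring\<^esub> g = compose torsion f g"
  "\<one>\<^bsub>End_ring\<^esub> = (\<lambda>v\<in>torsion. v)"
  "\<zero>\<^bsub>End_ring\<^esub> = (\<lambda>v\<in>torsion. 0)"
  "f \<oplus>\<^bsub>End_ring\<^esub> g = (\<lambda>v\<in>torsion. f v + g v)"
  by (simp_all add: End_ring_def)

lemma endos_closed [simp]: "f \<in> endos \<Longrightarrow> v \<in> torsion \<Longrightarrow> f v \<in> torsion"
  and endos_add: "f \<in> endos \<Longrightarrow> v \<in> torsion \<Longrightarrow> w \<in> torsion \<Longrightarrow> f (v + w) = f v + f w"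
  and endos_aact: "f \<in> endos \<Longrightarrow> v \<in> torsion \<Longrightarrow> f (aact a v) = aact a (f v)"
  and endos_extensional: "f \<in> endos \<Longrightarrow> f \<in> extensional torsion"
  by (auto simp: endos_def PiE_def)

lemma endos_funcset: "f \<in> endos \<Longrightarrow> f \<in> torsion \<rightarrow> torsion"
  by auto

lemma endosI:
  assumes "f \<in> extensional torsion" "\<And>v. v \<in> torsion \<Longrightarrow> f v \<in> torsion"
    and "\<And>v w. v \<in> torsion \<Longrightarrow> w \<in> torsion \<Longrightarrow> f (v + w) = f v + f w"
    and "\<And>a v. v \<in> torsion \<Longrightarrow> f (aact a v) = aact a (f v)"
  shows "f \<in> endos"
  unfolding endos_def PiE_def Pi_def using assms by blast

lemma restrict_endosI:
  assumes "\<And>v. v \<in> torsion \<Longrightarrow> f v \<in> torsion"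
    and "\<And>v w. v \<in> torsion \<Longrightarrow> w \<in> torsion \<Longrightarrow> f (v + w) = f v + f w"
    and "\<And>a v. v \<in> torsion \<Longrightarrow> f (aact a v) = aact a (f v)"
  shows "(\<lambda>v\<in>torsion. f v) \<in> endos"
  using assms by (intro endosI) (auto simp: torsion_add torsion_aact)

lemma endos_zero: "(\<lambda>v\<in>torsion. 0) \<in> endos"
  and endos_one: "(\<lambda>v\<in>torsion. v) \<in> endos"
  by (auto intro!: restrict_endosI simp: torsion_zero)

lemma endos_plus: "f \<in> endos \<Longrightarrow> g \<in> endos \<Longrightarrow> (\<lambda>v\<in>torsion. f v + g v) \<in> endos"
  by (rule restrict_endosI) (auto simp: torsion_add endos_add endos_aact act_add_right)

lemma endos_uminus: "f \<in> endos \<Longrightarrow> (\<lambda>v\<in>torsion. - f v) \<in> endos"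
  by (rule restrict_endosI) (auto simp: torsion_minus endos_add endos_aact act_minus_right)

lemma endos_compose: "f \<in> endos \<Longrightarrow> g \<in> endos \<Longrightarrow> compose torsion f g \<in> endos"
  unfolding compose_def by (rule restrict_endosI) (auto simp: endos_add endos_aact)

theorem ring_End_ring: "ring End_ring"
proof (rule ringI)
  show "abelian_group End_ring"
  proof (rule abelian_groupI)
    fix f assume f: "f \<in> carrier End_ring"
    show "\<exists>g\<in>carrier End_ring. g \<oplus>\<^bsub>End_ring\<^esub> f = \<zero>\<^bsub>End_ring\<^esub>"
      using f by (intro bexI[of _ "\<lambda>v\<in>torsion. - f v"]) (auto simp: endos_uminus)
    have "\<zero>\<^bsub>End_ring\<^esub> \<oplus>\<^bsub>End_ring\<^esub> f = restrict f torsion"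
      unfolding End_ring_simps by (rule restrict_ext) simp
    then show "\<zero>\<^bsub>End_ring\<^esub> \<oplus>\<^bsub>End_ring\<^esub> f = f"
      using f extensional_restrict[OF endos_extensional, of f] by simp
  qed (auto simp: endos_plus endos_zero add_ac)
  show "Group.monoid End_ring"
  proof (rule monoidI)
    fix f g h assume "f \<in> carrier End_ring" "g \<in> carrier End_ring" "h \<in> carrier End_ring"
    then show "f \<otimes>\<^bsub>End_ring\<^esub> g \<otimes>\<^bsub>End_ring\<^esub> h = f \<otimes>\<^bsub>End_ring\<^esub> (g \<otimes>\<^bsub>End_ring\<^esub> h)"
      using compose_assoc[of h torsion torsion f g] by simp
  next
    fix f assume f: "f \<in> carrier End_ring"
    show "\<one>\<^bsub>End_ring\<^esub> \<otimes>\<^bsub>End_ring\<^esub> f = f" "f \<otimes>\<^bsub>End_ring\<^esub> \<one>\<^bsub>End_ring\<^esub> = f"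
      unfolding End_ring_simps
      using f endos_extensional[of f] endos_funcset[of f] Id_compose[of f torsion torsion]
        compose_Id[of f torsion torsion] by auto
  qed (auto simp: endos_compose endos_one)
qed (auto simp: compose_def endos_add)

sublocale E: ring End_ring
  by (rule ring_End_ring)

definition poly_op :: "'f alg_closure poly \<Rightarrow> 'f alg_closure \<Rightarrow> 'f alg_closure" where
  "poly_op P = (\<lambda>v\<in>torsion. pact P v)"

definition \<pi> :: "'f alg_closure \<Rightarrow> 'f alg_closure" where
  "\<pi> = (\<lambda>v\<in>torsion. frob r v)"

lemma poly_op_in_endos: "frob_poly n P = P \<Longrightarrow> poly_op P \<in> endos"
  unfolding poly_op_def by (rule restrict_endosI) (auto simp: torsion_pact act_add_right pact_aact)

lemma \<pi>_in_endos: "\<pi> \<in> endos"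
  unfolding \<pi>_def
  using torsion_frob[of _ 1] frob_aact[of 1]
  by (intro restrict_endosI) (auto simp: frob_add)

lemma \<pi>_pow: "\<pi> [^]\<^bsub>End_ring\<^esub> (k::nat) = (\<lambda>v\<in>torsion. frob (r * k) v)"
proof (induction k)
  case (Suc k)
  have "\<pi> [^]\<^bsub>End_ring\<^esub> Suc k = compose torsion (\<lambda>v\<in>torsion. frob (r * k) v) \<pi>"
    using Suc by (simp only: E.nat_pow_Suc End_ring_simps)
  also have "\<dots> = (\<lambda>v\<in>torsion. frob (r * Suc k) v)"
    unfolding compose_def
  proof (rule restrict_ext)
    fix v assume v: "v \<in> torsion"
    then have "frob r v \<in> torsion"
      using torsion_frob[of v 1] by simp
    then show "restrict (frob (r * k)) torsion (\<pi> v) = frob (r * Suc k) v"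
      using v by (simp add: \<pi>_def frob_frob add.commute)
  qed
  finally show ?case .
qed simp

lemma poly_op_add: "poly_op P \<oplus>\<^bsub>End_ring\<^esub> poly_op Q = poly_op (P + Q)"
  by (auto simp: poly_op_def act_add_left)

lemma poly_op_mult: "frob_poly n Q = Q \<Longrightarrow> poly_op P \<otimes>\<^bsub>End_ring\<^esub> poly_op Q = poly_op (P * Q)"
  by (auto simp: poly_op_def act_mult compose_def torsion_pact)

lemma poly_op_one: "poly_op 1 = \<one>\<^bsub>End_ring\<^esub>"
  by (auto simp: poly_op_def one_pCons act_pCons)

lemma poly_op_zero: "poly_op 0 = \<zero>\<^bsub>End_ring\<^esub>"
  by (auto simp: poly_op_def)

lemma \<pi>_poly_op:
  "\<pi> [^]\<^bsub>End_ring\<^esub> (k::nat) \<otimes>\<^bsub>End_ring\<^esub> poly_op P =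
    poly_op (frob_poly (r * k) P) \<otimes>\<^bsub>End_ring\<^esub> \<pi> [^]\<^bsub>End_ring\<^esub> k"
  if "frob_poly n P = P"
  using that by (auto simp: \<pi>_pow poly_op_def compose_def torsion_pact torsion_frob frob_pact)

lemma poly_op_commutes_scalar:
  "f \<in> endos \<Longrightarrow> f \<otimes>\<^bsub>End_ring\<^esub> poly_op (lift_poly a) = poly_op (lift_poly a) \<otimes>\<^bsub>End_ring\<^esub> f"
  by (auto simp: poly_op_def compose_def endos_aact torsion_aact)

lemma \<pi>_pow_n: "\<pi> [^]\<^bsub>End_ring\<^esub> n = poly_op (lift_poly p\<^sub>0)"
  by (auto simp: \<pi>_pow poly_op_def aact_p0 mult.commute)

text \<open>
  The inverse of \<open>p\<^sub>0\<close> modulo \<open>p\<close> makes \<open>c\<close> a unit and \<open>\<pi>\<close> invertible. Here the ideal generated by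
  both polynomials is tested against the irreducible \<open>p\<^sub>0\<close>, which does not divide \<open>p\<close> because \<open>p(t) \<noteq> 0\<close>.
\<close>
lemma p0_invertible: "\<exists>b s. b * p\<^sub>0 + s * p = 1"
proof -
  let ?J = "{a. \<exists>b s. b * p\<^sub>0 + s * p = a}"
  have "\<not> p\<^sub>0 dvd p"
  proof
    assume "p\<^sub>0 dvd p"
    then obtain k where "p = p\<^sub>0 * k" by (rule dvdE)
    then have "poly (lift_poly p) t = 0" by (simp only: lift_poly_simps poly_mult root_p0 mult_zero_left)
    with p_t_nonzero show False ..
  qed
  moreover have "x - z * y \<in> ?J" if "x \<in> ?J" "y \<in> ?J" for x y z
  proof -
    from that obtain b s b' s' where "x = b * p\<^sub>0 + s * p" "y = b' * p\<^sub>0 + s' * p" by auto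
    then have "(b - z * b') * p\<^sub>0 + (s - z * s') * p = x - z * y"
      by (simp add: algebra_simps)
    then show ?thesis by blast
  qed
  moreover have "0 * p\<^sub>0 + 1 * p = p" "1 * p\<^sub>0 + 0 * p = p\<^sub>0" by simp_all
  then have "p \<in> ?J" "p\<^sub>0 \<in> ?J" by blast+
  ultimately have "1 \<in> ?J"
    by (intro one_in_poly_ideal[OF irreducible_p0, of _ p])
  then show ?thesis by blast
qed

text \<open>
  All endomorphisms commute with the scalars, so this is the centralizer of \<open>R\<^sub>0\<close>.
\<close>
definition centr :: "nat \<Rightarrow> ('f alg_closure \<Rightarrow> 'f alg_closure) set" where
  "centr m = ring_centralizer End_ring {\<pi> [^]\<^bsub>End_ring\<^esub> m}"

abbreviation Cent_ring :: "nat \<Rightarrow> ('f alg_closure \<Rightarrow> 'f alg_closure) ring" where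
  "Cent_ring m \<equiv> End_ring\<lparr>carrier := centr m\<rparr>"

lemma \<pi>_pow_in_endos: "\<pi> [^]\<^bsub>End_ring\<^esub> (k::nat) \<in> endos"
  using E.nat_pow_closed[of \<pi> k] \<pi>_in_endos by simp

lemma subring_centr: "subring (centr m) End_ring"
  unfolding centr_def by (rule E.subring_centralizer) (simp add: \<pi>_pow_in_endos)

lemma ring_Cent_ring: "ring (Cent_ring m)"
  by (rule E.subring_is_ring[OF subring_centr])

lemma centr_endos: "f \<in> centr m \<Longrightarrow> f \<in> endos"
  by (simp add: centr_def ring_centralizer_def)

lemma Cent_ring_pow: "f [^]\<^bsub>Cent_ring m\<^esub> (k::nat) = f [^]\<^bsub>End_ring\<^esub> k"
  by (simp add: nat_pow_def)

lemma poly_op_in_centr: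
  assumes "m dvd n" "frob_poly m P = P"
  shows "poly_op P \<in> centr m"
proof -
  have "frob_poly n P = P" "frob_poly (r * m) P = P"
    using assms frob_poly_dvd[of m P] by auto
  then show ?thesis
    using \<pi>_poly_op[of P m] by (auto simp: centr_def ring_centralizer_def poly_op_in_endos)
qed

lemma \<pi>_in_centr: "\<pi> \<in> centr m"
proof -
  have "\<pi> \<otimes>\<^bsub>End_ring\<^esub> \<pi> [^]\<^bsub>End_ring\<^esub> m = \<pi> [^]\<^bsub>End_ring\<^esub> m \<otimes>\<^bsub>End_ring\<^esub> \<pi>"
    using \<pi>_in_endos E.nat_pow_Suc2[of \<pi> m] E.nat_pow_Suc[of \<pi> m] by (simp del: End_ring_simps(2))
  then show ?thesis
    using \<pi>_in_endos by (simp add: centr_def ring_centralizer_def)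
qed

text \<open>
  As \<open>\<pi>\<^sup>n\<close> is the scalar \<open>c\<close>, the inverse of \<open>\<pi>\<close> is \<open>\<pi>\<^sup>n\<^sup>-\<^sup>1 c\<^sup>-\<^sup>1\<close>.
\<close>
lemma \<pi>_Units: "\<pi> \<in> Units (Cent_ring m)"
proof -
  interpret R: ring "Cent_ring m" by (rule ring_Cent_ring)
  obtain b s where bs: "b * p\<^sub>0 + s * p = 1" using p0_invertible by blast
  let ?B = "poly_op (lift_poly b)"
  have B: "?B \<in> centr m"
    by (auto simp: centr_def ring_centralizer_def poly_op_in_endos \<pi>_pow_in_endos poly_op_commutes_scalar[symmetric]
        simp del: End_ring_simps(2))
  have CB: "poly_op (lift_poly p\<^sub>0) \<otimes>\<^bsub>End_ring\<^esub> ?B = \<one>\<^bsub>End_ring\<^esub>"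
  proof -
    have "poly_op (lift_poly p\<^sub>0) \<otimes>\<^bsub>End_ring\<^esub> ?B = poly_op (lift_poly (p\<^sub>0 * b))"
      by (subst poly_op_mult) simp_all
    also have "p\<^sub>0 * b = 1 - s * p"
      using bs by (simp add: algebra_simps)
    also have "poly_op (lift_poly (1 - s * p)) = \<one>\<^bsub>End_ring\<^esub>"
      by (auto simp: poly_op_def act_diff_left act_mult torsion_def one_pCons act_pCons)
    finally show ?thesis .
  qed
  obtain k where k: "n = Suc k" using n_pos gr0_conv_Suc by blast
  let ?I = "\<pi> [^]\<^bsub>End_ring\<^esub> k \<otimes>\<^bsub>End_ring\<^esub> ?B"
  note mem = \<pi>_in_endos \<pi>_pow_in_endos[of k] centr_endos[OF B]
  have "\<pi> \<otimes>\<^bsub>End_ring\<^esub> ?I = \<pi> [^]\<^bsub>End_ring\<^esub> Suc k \<otimes>\<^bsub>End_ring\<^esub> ?B"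
    using mem E.nat_pow_Suc2[of \<pi> k] by (simp add: E.m_assoc del: End_ring_simps(2) E.nat_pow_Suc)
  then have 1: "\<pi> \<otimes>\<^bsub>End_ring\<^esub> ?I = \<one>\<^bsub>End_ring\<^esub>"
    unfolding k[symmetric] \<pi>_pow_n CB .
  have "?I \<otimes>\<^bsub>End_ring\<^esub> \<pi> = \<pi> [^]\<^bsub>End_ring\<^esub> k \<otimes>\<^bsub>End_ring\<^esub> (\<pi> \<otimes>\<^bsub>End_ring\<^esub> ?B)"
    using mem poly_op_commutes_scalar[OF \<pi>_in_endos, of b]
    by (simp add: E.m_assoc del: End_ring_simps(2))
  also have "\<dots> = \<pi> [^]\<^bsub>End_ring\<^esub> Suc k \<otimes>\<^bsub>End_ring\<^esub> ?B"
    using mem by (simp add: E.m_assoc del: End_ring_simps(2))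
  finally have 2: "?I \<otimes>\<^bsub>End_ring\<^esub> \<pi> = \<one>\<^bsub>End_ring\<^esub>"
    unfolding k[symmetric] \<pi>_pow_n CB .
  have "?I \<in> centr m"
    using R.nat_pow_closed[of \<pi> k] R.m_closed[of "\<pi> [^]\<^bsub>End_ring\<^esub> k" ?B] B \<pi>_in_centr[of m]
    by (simp add: Cent_ring_pow)
  then show ?thesis
    using 1 2 \<pi>_in_centr[of m] by (auto simp: Units_def)
qed

lemma finsum_Cent_ring:
  assumes "finite A" "\<And>i. i \<in> A \<Longrightarrow> F i \<in> centr m"
  shows "(\<Oplus>\<^bsub>Cent_ring m\<^esub>i\<in>A. F i) = (\<lambda>v\<in>torsion. \<Sum>i\<in>A. F i v)"
proof -
  interpret R: ring "Cent_ring m" by (rule ring_Cent_ring)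
  show ?thesis
    using assms
  proof (induction A)
    case (insert x A)
    then show ?case
      by (subst R.finsum_insert) auto
  qed simp
qed

end


section \<open>The subfield \<open>K\<close> and the structure of the centralizer\<close>

lemma frob_poly_frob_poly: "frob_poly i (frob_poly j P) = frob_poly (i + j) P"
  by (rule poly_eqI) (simp add: frob_frob)

lemma frob_poly_one [simp]: "frob_poly k 1 = 1"
  by (simp add: one_pCons)

lemma frob_poly_power: "frob_poly k (P ^ j) = frob_poly k P ^ j"
  by (induction j) auto

locale drinfeld_setting_subfield = drinfeld_setting n r d t p\<^sub>0 p
  for n r d :: nat and t :: "'f::{field, finite} alg_closure" and p\<^sub>0 p :: "'f poly" +
  fixes m :: nat
  assumes m_dvd_n: "m dvd n" and coprime_m_d: "coprime m d"
begin

lemma m_pos: "m > 0"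
  using m_dvd_n n_pos by (auto intro: Nat.gr0I)

lemma coprime_m_r: "coprime m r"
  using coprime_n_r m_dvd_n by (metis coprime_divisors dvd_refl)

text \<open>
  The carrier of \<open>K\<close>. Polynomials of arbitrary degree are admitted, so that closure under multiplication
  is evident.
\<close>
definition Kc :: "('f alg_closure \<Rightarrow> 'f alg_closure) set" where
  "Kc = poly_op ` {P. frob_poly m P = P}"

lemma over_n: "frob_poly m P = P \<Longrightarrow> frob_poly n P = P"
  using m_dvd_n frob_poly_dvd by blast

lemma KcI: "frob_poly m P = P \<Longrightarrow> poly_op P \<in> Kc"
  by (auto simp: Kc_def)

lemma Kc_centr: "Kc \<subseteq> centr m"
  using poly_op_in_centr[OF m_dvd_n] by (auto simp: Kc_def)

lemma Kc_endos: "Kc \<subseteq> endos"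
  using Kc_centr centr_endos by blast

lemma poly_op_eq_iff:
  assumes "frob_poly m P = P" "frob_poly m Q = Q"
  shows "poly_op P = poly_op Q \<longleftrightarrow> poly P \<theta> = poly Q \<theta>"
proof -
  have "poly_op P = poly_op Q \<longleftrightarrow> (\<forall>v\<in>torsion. pact P v = pact Q v)"
    unfolding poly_op_def restrict_def fun_eq_iff by auto
  also have "\<dots> \<longleftrightarrow> (\<forall>v\<in>torsion. pact (P - Q) v = 0)"
    by (simp add: act_diff_left)
  also have "\<dots> \<longleftrightarrow> poly (P - Q) \<theta> = 0"
    using pact_zero_iff_poly_theta[OF coprime_m_d m_dvd_n, of "P - Q"] assms by simp
  finally show ?thesis by simp
qed

lemma poly_op_reduce:
  assumes "frob_poly m P = P"
  obtains S where "S \<in> polys_below m d" "poly_op P = poly_op S"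
proof -
  obtain S Q where S: "S \<in> polys_below m d" and Q: "P = S + Q * lift_poly p"
    using reduce_modulo[OF monic_p _ assms] d_pos degree_p by auto
  have "frob_poly m S = S" using S by (simp add: polys_below_def)
  moreover have "poly P \<theta> = poly S \<theta>"
    by (simp add: Q poly_p_theta)
  ultimately have "poly_op P = poly_op S"
    using assms poly_op_eq_iff by blast
  with S that show ?thesis by blast
qed

sublocale R: ring "Cent_ring m"
  by (rule ring_Cent_ring)

lemma subring_Kc: "subring Kc (Cent_ring m)"
proof (rule R.subringI)
  show "Kc \<subseteq> carrier (Cent_ring m)" using Kc_centr by simp
  show "\<one>\<^bsub>Cent_ring m\<^esub> \<in> Kc"
    using KcI[of 1] poly_op_one by simp
  fix x assume "x \<in> Kc"
  then obtain P where P: "frob_poly m P = P" "x = poly_op P" by (auto simp: Kc_def)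
  have mP: "frob_poly m (- P) = - P" using P by simp
  have "poly_op (- P) \<oplus>\<^bsub>Cent_ring m\<^esub> poly_op P = \<zero>\<^bsub>Cent_ring m\<^esub>"
    using poly_op_add[of "- P" P] poly_op_zero by simp
  then have "\<ominus>\<^bsub>Cent_ring m\<^esub> x = poly_op (- P)"
    unfolding P(2) using KcI[OF P(1)] KcI[OF mP] Kc_centr by (intro R.minus_equality) auto
  then show "\<ominus>\<^bsub>Cent_ring m\<^esub> x \<in> Kc"
    using KcI[OF mP] by simp
  fix y assume "y \<in> Kc"
  then obtain Q where Q: "frob_poly m Q = Q" "y = poly_op Q" by (auto simp: Kc_def)
  show "x \<otimes>\<^bsub>Cent_ring m\<^esub> y \<in> Kc"
    using poly_op_mult[OF over_n[OF Q(1)], of P] KcI[of "P * Q"] P Q by simp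
  show "x \<oplus>\<^bsub>Cent_ring m\<^esub> y \<in> Kc"
    using poly_op_add[of P Q] KcI[of "P + Q"] P Q by simp
qed

lemma \<pi>_poly_op_1:
  assumes "frob_poly n P = P"
  shows "\<pi> \<otimes>\<^bsub>End_ring\<^esub> poly_op P = poly_op (frob_poly r P) \<otimes>\<^bsub>End_ring\<^esub> \<pi>"
proof -
  have "\<pi> [^]\<^bsub>End_ring\<^esub> (1::nat) = \<pi>"
    using \<pi>_in_endos by (intro E.nat_pow_eone) simp
  then show ?thesis
    using \<pi>_poly_op[OF assms, of 1] by (simp del: End_ring_simps(2))
qed

lemma frob_poly_over: "frob_poly m P = P \<Longrightarrow> frob_poly m (frob_poly k P) = frob_poly k P"
  by (metis add.commute frob_poly_frob_poly)

lemma conj_\<pi>: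
  assumes "frob_poly m P = P"
  shows "\<pi> \<otimes>\<^bsub>Cent_ring m\<^esub> poly_op P \<otimes>\<^bsub>Cent_ring m\<^esub> inv\<^bsub>Cent_ring m\<^esub> \<pi> = poly_op (frob_poly r P)"
proof -
  have mem: "poly_op (frob_poly r P) \<in> carrier (Cent_ring m)" "\<pi> \<in> carrier (Cent_ring m)"
      "inv\<^bsub>Cent_ring m\<^esub> \<pi> \<in> carrier (Cent_ring m)"
    using KcI[OF frob_poly_over[OF assms]] Kc_centr \<pi>_in_centr R.Units_inv_closed[OF \<pi>_Units]
    by auto
  have "\<pi> \<otimes>\<^bsub>Cent_ring m\<^esub> poly_op P = poly_op (frob_poly r P) \<otimes>\<^bsub>Cent_ring m\<^esub> \<pi>"
    using \<pi>_poly_op_1[OF over_n[OF assms]] by simp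
  then show ?thesis
    using R.m_assoc[OF mem] R.Units_r_inv[OF \<pi>_Units] R.r_one[OF mem(1)] by simp
qed

lemma op_sum_eq_finsum:
  assumes P: "\<And>i. i < n \<Longrightarrow> frob_poly m (P i) = P i" and f: "\<And>i. i < n \<Longrightarrow> f i = poly_op (P i)"
  shows "(\<Oplus>\<^bsub>Cent_ring m\<^esub>i\<in>{..<n}. f i \<otimes>\<^bsub>Cent_ring m\<^esub> \<pi> [^]\<^bsub>Cent_ring m\<^esub> i) = op_sum P"
proof -
  have mem: "f i \<otimes>\<^bsub>Cent_ring m\<^esub> \<pi> [^]\<^bsub>Cent_ring m\<^esub> i \<in> centr m" if "i \<in> {..<n}" for i
    using R.m_closed[of "f i" "\<pi> [^]\<^bsub>Cent_ring m\<^esub> i"] R.nat_pow_closed[of \<pi> i] \<pi>_in_centr[of m]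
      f[of i] KcI[OF P[of i]] Kc_centr that by auto
  have "(\<Oplus>\<^bsub>Cent_ring m\<^esub>i\<in>{..<n}. f i \<otimes>\<^bsub>Cent_ring m\<^esub> \<pi> [^]\<^bsub>Cent_ring m\<^esub> i) =
      (\<lambda>v\<in>torsion. \<Sum>i<n. (f i \<otimes>\<^bsub>Cent_ring m\<^esub> \<pi> [^]\<^bsub>Cent_ring m\<^esub> i) v)"
    using mem by (intro finsum_Cent_ring) auto
  also have "\<dots> = op_sum P"
    unfolding op_sum_def
  proof (rule restrict_ext)
    fix v assume v: "v \<in> torsion"
    show "(\<Sum>i<n. (f i \<otimes>\<^bsub>Cent_ring m\<^esub> \<pi> [^]\<^bsub>Cent_ring m\<^esub> i) v) = (\<Sum>i<n. pact (P i) (frob (r * i) v))"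
      using v by (intro sum.cong) (simp_all add: Cent_ring_pow \<pi>_pow f compose_def poly_op_def torsion_frob)
  qed
  finally show ?thesis .
qed

lemma polys_below_over: "P \<in> polys_below m d \<Longrightarrow> frob_poly m P = P"
  and polys_below_n: "P \<in> polys_below m d \<Longrightarrow> P \<in> polys_below n d"
  by (auto simp: polys_below_def over_n)

lemma Kc_cases:
  assumes "x \<in> Kc"
  obtains P where "P \<in> polys_below m d" "x = poly_op P"
  using assms poly_op_reduce unfolding Kc_def by blast

text \<open>
  This is the unique representation of endomorphisms as sums \<open>\<Sum>\<^sub>i P\<^sub>i(\<Phi>) \<pi>\<^sup>i\<close>, restricted to the
  coefficients that belong to the centralizer.
\<close>
theorem basis_Cent_ring:
  "bij_betw (\<lambda>f. \<Oplus>\<^bsub>Cent_ring m\<^esub>i\<in>{..<n}. f i \<otimes>\<^bsub>Cent_ring m\<^esub> \<pi> [^]\<^bsub>Cent_ring m\<^esub> i)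
    ({..<n} \<rightarrow>\<^sub>E Kc) (carrier (Cent_ring m))"
proof -
  let ?F = "\<lambda>f. \<Oplus>\<^bsub>Cent_ring m\<^esub>i\<in>{..<n}. f i \<otimes>\<^bsub>Cent_ring m\<^esub> \<pi> [^]\<^bsub>Cent_ring m\<^esub> i"
  have rep: "\<exists>P. (\<forall>i<n. P i \<in> polys_below m d) \<and> (\<forall>i<n. f i = poly_op (P i))" if "f \<in> {..<n} \<rightarrow>\<^sub>E Kc" for f
  proof -
    have "\<forall>i\<in>{..<n}. \<exists>P. P \<in> polys_below m d \<and> f i = poly_op P"
      using that by (meson Kc_cases PiE_mem)
    then show ?thesis by (metis lessThan_iff)
  qed
  have "inj_on ?F ({..<n} \<rightarrow>\<^sub>E Kc)"
  proof (rule inj_onI)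
    fix f g assume fg: "f \<in> {..<n} \<rightarrow>\<^sub>E Kc" "g \<in> {..<n} \<rightarrow>\<^sub>E Kc" "?F f = ?F g"
    obtain P where P: "\<And>i. i < n \<Longrightarrow> P i \<in> polys_below m d" "\<And>i. i < n \<Longrightarrow> f i = poly_op (P i)"
      using rep[OF fg(1)] by blast
    obtain Q where Q: "\<And>i. i < n \<Longrightarrow> Q i \<in> polys_below m d" "\<And>i. i < n \<Longrightarrow> g i = poly_op (Q i)"
      using rep[OF fg(2)] by blast
    have "op_sum P = ?F f"
      by (rule op_sum_eq_finsum[symmetric]) (use P polys_below_over in auto)
    also have "\<dots> = ?F g"
      by (rule fg(3))
    also have "\<dots> = op_sum Q"
      by (rule op_sum_eq_finsum) (use Q polys_below_over in auto)
    finally have "P i = Q i" if "i < n" for i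
      using P(1) Q(1) that by (intro op_sum_eq_iff[of P Q] polys_below_n) auto
    then show "f = g"
      using P(2) Q(2) by (intro PiE_ext[OF fg(1,2)]) simp
  qed
  moreover have "?F ` ({..<n} \<rightarrow>\<^sub>E Kc) = carrier (Cent_ring m)"
  proof
    show "?F ` ({..<n} \<rightarrow>\<^sub>E Kc) \<subseteq> carrier (Cent_ring m)"
    proof (intro image_subsetI R.finsum_closed funcsetI R.m_closed R.nat_pow_closed)
      show "f i \<in> carrier (Cent_ring m)" if "f \<in> {..<n} \<rightarrow>\<^sub>E Kc" "i \<in> {..<n}" for f i
        using PiE_mem[OF that] Kc_centr by auto
    qed (simp add: \<pi>_in_centr)
    show "carrier (Cent_ring m) \<subseteq> ?F ` ({..<n} \<rightarrow>\<^sub>E Kc)"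
    proof
      fix x assume "x \<in> carrier (Cent_ring m)"
      then have x: "x \<in> centr m" by simp
      obtain P where P: "\<And>i. i < n \<Longrightarrow> P i \<in> polys_below n d" "x = op_sum P"
        using endos_eq_op_sum[OF centr_endos[OF x]] by blast
      have "x (frob (r * m) v) = frob (r * m) (x v)" if v: "v \<in> torsion" for v
      proof -
        have "compose torsion x (\<pi> [^]\<^bsub>End_ring\<^esub> m) = compose torsion (\<pi> [^]\<^bsub>End_ring\<^esub> m) x"
          using x by (simp add: centr_def ring_centralizer_def)
        from fun_cong[OF this, of v] show ?thesis
          using v centr_endos[OF x] by (simp add: compose_def \<pi>_pow)
      qed
      then have Pm: "P i \<in> polys_below m d" if "i < n" for i
        using that P by (intro op_sum_commutes[OF _ _ m_dvd_n]) auto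
      let ?f = "\<lambda>i\<in>{..<n}. poly_op (P i)"
      have "?F ?f = x"
        unfolding P(2) using Pm polys_below_over by (intro op_sum_eq_finsum) auto
      moreover have "?f \<in> {..<n} \<rightarrow>\<^sub>E Kc"
        using Pm polys_below_over KcI by auto
      ultimately show "x \<in> ?F ` ({..<n} \<rightarrow>\<^sub>E Kc)" by blast
    qed
  qed
  ultimately show ?thesis
    unfolding bij_betw_def by blast
qed

sublocale X: cyclic_extension "Cent_ring m" Kc \<pi> "poly_op (lift_poly p\<^sub>0)" n
proof (intro cyclic_extension.intro cyclic_extension_axioms.intro)
  show "ring (Cent_ring m)" by (rule ring_Cent_ring)
  show "n > 0" by (rule n_pos)
  show "subring Kc (Cent_ring m)" by (rule subring_Kc)
  show "\<pi> \<in> Units (Cent_ring m)" by (rule \<pi>_Units)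
  show "\<pi> \<otimes>\<^bsub>Cent_ring m\<^esub> x \<otimes>\<^bsub>Cent_ring m\<^esub> inv\<^bsub>Cent_ring m\<^esub> \<pi> \<in> Kc" if "x \<in> Kc" for x
    using that conj_\<pi> KcI[OF frob_poly_over] by (auto simp: Kc_def)
  show "poly_op (lift_poly p\<^sub>0) \<in> Kc" by (rule KcI) simp
  show "\<pi> [^]\<^bsub>Cent_ring m\<^esub> n = poly_op (lift_poly p\<^sub>0)"
    by (simp add: Cent_ring_pow \<pi>_pow_n)
  show "poly_op (lift_poly p\<^sub>0) \<otimes>\<^bsub>Cent_ring m\<^esub> x = x \<otimes>\<^bsub>Cent_ring m\<^esub> poly_op (lift_poly p\<^sub>0)" if "x \<in> Kc" for x
    using that Kc_endos poly_op_commutes_scalar[of x p\<^sub>0] by auto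
qed (rule basis_Cent_ring)

abbreviation K_ring :: "('f alg_closure \<Rightarrow> 'f alg_closure) ring" where
  "K_ring \<equiv> Cent_ring m\<lparr>carrier := Kc\<rparr>"

lemma twist_poly_op: "frob_poly m P = P \<Longrightarrow> X.twist (poly_op P) = poly_op (frob_poly r P)"
  using conj_\<pi>[of P] KcI[of P] by (simp add: X.twist_def)

lemma twist_pow_poly_op:
  "frob_poly m P = P \<Longrightarrow> (X.twist ^^ k) (poly_op P) = poly_op (frob_poly (r * k) P)"
proof (induction k)
  case 0
  have "frob_poly 0 P = P" by (simp add: frob_poly_eq_iff)
  then show ?case by simp
next
  case (Suc k)
  then show ?case
    using twist_poly_op[OF frob_poly_over[OF Suc.prems], of "r * k"] by (simp add: frob_poly_frob_poly)
qed

lemma finite_Kc: "finite Kc"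
  using Kc_endos card_endos_le(1) finite_subset by blast

lemma value_in_GF: "frob_poly m P = P \<Longrightarrow> poly P \<theta> \<in> carrier (GF (m * d))"
proof -
  assume P: "frob_poly m P = P"
  have "frob (m * d) \<theta> = \<theta>"
    using frob_period_theta by (simp add: frob_period_def)
  then show ?thesis
    using poly_frob_poly[of "m * d" P \<theta>] frob_poly_dvd[OF P, of "m * d"] by (simp add: carrier_GF)
qed

text \<open>
  Both sides have \<open>q\<^sup>m\<^sup>d\<close> elements.
\<close>
lemma values_eq_GF: "(\<lambda>P. poly P \<theta>) ` polys_below m d = carrier (GF (m * d))"
proof (rule card_subset_eq)
  show "finite (carrier (GF (m * d) :: 'f alg_closure ring))"
    using m_pos d_pos by (simp add: finite_carrier_GF)
  show "(\<lambda>P. poly P \<theta>) ` polys_below m d \<subseteq> carrier (GF (m * d))"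
    using value_in_GF polys_below_over by blast
  have "inj_on (\<lambda>P. poly P \<theta>) (polys_below m d)"
  proof (rule inj_onI)
    fix P Q assume PQ: "P \<in> polys_below m d" "Q \<in> polys_below m d" "poly P \<theta> = poly Q \<theta>"
    then have "P - Q \<in> polys_below m d"
      by (auto simp: polys_below_def intro: degree_diff_less)
    then have "P - Q = 0"
      using PQ(3) by (intro poly_theta_faithful[OF coprime_m_d]) simp_all
    then show "P = Q" by simp
  qed
  then show "card ((\<lambda>P. poly P \<theta>) ` polys_below m d) = card (carrier (GF (m * d) :: 'f alg_closure ring))"
    using m_pos d_pos by (simp add: card_image card_polys_below card_carrier_GF)
qed

text \<open>
  The inverse of \<open>P(\<Phi>) \<mapsto> P(\<theta>)\<close>; the choice of \<open>P\<close> is irrelevant, as an operator in \<open>K\<close> depends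
  only on its value.
\<close>
definition from_value :: "'f alg_closure \<Rightarrow> 'f alg_closure \<Rightarrow> 'f alg_closure" where
  "from_value x = poly_op (SOME P. frob_poly m P = P \<and> poly P \<theta> = x)"

lemma from_value_poly:
  assumes "frob_poly m P = P"
  shows "from_value (poly P \<theta>) = poly_op P"
proof -
  let ?Q = "SOME Q. frob_poly m Q = Q \<and> poly Q \<theta> = poly P \<theta>"
  have "frob_poly m ?Q = ?Q \<and> poly ?Q \<theta> = poly P \<theta>"
    using assms by (intro someI[of "\<lambda>Q. frob_poly m Q = Q \<and> poly Q \<theta> = poly P \<theta>" P]) simp
  then show ?thesis
    unfolding from_value_def using assms poly_op_eq_iff by blast
qed

theorem from_value_iso: "from_value \<in> ring_iso (GF (m * d)) K_ring"
proof (rule ring_iso_memI)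
  have rep: "\<exists>P. frob_poly m P = P \<and> x = poly P \<theta>" if "x \<in> carrier (GF (m * d))" for x
  proof -
    have "x \<in> (\<lambda>P. poly P \<theta>) ` polys_below m d"
      using that values_eq_GF by simp
    then show ?thesis
      using polys_below_over by blast
  qed
  fix x y :: "'f alg_closure"
  assume x: "x \<in> carrier (GF (m * d))"
  then obtain P where P: "frob_poly m P = P" "x = poly P \<theta>" using rep by blast
  show "from_value x \<in> carrier K_ring"
    using P by (simp add: from_value_poly KcI)
  assume y: "y \<in> carrier (GF (m * d))"
  then obtain Q where Q: "frob_poly m Q = Q" "y = poly Q \<theta>" using rep by blast
  have "from_value (x * y) = poly_op (P * Q)" "from_value (x + y) = poly_op (P + Q)"
    using from_value_poly[of "P * Q"] from_value_poly[of "P + Q"] P Q by simp_all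
  then show "from_value (x \<otimes>\<^bsub>GF (m * d)\<^esub> y) = from_value x \<otimes>\<^bsub>K_ring\<^esub> from_value y"
      "from_value (x \<oplus>\<^bsub>GF (m * d)\<^esub> y) = from_value x \<oplus>\<^bsub>K_ring\<^esub> from_value y"
    using poly_op_mult[OF over_n[OF Q(1)], of P] poly_op_add[of P Q] P Q by (simp_all add: from_value_poly)
next
  show "from_value \<one>\<^bsub>GF (m * d)\<^esub> = \<one>\<^bsub>K_ring\<^esub>"
    using from_value_poly[of 1] poly_op_one by simp
  have img: "from_value ` carrier (GF (m * d)) = Kc"
  proof
    show "from_value ` carrier (GF (m * d)) \<subseteq> Kc"
      unfolding values_eq_GF[symmetric]
      by (auto simp: from_value_poly[OF polys_below_over] intro!: KcI[OF polys_below_over])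
    show "Kc \<subseteq> from_value ` carrier (GF (m * d))"
    proof
      fix x assume "x \<in> Kc"
      then obtain P where "frob_poly m P = P" "x = poly_op P" by (auto simp: Kc_def)
      then show "x \<in> from_value ` carrier (GF (m * d))"
        using from_value_poly value_in_GF by (metis image_eqI)
    qed
  qed
  moreover have "inj_on from_value (carrier (GF (m * d)))"
    unfolding values_eq_GF[symmetric]
  proof (rule inj_onI)
    fix x y assume "x \<in> (\<lambda>P. poly P \<theta>) ` polys_below m d" "y \<in> (\<lambda>P. poly P \<theta>) ` polys_below m d"
      and eq: "from_value x = from_value y"
    then obtain P Q where PQ: "frob_poly m P = P" "frob_poly m Q = Q" "x = poly P \<theta>" "y = poly Q \<theta>"
      using polys_below_over by blast
    then have "poly_op P = poly_op Q"
      using eq by (simp add: from_value_poly)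
    then show "x = y"
      using PQ poly_op_eq_iff by blast
  qed
  ultimately show "bij_betw from_value (carrier (GF (m * d))) (carrier K_ring)"
    by (simp add: bij_betw_def)
qed

lemma field_K_ring: "field K_ring"
proof -
  interpret F: field "GF (m * d) :: 'f alg_closure ring"
    using m_pos d_pos by (intro field_GF) simp
  have "from_value \<zero>\<^bsub>GF (m * d)\<^esub> = \<zero>\<^bsub>K_ring\<^esub>"
    using from_value_poly[of 0] poly_op_zero by simp
  then show ?thesis
    using F.ring_iso_imp_img_field[OF from_value_iso] by (simp add: End_ring_def)
qed

lemma K_ring_iso_GF: "K_ring \<simeq> (GF (m * d) :: 'f alg_closure ring)"
proof -
  have "ring (GF (m * d) :: 'f alg_closure ring)"
    using m_pos d_pos field_GF[of "m * d", where 'f='f] by (simp add: field.is_ring field_def cring_def domain_def)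
  then show ?thesis
    using ring_iso_set_sym[OF _ from_value_iso] unfolding is_ring_iso_def by blast
qed

definition Frob :: "('f alg_closure \<Rightarrow> 'f alg_closure) \<Rightarrow> ('f alg_closure \<Rightarrow> 'f alg_closure)" where
  "Frob = (\<lambda>x\<in>Kc. x [^]\<^bsub>K_ring\<^esub> CARD('f))"

lemma poly_op_pow:
  assumes "frob_poly m P = P"
  shows "poly_op P [^]\<^bsub>K_ring\<^esub> (k::nat) = poly_op (P ^ k)"
proof (induction k)
  case 0
  show ?case using poly_op_one by (simp add: nat_pow_def)
next
  case (Suc k)
  have "poly_op P [^]\<^bsub>K_ring\<^esub> Suc k = poly_op P [^]\<^bsub>K_ring\<^esub> k \<otimes>\<^bsub>End_ring\<^esub> poly_op P"
    by (simp add: nat_pow_def)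
  also have "\<dots> = poly_op (P ^ k * P)"
    unfolding Suc by (rule poly_op_mult[OF over_n[OF assms]])
  finally show ?case by (simp add: mult.commute)
qed

lemma Frob_poly_op:
  assumes "frob_poly m P = P"
  shows "Frob (poly_op P) = poly_op (P ^ CARD('f))"
  unfolding Frob_def restrict_apply'[OF KcI[OF assms]] by (rule poly_op_pow[OF assms])

text \<open>On values at \<open>\<theta>\<close> the \<open>q\<close>-power map of \<open>K\<close> is the Frobenius of the algebraic closure.\<close>
lemma Frob_pow_poly_op:
  assumes "frob_poly m P = P"
  shows "\<exists>Q. frob_poly m Q = Q \<and> (Frob ^^ k) (poly_op P) = poly_op Q \<and> poly Q \<theta> = frob k (poly P \<theta>)"
proof (induction k)
  case 0
  then show ?case using assms by (intro exI[of _ P]) simp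
next
  case (Suc k)
  then obtain Q where Q: "frob_poly m Q = Q" "(Frob ^^ k) (poly_op P) = poly_op Q" "poly Q \<theta> = frob k (poly P \<theta>)"
    by blast
  have "poly (Q ^ CARD('f)) \<theta> = frob 1 (frob k (poly P \<theta>))"
    unfolding poly_power Q(3) by (simp add: frob_def)
  then show ?case
    using Q by (intro exI[of _ "Q ^ CARD('f)"]) (simp add: Frob_poly_op frob_frob frob_poly_power)
qed

lemma Frob_in_AutoGroup: "Frob \<in> carrier (ring_AutoGroup K_ring)"
proof (rule ring_AutoGroupI)
  show "finite (carrier K_ring)" using finite_Kc by simp
  show "Frob \<in> extensional (carrier K_ring)" by (simp add: Frob_def)
  have val: "poly (P ^ CARD('f)) \<theta> = frob 1 (poly P \<theta>)" for P
    by (simp add: frob_def)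
  show "inj_on Frob (carrier K_ring)"
  proof (rule inj_onI)
    fix x y assume "x \<in> carrier K_ring" "y \<in> carrier K_ring" and eq: "Frob x = Frob y"
    then obtain P Q where PQ: "frob_poly m P = P" "x = poly_op P" "frob_poly m Q = Q" "y = poly_op Q"
      by (auto simp: Kc_def)
    then have "poly_op (P ^ CARD('f)) = poly_op (Q ^ CARD('f))"
      using eq by (simp add: Frob_poly_op)
    then have "poly (P ^ CARD('f)) \<theta> = poly (Q ^ CARD('f)) \<theta>"
      using PQ by (subst (asm) poly_op_eq_iff) (simp_all add: frob_poly_power)
    then have "poly P \<theta> = poly Q \<theta>"
      unfolding val by simp
    then show "x = y"
      using PQ poly_op_eq_iff by blast
  qed
  show "Frob \<in> ring_hom K_ring K_ring"
  proof (rule ring_hom_memI)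
    fix x y assume "x \<in> carrier K_ring"
    then obtain P where P: "frob_poly m P = P" "x = poly_op P"
      by (auto simp: Kc_def)
    show "Frob x \<in> carrier K_ring"
      using P by (simp add: Frob_poly_op KcI frob_poly_power)
    assume "y \<in> carrier K_ring"
    then obtain Q where Q: "frob_poly m Q = Q" "y = poly_op Q"
      by (auto simp: Kc_def)
    have over: "frob_poly m (P * Q) = P * Q" "frob_poly m (P + Q) = P + Q"
        "frob_poly m (P ^ CARD('f)) = P ^ CARD('f)" "frob_poly m (Q ^ CARD('f)) = Q ^ CARD('f)"
      using P Q by (simp_all add: frob_poly_power)
    have xy: "x \<otimes>\<^bsub>K_ring\<^esub> y = poly_op (P * Q)" "x \<oplus>\<^bsub>K_ring\<^esub> y = poly_op (P + Q)"
      using poly_op_mult[OF over_n[OF Q(1)], of P] poly_op_add[of P Q] P Q by simp_all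
    have Fxy: "Frob x \<otimes>\<^bsub>K_ring\<^esub> Frob y = poly_op (P ^ CARD('f) * Q ^ CARD('f))"
        "Frob x \<oplus>\<^bsub>K_ring\<^esub> Frob y = poly_op (P ^ CARD('f) + Q ^ CARD('f))"
      using poly_op_mult[OF over_n[OF over(4)], of "P ^ CARD('f)"] poly_op_add[of "P ^ CARD('f)" "Q ^ CARD('f)"] P Q
      by (simp_all add: Frob_poly_op)
    show "Frob (x \<otimes>\<^bsub>K_ring\<^esub> y) = Frob x \<otimes>\<^bsub>K_ring\<^esub> Frob y"
      unfolding xy Fxy Frob_poly_op[OF over(1)] by (simp add: power_mult_distrib)
    have "poly ((P + Q) ^ CARD('f)) \<theta> = poly (P ^ CARD('f) + Q ^ CARD('f)) \<theta>"
      unfolding val poly_add frob_add ..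
    then show "Frob (x \<oplus>\<^bsub>K_ring\<^esub> y) = Frob x \<oplus>\<^bsub>K_ring\<^esub> Frob y"
      unfolding xy Fxy Frob_poly_op[OF over(2)] using P Q
      by (subst poly_op_eq_iff) (simp_all add: frob_poly_power)
  next
    show "Frob \<one>\<^bsub>K_ring\<^esub> = \<one>\<^bsub>K_ring\<^esub>"
      using Frob_poly_op[of 1] poly_op_one by simp
  qed
qed

text \<open>
  Injective because \<open>\<sigma>\<^sup>n\<close> is the identity.
\<close>
lemma twist_in_AutoGroup: "X.twist \<in> carrier (ring_AutoGroup K_ring)"
proof (rule ring_AutoGroupI)
  show "finite (carrier K_ring)" using finite_Kc by simp
  show "X.twist \<in> extensional (carrier K_ring)" by (simp add: X.twist_def)
  show "X.twist \<in> ring_hom K_ring K_ring" by (rule X.twist_hom)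
  show "inj_on X.twist (carrier K_ring)"
  proof (rule inj_onI)
    fix x y assume "x \<in> carrier K_ring" "y \<in> carrier K_ring" "X.twist x = X.twist y"
    then have xy: "x \<in> Kc" "y \<in> Kc" "X.twist x = X.twist y" by simp_all
    have "(X.twist ^^ n) x = (X.twist ^^ n) y"
      using xy(3) n_pos by (cases n) (simp_all add: funpow_Suc_right del: funpow.simps)
    then show "x = y"
      using X.twist_pow_n xy by simp
  qed
qed

lemma twist_scalar: "X.twist (poly_op (lift_poly a)) = poly_op (lift_poly a)"
  by (subst twist_poly_op) simp_all

lemma twist_const: "frob m z = z \<Longrightarrow> X.twist (poly_op [:z:]) = poly_op [:frob r z:]"
  by (subst twist_poly_op) simp_all

text \<open>The constants and the scalars generate \<open>K\<close>, so they determine its homomorphisms.\<close>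
lemma hom_eq_twist:
  assumes hom: "s \<in> ring_hom K_ring K_ring"
    and scalar: "\<And>a. s (poly_op (lift_poly a)) = poly_op (lift_poly a)"
    and const: "\<And>z. frob m z = z \<Longrightarrow> s (poly_op [:z:]) = poly_op [:frob r z:]"
  shows "frob_poly m P = P \<Longrightarrow> s (poly_op P) = poly_op (frob_poly r P)"
proof (induction P)
  case 0
  show ?case using scalar[of 0] by simp
next
  case (pCons a P)
  then have a: "frob m a = a" "frob_poly m P = P" by auto
  have X: "frob_poly m [:0, 1:] = [:0, 1:]" by simp
  have dec: "poly_op (pCons b Q) = poly_op [:b:] \<oplus>\<^bsub>K_ring\<^esub> (poly_op (lift_poly [:0, 1:]) \<otimes>\<^bsub>K_ring\<^esub> poly_op Q)"
    if "frob_poly m Q = Q" for b Q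
    using poly_op_mult[OF over_n[OF that], of "[:0, 1:]"] poly_op_add[of "[:b:]" "[:0, 1:] * Q"] by simp
  have mem: "poly_op [:a:] \<in> carrier K_ring" "poly_op (lift_poly [:0, 1:]) \<in> carrier K_ring" "poly_op P \<in> carrier K_ring"
    using a KcI[of "[:a:]"] KcI[of "lift_poly [:0, 1:]"] KcI[of P] by simp_all
  have "poly_op (lift_poly [:0, 1:]) \<otimes>\<^bsub>K_ring\<^esub> poly_op P \<in> carrier K_ring"
    by (rule X.K.m_closed[OF mem(2,3)])
  then have "s (poly_op (pCons a P)) = s (poly_op [:a:]) \<oplus>\<^bsub>K_ring\<^esub> (s (poly_op (lift_poly [:0, 1:])) \<otimes>\<^bsub>K_ring\<^esub> s (poly_op P))"
    unfolding dec[OF a(2)] using mem by (simp only: ring_hom_add[OF hom] ring_hom_mult[OF hom])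
  also have "\<dots> = poly_op [:frob r a:] \<oplus>\<^bsub>K_ring\<^esub> (poly_op (lift_poly [:0, 1:]) \<otimes>\<^bsub>K_ring\<^esub> poly_op (frob_poly r P))"
    by (simp only: scalar const[OF a(1)] pCons.IH[OF a(2)])
  also have "\<dots> = poly_op (frob_poly r (pCons a P))"
    unfolding frob_poly_simps(1) by (rule dec[symmetric, OF frob_poly_over[OF a(2)]])
  finally show ?case .
qed

lemma twist_unique:
  assumes "s \<in> carrier (ring_AutoGroup K_ring)"
    and "\<And>a. s (poly_op (lift_poly a)) = poly_op (lift_poly a)"
    and "\<And>z. frob m z = z \<Longrightarrow> s (poly_op [:z:]) = poly_op [:frob r z:]"
  shows "s = X.twist"
proof (rule extensionalityI)
  have s: "s \<in> ring_hom K_ring K_ring" "s \<in> extensional Kc"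
    using assms(1) by (auto simp: ring_AutoGroup_def ring_iso_def Bij_def)
  show "s \<in> extensional Kc" by (rule s)
  show "X.twist \<in> extensional Kc" by (simp add: X.twist_def)
  show "s x = X.twist x" if "x \<in> Kc" for x
    using that hom_eq_twist[OF s(1) assms(2,3)] twist_poly_op by (auto simp: Kc_def)
qed

text \<open>
  Raising \<open>P(\<theta>)\<close> to the power \<open>q\<^sup>e\<close> raises the coefficients to the power \<open>q\<^sup>r\<close>, as \<open>e \<equiv> r\<close> modulo \<open>m\<close>, and
  fixes \<open>\<theta>\<close>, as \<open>d\<close> divides \<open>e\<close>. The result is the value of the operator with twisted coefficients.
\<close>
lemma twist_eq_Frob_pow:
  assumes "[e = r] (mod m)" "[e = 0] (mod d)"
  shows "X.twist = Frob [^]\<^bsub>ring_AutoGroup K_ring\<^esub> e"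
proof (rule extensionalityI)
  show "X.twist \<in> extensional Kc" by (simp add: X.twist_def)
  have pow: "Frob [^]\<^bsub>ring_AutoGroup K_ring\<^esub> e = (\<lambda>x\<in>Kc. (Frob ^^ e) x)"
    using X.K.ring_AutoGroup_pow[OF Frob_in_AutoGroup, of e] by simp
  show "Frob [^]\<^bsub>ring_AutoGroup K_ring\<^esub> e \<in> extensional Kc"
    unfolding pow by simp
  fix x assume x: "x \<in> Kc"
  then obtain P where P: "frob_poly m P = P" "x = poly_op P" by (auto simp: Kc_def)
  obtain Q where Q: "frob_poly m Q = Q" "(Frob ^^ e) x = poly_op Q" "poly Q \<theta> = frob e (poly P \<theta>)"
    using Frob_pow_poly_op[OF P(1), of e] P(2) by blast
  have "frob e \<theta> = \<theta>"
    using frob_period_theta assms(2) by (simp add: frob_period_def cong_0_iff)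
  moreover have "frob_poly e P = frob_poly r P"
  proof (rule poly_eqI)
    fix i
    have "frob m (Polynomial.coeff P i) = Polynomial.coeff P i"
      using P(1) by (simp add: frob_poly_eq_iff)
    then show "Polynomial.coeff (frob_poly e P) i = Polynomial.coeff (frob_poly r P) i"
      using frob_cong[OF _ assms(1)] by simp
  qed
  ultimately have "poly Q \<theta> = poly (frob_poly r P) \<theta>"
    using poly_frob_poly[of e P \<theta>] Q(3) by simp
  then have "poly_op Q = poly_op (frob_poly r P)"
    using poly_op_eq_iff[OF Q(1) frob_poly_over[OF P(1)]] by simp
  then show "X.twist x = (Frob [^]\<^bsub>ring_AutoGroup K_ring\<^esub> e) x"
    unfolding pow restrict_apply'[OF x] using Q(2) P twist_poly_op[OF P(1)] by simp
qed

text \<open>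
  A constant of period \<open>m\<close> is fixed by \<open>\<sigma>\<^sup>k\<close> only if \<open>m\<close> divides \<open>rk\<close>, and \<open>r\<close> is prime to \<open>m\<close>.
\<close>
lemma ord_twist: "group.ord (ring_AutoGroup K_ring) X.twist = m"
proof -
  interpret G: group "ring_AutoGroup K_ring" by (rule X.K.group_ring_AutoGroup)
  have "X.twist [^]\<^bsub>ring_AutoGroup K_ring\<^esub> k = \<one>\<^bsub>ring_AutoGroup K_ring\<^esub> \<longleftrightarrow> m dvd k" for k :: nat
  proof -
    have pow: "X.twist [^]\<^bsub>ring_AutoGroup K_ring\<^esub> k = (\<lambda>x\<in>Kc. (X.twist ^^ k) x)"
      using X.K.ring_AutoGroup_pow[OF twist_in_AutoGroup, of k] by simp
    have one: "\<one>\<^bsub>ring_AutoGroup K_ring\<^esub> = (\<lambda>x\<in>Kc. x)"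
      by (simp add: ring_AutoGroup_def BijGroup_def)
    show ?thesis
    proof
      assume "X.twist [^]\<^bsub>ring_AutoGroup K_ring\<^esub> k = \<one>\<^bsub>ring_AutoGroup K_ring\<^esub>"
      then have eq: "(\<lambda>x\<in>Kc. (X.twist ^^ k) x) = (\<lambda>x\<in>Kc. x)"
        unfolding pow one .
      obtain z :: "'f alg_closure" where z: "frob_period z m"
        using exists_frob_period[OF m_pos] by blast
      then have zm: "frob m z = z" by (simp add: frob_period_def)
      then have P: "frob_poly m [:z:] = [:z:]" by simp
      have "poly_op (frob_poly (r * k) [:z:]) = poly_op [:z:]"
        using fun_cong[OF eq, of "poly_op [:z:]"] KcI[OF P] twist_pow_poly_op[OF P, of k] by simp
      then have "frob (r * k) z = z"
        using poly_op_eq_iff[OF frob_poly_over[OF P] P, of "r * k"] by simp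
      then have "m dvd r * k"
        using z by (simp add: frob_period_def)
      then show "m dvd k"
        using coprime_m_r by (simp add: coprime_dvd_mult_right_iff)
    next
      assume "m dvd k"
      then have "m dvd r * k" by simp
      then have "(X.twist ^^ k) x = x" if "x \<in> Kc" for x
      proof -
        from that obtain P where "frob_poly m P = P" "x = poly_op P" by (auto simp: Kc_def)
        then show ?thesis
          using twist_pow_poly_op[of P k] frob_poly_dvd[of m P "r * k"] \<open>m dvd r * k\<close> by simp
      qed
      then show "X.twist [^]\<^bsub>ring_AutoGroup K_ring\<^esub> k = \<one>\<^bsub>ring_AutoGroup K_ring\<^esub>"
        unfolding pow one by (intro restrict_ext)
    qed
  qed
  then show ?thesis
    using G.ord_unique[OF twist_in_AutoGroup] by blast
qed

text \<open>
  The coefficients of a fixed element of minimal degree are fixed by \<open>\<zeta> \<mapsto> \<zeta>^(q^r)\<close> and lie in the field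
  with \<open>q\<^sup>m\<close> elements, hence in the field with \<open>q\<close> elements because \<open>gcd(r, m) = 1\<close>.
\<close>
lemma fixed_points_twist: "{x \<in> Kc. X.twist x = x} = range (\<lambda>a. poly_op (lift_poly a))"
proof
  show "range (\<lambda>a. poly_op (lift_poly a)) \<subseteq> {x \<in> Kc. X.twist x = x}"
    using twist_scalar KcI by auto
  show "{x \<in> Kc. X.twist x = x} \<subseteq> range (\<lambda>a. poly_op (lift_poly a))"
  proof
    fix x assume "x \<in> {x \<in> Kc. X.twist x = x}"
    then have x: "x \<in> Kc" "X.twist x = x" by auto
    obtain P where P: "P \<in> polys_below m d" "x = poly_op P"
      using Kc_cases[OF x(1)] by blast
    note Pm = polys_below_over[OF P(1)]
    have "poly_op (frob_poly r P) = poly_op P"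
      using x(2) twist_poly_op[OF Pm] P(2) by simp
    then have "poly (frob_poly r P - P) \<theta> = 0"
      using poly_op_eq_iff[OF frob_poly_over[OF Pm] Pm] by simp
    moreover have "frob_poly r P - P \<in> polys_below m d"
      using P(1) frob_poly_over[OF Pm, of r] by (auto simp: polys_below_def intro: degree_diff_less)
    ultimately have "frob_poly r P - P = 0"
      by (intro poly_theta_faithful[OF coprime_m_d])
    then have "frob r (Polynomial.coeff P i) = Polynomial.coeff P i" for i
      using frob_poly_eq_iff[of r P] by simp
    moreover have "frob m (Polynomial.coeff P i) = Polynomial.coeff P i" for i
      using Pm by (simp add: frob_poly_eq_iff)
    ultimately have "frob 1 (Polynomial.coeff P i) = Polynomial.coeff P i" for i
      using frob_gcd[of m "Polynomial.coeff P i" r] coprime_m_r by simp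
    then have "Polynomial.coeff P i \<in> range to_ac" for i
      using carrier_GF_1[where 'f='f] by (auto simp: carrier_GF)
    then have "P = lift_poly (map_poly of_ac P)"
      by (intro poly_eqI) (simp add: coeff_map_poly to_ac_of_ac)
    with P(2) show "x \<in> range (\<lambda>a. poly_op (lift_poly a))" by (metis rangeI)
  qed
qed

end


section \<open>Twisted polynomials in \<open>\<tau>\<close> as operators\<close>

lemma twisted_polynomials_tau:
  assumes "r > 0"
  shows "twisted_polynomials (GF r :: 'f::{field, finite} alg_closure ring) (\<lambda>x. x ^ CARD('f))"
proof -
  interpret F: field "GF r :: 'f alg_closure ring"
    using assms by (rule field_GF)
  have pow: "x ^ CARD('f) = frob 1 x" for x :: "'f alg_closure"
    by (simp add: frob_def)
  have "(\<lambda>x. x ^ CARD('f)) \<in> ring_hom (GF r :: 'f alg_closure ring) (GF r)"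
  proof (rule ring_hom_memI)
    show "x ^ CARD('f) \<in> carrier (GF r)" if "x \<in> carrier (GF r)" for x :: "'f alg_closure"
    proof -
      have "frob r (frob 1 x) = frob 1 (frob r x)"
        by (simp only: frob_frob add.commute)
      then show ?thesis
        using that by (simp only: pow carrier_GF mem_Collect_eq)
    qed
  qed (simp_all add: GF_simps pow frob_add frob_mult)
  then show ?thesis
    by (intro twisted_polynomials.intro twisted_polynomials_axioms.intro F.ring_axioms)
qed

lemma frob_iterate: "((\<lambda>x. x ^ CARD('f)) ^^ i) x = frob i (x :: 'f::{field, finite} alg_closure)"
proof (induction i)
  case (Suc i)
  have "((\<lambda>x. x ^ CARD('f)) ^^ Suc i) x = frob 1 (frob i x)"
    using Suc by (simp add: frob_def)
  then show ?case by (simp add: frob_frob)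
qed simp

context
  fixes r :: nat
  assumes r_pos: "r > 0"
begin

interpretation T: twisted_polynomials "GF r :: 'f::{field, finite} alg_closure ring" "\<lambda>x. x ^ CARD('f)"
  using r_pos by (rule twisted_polynomials_tau)

lemma tau_act_altdef:
  "finite A \<Longrightarrow> {i. f i \<noteq> 0} \<subseteq> A \<Longrightarrow> tau_act f v = (\<Sum>i\<in>A. f i * frob i v)"
  for f :: "nat \<Rightarrow> 'f::{field, finite} alg_closure"
  unfolding tau_act_def frob_def by (intro sum.mono_neutral_left) auto

lemma finite_support_up: "finite {i. f i \<noteq> 0}" if f: "f \<in> up (GF r)" for f :: "nat \<Rightarrow> 'f::{field, finite} alg_closure"
proof -
  obtain k where k: "bound \<zero>\<^bsub>GF r\<^esub> k f"
    using T.bound_upD[OF f] by (rule exE)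
  have "{i. f i \<noteq> 0} \<subseteq> {..k}"
  proof
    fix i assume "i \<in> {i. f i \<noteq> 0}"
    then have "\<not> k < i"
      using bound.bound[OF k, of i] by auto
    then show "i \<in> {..k}" by simp
  qed
  then show ?thesis
    by (rule finite_subset) simp
qed

lemma tau_act_add:
  assumes "f \<in> up (GF r)" "g \<in> up (GF r)"
  shows "tau_act (f \<oplus>\<^bsub>tau_ring r\<^esub> g) v = tau_act f v + tau_act g (v :: 'f::{field, finite} alg_closure)"
proof -
  let ?A = "{i. f i \<noteq> 0} \<union> {i. g i \<noteq> 0}"
  have A: "finite ?A" using finite_support_up[OF assms(1)] finite_support_up[OF assms(2)] by simp
  have fg: "(f \<oplus>\<^bsub>tau_ring r\<^esub> g) i = f i + g i" for i
    unfolding tau_ring_def by (subst T.add_S[OF assms]) simp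
  have "tau_act (f \<oplus>\<^bsub>tau_ring r\<^esub> g) v = (\<Sum>i\<in>?A. (f \<oplus>\<^bsub>tau_ring r\<^esub> g) i * frob i v)"
    by (rule tau_act_altdef[OF A]) (auto simp: fg)
  also have "\<dots> = (\<Sum>i\<in>?A. f i * frob i v) + (\<Sum>i\<in>?A. g i * frob i v)"
    by (simp add: fg algebra_simps sum.distrib)
  also have "\<dots> = tau_act f v + tau_act g v"
    by (subst (1 2) tau_act_altdef[OF A]) auto
  finally show ?thesis .
qed

lemma tau_act_monom:
  assumes "a \<in> carrier (GF r)"
  shows "tau_act (up_ring.monom (tau_ring r) a i) v = a * frob i (v :: 'f::{field, finite} alg_closure)"
proof -
  have "up_ring.monom (tau_ring r) a i = (\<lambda>j. if j = i then a else 0)"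
    unfolding tau_ring_def using T.monom_S[OF assms, of i] by (auto simp: fun_eq_iff)
  then show ?thesis
    by (subst tau_act_altdef[of "{i}"]) auto
qed

lemma tau_act_add_right: "tau_act f (v + w) = tau_act f v + tau_act f (w :: 'f::{field, finite} alg_closure)"
  unfolding tau_act_def frob_def[symmetric] by (simp add: frob_add algebra_simps sum.distrib)

text \<open>
  Both sides are additive in \<open>f\<close> and \<open>g\<close>; on monomials this is the relation \<open>\<tau> a = a\<^sup>q \<tau>\<close>.
\<close>
lemma tau_act_mult:
  assumes "f \<in> up (GF r)" "g \<in> up (GF r)"
  shows "tau_act (f \<otimes>\<^bsub>tau_ring r\<^esub> g) v = tau_act f (tau_act g (v :: 'f::{field, finite} alg_closure))"
  using assms(1)
proof (induction rule: T.up_induct)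
  case (add f f')
  then show ?case
    using assms(2) unfolding tau_ring_def[symmetric]
    using T.S_l_distr[of f f' g] T.S_mult_closed[of f g] T.S_mult_closed[of f' g]
    unfolding tau_ring_def[symmetric] by (simp add: tau_act_add)
next
  case (monom a i)
  show ?case
    using assms(2)
  proof (induction rule: T.up_induct)
    case (add g g')
    have m: "up_ring.monom (tau_ring r) a i \<in> up (GF r)"
      using T.monom_in_up[OF monom] unfolding tau_ring_def .
    show ?case
      using add T.S_r_distr[OF add(1,2) m[unfolded tau_ring_def]]
        T.S_mult_closed[OF m[unfolded tau_ring_def] add(1)]
        T.S_mult_closed[OF m[unfolded tau_ring_def] add(2)]
      unfolding tau_ring_def[symmetric] by (simp add: tau_act_add tau_act_add_right)
  next
    case (monom b j)
    have ab: "a * frob i b \<in> carrier (GF r)"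
      using T.m_closed[OF \<open>a \<in> carrier (GF r)\<close> T.s_pow_closed[OF monom, of i]]
      by (simp add: frob_iterate)
    show ?case
      using T.monom_mult_monom[OF \<open>a \<in> carrier (GF r)\<close> monom, of i j] ab monom \<open>a \<in> carrier (GF r)\<close>
      unfolding tau_ring_def[symmetric]
      by (simp add: tau_act_monom frob_iterate frob_mult frob_frob mult.assoc)
  qed
qed

lemma tau_var_pow: "tau_var r [^]\<^bsub>tau_ring r\<^esub> (k::nat) = up_ring.monom (tau_ring r) (1 :: 'f::{field, finite} alg_closure) k"
  using T.monom_one_pow[of k] unfolding tau_ring_def[symmetric] tau_var_def by simp

lemma tau_act_tau_var_pow: "tau_act (tau_var r [^]\<^bsub>tau_ring r\<^esub> (k::nat)) v = frob k (v :: 'f::{field, finite} alg_closure)"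
  unfolding tau_var_pow by (subst tau_act_monom) (simp_all add: carrier_GF)

text \<open>A Drinfeld module acts through its value at \<open>T\<close>.\<close>
lemma tau_act_drinfeld_module:
  fixes t :: "'f::{field, finite} alg_closure"
  assumes phi: "is_drinfeld_module r t n \<phi>" and t: "t \<in> carrier (GF r)"
  shows "tau_act (\<phi> a) v = act n t (lift_poly a) v"
proof (induction a arbitrary: v)
  case 0
  have "\<phi> [:0:] = up_ring.monom (tau_ring r) (to_ac 0) 0"
    using phi unfolding is_drinfeld_module_def by blast
  then show ?case
    using tau_act_monom[of 0 0 v] by (simp add: carrier_GF)
next
  case (pCons a b)
  have hom: "\<phi> \<in> ring_hom ring_of_type_algebra (tau_ring r)"
    and const: "\<phi> [:a:] = up_ring.monom (tau_ring r) (to_ac a) 0"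
    and var: "\<phi> [:0, 1:] = up_ring.monom (tau_ring r) t 0 \<oplus>\<^bsub>tau_ring r\<^esub> tau_var r [^]\<^bsub>tau_ring r\<^esub> n"
    using phi by (auto simp: is_drinfeld_module_def)
  have up: "\<phi> x \<in> up (GF r)" for x
  proof -
    have "\<phi> x \<in> carrier (tau_ring r)"
      by (rule ring_hom_closed[OF hom]) (simp add: ring_of_type_algebra_def)
    then show ?thesis
      unfolding tau_ring_def T.carrier_S .
  qed
  have add: "\<phi> (x + y) = \<phi> x \<oplus>\<^bsub>tau_ring r\<^esub> \<phi> y" and mult: "\<phi> (x * y) = \<phi> x \<otimes>\<^bsub>tau_ring r\<^esub> \<phi> y" for x y
    using ring_hom_add[OF hom, of x y] ring_hom_mult[OF hom, of x y]
    by (simp_all add: ring_of_type_algebra_def)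
  have mt: "up_ring.monom (tau_ring r) t 0 \<in> up (GF r)"
      "up_ring.monom (tau_ring r) 1 n \<in> up (GF r :: 'f::{field, finite} alg_closure ring)"
    using T.monom_in_up[OF t, of 0] T.monom_in_up[of 1 n] unfolding tau_ring_def by (simp_all add: carrier_GF)
  have Phi: "tau_act (\<phi> [:0, 1:]) w = Phi n t w" for w
    unfolding var tau_var_pow using tau_act_monom[OF t] tau_act_monom[of 1]
    by (simp add: tau_act_add[OF mt] Phi_def carrier_GF)
  have "pCons a b = [:a:] + b * [:0, 1:]" by simp
  then have "tau_act (\<phi> (pCons a b)) v = tau_act (\<phi> [:a:]) v + tau_act (\<phi> (b * [:0, 1:])) v"
    using tau_act_add[OF up[of "[:a:]"] up[of "b * [:0, 1:]"]] by (simp only: add)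
  also have "tau_act (\<phi> [:a:]) v = to_ac a * v"
    unfolding const by (subst tau_act_monom) (simp_all add: carrier_GF)
  also have "tau_act (\<phi> (b * [:0, 1:])) v = tau_act (\<phi> b) (Phi n t v)"
    unfolding mult by (simp only: tau_act_mult[OF up up] Phi)
  finally show ?case
    by (simp add: pCons.IH act_pCons)
qed

end

section \<open>The residue field and the torsion module\<close>

abbreviation (input) poly_ring :: "'f::field poly ring" where
  "poly_ring \<equiv> ring_of_type_algebra"

lemma poly_ring_simps:
  "carrier poly_ring = UNIV" "x \<otimes>\<^bsub>poly_ring\<^esub> y = x * y" "x \<oplus>\<^bsub>poly_ring\<^esub> y = x + y"
  "\<one>\<^bsub>poly_ring\<^esub> = 1" "\<zero>\<^bsub>poly_ring\<^esub> = 0"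
  by (simp_all add: ring_of_type_algebra_def)

definition residue :: "'f::field poly \<Rightarrow> 'f poly \<Rightarrow> 'f poly set" where
  "residue p a = PIdl\<^bsub>poly_ring\<^esub> p +>\<^bsub>poly_ring\<^esub> a"

lemma residue_altdef: "residue p a = range (\<lambda>z. z * p + a)"
  unfolding residue_def cgenideal_def a_r_coset_def' by (auto simp: poly_ring_simps)

lemma carrier_residue_ring: "carrier (poly_ring Quot (PIdl\<^bsub>poly_ring\<^esub> p)) = range (residue p)"
  unfolding FactRing_def A_RCOSETS_def' residue_def by (auto simp: poly_ring_simps)

lemma ideal_PIdl: "ideal (PIdl\<^bsub>poly_ring\<^esub> p) (poly_ring :: 'f::field poly ring)"
  by (rule cring.cgenideal_ideal[OF cring_from_type_algebra]) (simp add: poly_ring_simps)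

lemma residue_mult:
  "residue p a \<otimes>\<^bsub>poly_ring Quot (PIdl\<^bsub>poly_ring\<^esub> p)\<^esub> residue p b = residue p (a * b)"
  using ideal.rcoset_mult_add[OF ideal_PIdl, of a b p]
  by (simp add: FactRing_def residue_def poly_ring_simps)

lemma residue_cong: "residue p (a + s * p) = residue p a"
  unfolding residue_altdef
proof (intro equalityI subsetI)
  fix x assume "x \<in> range (\<lambda>z. z * p + (a + s * p))"
  then obtain z where "x = z * p + (a + s * p)" by blast
  then have "x = (z + s) * p + a" by (simp add: algebra_simps)
  then show "x \<in> range (\<lambda>z. z * p + a)" by blast
next
  fix x assume "x \<in> range (\<lambda>z. z * p + a)"
  then obtain z where "x = z * p + a" by blast
  then have "x = (z - s) * p + (a + s * p)" by (simp add: algebra_simps)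
  then show "x \<in> range (\<lambda>z. z * p + (a + s * p))" by blast
qed

lemma residue_in_Units:
  assumes "b * a + s * p = 1"
  shows "residue p a \<in> Units (poly_ring Quot (PIdl\<^bsub>poly_ring\<^esub> p))"
proof -
  have "residue p (b * a) = residue p 1"
    using residue_cong[of p "b * a" s] assms by simp
  moreover have "\<one>\<^bsub>poly_ring Quot (PIdl\<^bsub>poly_ring\<^esub> p)\<^esub> = residue p 1"
    by (simp add: FactRing_def residue_def poly_ring_simps)
  ultimately show ?thesis
    unfolding Units_def carrier_residue_ring
    by (auto simp: residue_mult mult.commute[of a b] intro!: bexI[of _ b])
qed

context drinfeld_setting
begin

context
  fixes \<phi> :: "'f poly \<Rightarrow> nat \<Rightarrow> 'f alg_closure"
  assumes phi: "is_drinfeld_module r t n \<phi>"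
begin

lemma tau_act_phi: "tau_act (\<phi> a) v = aact a v"
  using tau_act_drinfeld_module[OF r_pos phi] frob_t by (simp add: carrier_GF)

lemma carrier_drinfeld_torsion: "carrier (drinfeld_torsion \<phi> p) = torsion"
  by (simp add: drinfeld_torsion_def torsion_def tau_act_phi)

lemma smult_drinfeld_torsion:
  assumes "v \<in> torsion"
  shows "residue p a \<odot>\<^bsub>drinfeld_torsion \<phi> p\<^esub> v = aact a v"
proof -
  have "(\<lambda>a. tau_act (\<phi> a) v) ` residue p a = {aact a v}"
    using assms unfolding residue_altdef
    by (auto simp: tau_act_phi act_add_left act_mult torsion_def image_iff)
  then show ?thesis
    by (simp add: drinfeld_torsion_def)
qed

text \<open>
  A residue class acts through any of its elements, so linearity over \<open>A/p\<close> is commutation with the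
  operators of all polynomials.
\<close>
lemma module_End_drinfeld_torsion:
  "module_End (poly_ring Quot (PIdl\<^bsub>poly_ring\<^esub> p)) (drinfeld_torsion \<phi> p) = End_ring"
proof -
  let ?M = "drinfeld_torsion \<phi> p"
  have ops: "v \<oplus>\<^bsub>?M\<^esub> w = v + w" "\<zero>\<^bsub>?M\<^esub> = 0" for v w
    by (simp_all add: drinfeld_torsion_def)
  have "{f \<in> carrier ?M \<rightarrow>\<^sub>E carrier ?M.
        (\<forall>v\<in>carrier ?M. \<forall>w\<in>carrier ?M. f (v \<oplus>\<^bsub>?M\<^esub> w) = f v \<oplus>\<^bsub>?M\<^esub> f w) \<and>
        (\<forall>a\<in>carrier (poly_ring Quot (PIdl\<^bsub>poly_ring\<^esub> p)). \<forall>v\<in>carrier ?M. f (a \<odot>\<^bsub>?M\<^esub> v) = a \<odot>\<^bsub>?M\<^esub> f v)} = endos"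
  proof -
    have "(\<forall>a\<in>range (residue p). \<forall>v\<in>torsion. f (a \<odot>\<^bsub>?M\<^esub> v) = a \<odot>\<^bsub>?M\<^esub> f v) \<longleftrightarrow>
        (\<forall>a. \<forall>v\<in>torsion. f (aact a v) = aact a (f v))" if "f \<in> torsion \<rightarrow>\<^sub>E torsion" for f
      using PiE_mem[OF that] by (simp add: smult_drinfeld_torsion)
    then show ?thesis
      unfolding endos_def carrier_drinfeld_torsion ops carrier_residue_ring by blast
  qed
  then show ?thesis
    unfolding module_End_def End_ring_def ops by (simp add: carrier_drinfeld_torsion)
qed

lemma scalar_op_drinfeld_torsion: "scalar_op (drinfeld_torsion \<phi> p) (residue p a) = poly_op (lift_poly a)"
  unfolding scalar_op_def poly_op_def carrier_drinfeld_torsion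
  by (rule restrict_ext) (rule smult_drinfeld_torsion)

end

lemma poly_op_const: "(\<lambda>v\<in>torsion. z * v) = poly_op [:z:]"
  unfolding poly_op_def by (rule restrict_ext) (simp add: act_pCons)

lemma centralizer_R0:
  "ring_centralizer End_ring (generate_ring End_ring
     (insert (\<pi> [^]\<^bsub>End_ring\<^esub> (k::nat)) (range (\<lambda>a. poly_op (lift_poly a))))) = centr k"
proof -
  have "insert (\<pi> [^]\<^bsub>End_ring\<^esub> k) (range (\<lambda>a. poly_op (lift_poly a))) \<subseteq> carrier End_ring"
    using \<pi>_pow_in_endos poly_op_in_endos by auto
  moreover have "ring_centralizer End_ring (insert (\<pi> [^]\<^bsub>End_ring\<^esub> k) (range (\<lambda>a. poly_op (lift_poly a)))) = centr k"
    unfolding centr_def ring_centralizer_def using poly_op_commutes_scalar by auto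
  ultimately show ?thesis
    using E.centralizer_generate_ring by simp
qed

end

context drinfeld_setting_subfield
begin

lemma sum_poly_op:
  assumes "finite A" "\<And>i. i \<in> A \<Longrightarrow> frob_poly m (P i) = P i"
  shows "(\<Oplus>\<^bsub>Cent_ring m\<^esub>i\<in>A. poly_op (P i)) = poly_op (\<Sum>i\<in>A. P i)"
  using assms
proof (induction A)
  case empty
  show ?case using poly_op_zero by simp
next
  case (insert x A)
  have "(\<Oplus>\<^bsub>Cent_ring m\<^esub>i\<in>insert x A. poly_op (P i)) =
      poly_op (P x) \<oplus>\<^bsub>Cent_ring m\<^esub> (\<Oplus>\<^bsub>Cent_ring m\<^esub>i\<in>A. poly_op (P i))"
    using insert.hyps insert.prems KcI Kc_centr by (intro R.finsum_insert) auto
  then show ?case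
    using insert poly_op_add[of "P x" "sum P A"] by simp
qed

text \<open>
  A sum of products of constants and scalars is a polynomial in \<open>\<Phi>\<close>; conversely a polynomial is the sum
  of its coefficients times powers of \<open>\<Phi>\<close>, and these powers are scalars.
\<close>
lemma tensor_image_eq_Kc:
  "tensor_image (Cent_ring m) ((\<lambda>z. poly_op [:z:]) ` carrier (GF m)) (range (\<lambda>a. poly_op (lift_poly a))) = Kc"
proof
  have prod: "poly_op [:z:] \<otimes>\<^bsub>Cent_ring m\<^esub> poly_op (lift_poly a) = poly_op (Polynomial.smult z (lift_poly a))" for z a
    using poly_op_mult[of "lift_poly a" "[:z:]"] by simp
  show "tensor_image (Cent_ring m) ((\<lambda>z. poly_op [:z:]) ` carrier (GF m)) (range (\<lambda>a. poly_op (lift_poly a))) \<subseteq> Kc"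
  proof
    fix u assume "u \<in> tensor_image (Cent_ring m) ((\<lambda>z. poly_op [:z:]) ` carrier (GF m)) (range (\<lambda>a. poly_op (lift_poly a)))"
    then obtain N :: nat and x y where u: "u = (\<Oplus>\<^bsub>Cent_ring m\<^esub>i\<in>{..<N}. x i \<otimes>\<^bsub>Cent_ring m\<^esub> y i)"
      and x: "x \<in> {..<N} \<rightarrow> (\<lambda>z. poly_op [:z:]) ` carrier (GF m)" and y: "y \<in> {..<N} \<rightarrow> range (\<lambda>a. poly_op (lift_poly a))"
      unfolding tensor_image_def by blast
    have "\<forall>i\<in>{..<N}. \<exists>z. frob m z = z \<and> x i = poly_op [:z:]"
      using x by (auto simp: carrier_GF dest!: funcset_mem)
    then obtain z where z: "\<And>i. i \<in> {..<N} \<Longrightarrow> frob m (z i) = z i" "\<And>i. i \<in> {..<N} \<Longrightarrow> x i = poly_op [:z i:]"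
      by metis
    have "\<forall>i\<in>{..<N}. \<exists>a. y i = poly_op (lift_poly a)"
      using y by (auto dest!: funcset_mem)
    then obtain a where a: "\<And>i. i \<in> {..<N} \<Longrightarrow> y i = poly_op (lift_poly (a i))"
      by metis
    let ?P = "\<lambda>i. Polynomial.smult (z i) (lift_poly (a i))"
    have P: "frob_poly m (?P i) = ?P i" if "i \<in> {..<N}" for i
      using z(1)[OF that] by simp
    have "u = (\<Oplus>\<^bsub>Cent_ring m\<^esub>i\<in>{..<N}. poly_op (?P i))"
      unfolding u
    proof (rule R.finsum_cong')
      show "(\<lambda>i. poly_op (?P i)) \<in> {..<N} \<rightarrow> carrier (Cent_ring m)"
        using KcI[OF P] Kc_centr by auto
      show "x i \<otimes>\<^bsub>Cent_ring m\<^esub> y i = poly_op (?P i)" if "i \<in> {..<N}" for i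
        unfolding z(2)[OF that] a[OF that] by (rule prod)
    qed simp
    also have "\<dots> = poly_op (\<Sum>i<N. ?P i)"
      using P by (intro sum_poly_op) simp_all
    finally have u': "u = poly_op (\<Sum>i<N. ?P i)" .
    have "frob_poly m (sum ?P B) = sum ?P B" if "finite B" "B \<subseteq> {..<N}" for B
      using that
    proof (induction B)
      case (insert b B)
      then show ?case
        using P[of b] by simp
    qed simp
    then show "u \<in> Kc"
      unfolding u' by (intro KcI) simp
  qed
  show "Kc \<subseteq> tensor_image (Cent_ring m) ((\<lambda>z. poly_op [:z:]) ` carrier (GF m)) (range (\<lambda>a. poly_op (lift_poly a)))"
  proof
    fix u assume "u \<in> Kc"
    then obtain P where P: "frob_poly m P = P" "u = poly_op P" by (auto simp: Kc_def)
    define N where "N = Suc (Polynomial.degree P)"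
    let ?z = "\<lambda>i. Polynomial.coeff P i" and ?a = "\<lambda>i. Polynomial.monom 1 i :: 'f poly"
    have lift: "lift_poly (?a i) = Polynomial.monom 1 i" for i
      by (simp add: map_poly_monom)
    have z: "frob m (?z i) = ?z i" for i
      using P(1) by (simp add: frob_poly_eq_iff)
    have over: "frob_poly m (Polynomial.smult (?z i) (lift_poly (?a i))) = Polynomial.smult (?z i) (lift_poly (?a i))" for i
      using z[of i] by simp
    have "P = (\<Sum>i<N. Polynomial.smult (?z i) (lift_poly (?a i)))"
      unfolding N_def lessThan_Suc_atMost lift smult_monom
      using poly_as_sum_of_monoms[of P] by simp
    then have "u = (\<Oplus>\<^bsub>Cent_ring m\<^esub>i\<in>{..<N}. poly_op (Polynomial.smult (?z i) (lift_poly (?a i))))"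
      using sum_poly_op[of "{..<N}" "\<lambda>i. Polynomial.smult (?z i) (lift_poly (?a i))"] over P(2) by simp
    then have "u = (\<Oplus>\<^bsub>Cent_ring m\<^esub>i\<in>{..<N}. poly_op [:?z i:] \<otimes>\<^bsub>Cent_ring m\<^esub> poly_op (lift_poly (?a i)))"
      by (simp only: prod)
    moreover have "(\<lambda>i. poly_op [:?z i:]) \<in> {..<N} \<rightarrow> (\<lambda>z. poly_op [:z:]) ` carrier (GF m)"
      using z by (auto simp: carrier_GF)
    moreover have "(\<lambda>i. poly_op (lift_poly (?a i))) \<in> {..<N} \<rightarrow> range (\<lambda>a. poly_op (lift_poly a))"
      by auto
    ultimately show "u \<in> tensor_image (Cent_ring m) ((\<lambda>z. poly_op [:z:]) ` carrier (GF m)) (range (\<lambda>a. poly_op (lift_poly a)))"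
      unfolding tensor_image_def
      by (intro CollectI exI[of _ N] exI[of _ "\<lambda>i. poly_op [:?z i:]"]
          exI[of _ "\<lambda>i. poly_op (lift_poly (?a i))"] conjI)
  qed
qed

lemma conj_image: "(\<lambda>x. \<pi> \<otimes>\<^bsub>Cent_ring m\<^esub> x \<otimes>\<^bsub>Cent_ring m\<^esub> inv\<^bsub>Cent_ring m\<^esub> \<pi>) ` Kc = Kc"
proof -
  have "(\<lambda>x. \<pi> \<otimes>\<^bsub>Cent_ring m\<^esub> x \<otimes>\<^bsub>Cent_ring m\<^esub> inv\<^bsub>Cent_ring m\<^esub> \<pi>) ` Kc = X.twist ` Kc"
    by (rule image_cong) (simp_all add: X.twist_def)
  also have "\<dots> = Kc"
    using twist_in_AutoGroup by (simp add: ring_AutoGroup_def Bij_def bij_betw_def)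
  finally show ?thesis .
qed

end

theorem theorem3p3:
  fixes n r d m :: nat
    and p\<^sub>0 p :: "'f::{field, finite} poly"
    and t :: "'f alg_closure"
    and \<phi> :: "'f poly \<Rightarrow> nat \<Rightarrow> 'f alg_closure"
    and A :: "'f poly ring"
    and \<kappa> :: "'f poly set ring"
    and M :: "('f poly set, 'f alg_closure) module"
    and E R K :: "('f alg_closure \<Rightarrow> 'f alg_closure) ring"
    and \<kappa>\<^sub>E R\<^sub>0 L :: "('f alg_closure \<Rightarrow> 'f alg_closure) set"
    and \<pi> :: "'f alg_closure \<Rightarrow> 'f alg_closure"
    and c :: "'f poly set"
    and \<mu> :: "'f alg_closure \<Rightarrow> 'f alg_closure \<Rightarrow> 'f alg_closure"
    and \<sigma> Frob :: "('f alg_closure \<Rightarrow> 'f alg_closure) \<Rightarrow> ('f alg_closure \<Rightarrow> 'f alg_closure)"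
    and S :: "('f alg_closure \<Rightarrow> 'f alg_closure,
               nat \<Rightarrow> 'f alg_closure \<Rightarrow> 'f alg_closure) up_ring"
    and y modulus :: "nat \<Rightarrow> 'f alg_closure \<Rightarrow> 'f alg_closure"
    and I :: "(nat \<Rightarrow> 'f alg_closure \<Rightarrow> 'f alg_closure) set"
  assumes "n \<ge> 1"
    and "Polynomial.lead_coeff p\<^sub>0 = 1" and "Factorial_Ring.irreducible p\<^sub>0" and "Polynomial.degree p\<^sub>0 = r"
    and "gcd n r = 1"
    and "t \<in> carrier (GF r)" and "Polynomial.poly (map_poly to_ac p\<^sub>0) t = 0"
    and "is_drinfeld_module r t n \<phi>"
    and "Polynomial.lead_coeff p = 1" and "Factorial_Ring.irreducible p" and "Polynomial.degree p = d" and "p \<noteq> p\<^sub>0"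
    and "A = ring_of_type_algebra"
    and "\<kappa> = A Quot (PIdl\<^bsub>A\<^esub> p)"
    and "M = drinfeld_torsion \<phi> p"
    and "E = module_End \<kappa> M"
    and "\<kappa>\<^sub>E = scalar_op M ` carrier \<kappa>"
    and "\<pi> = restrict (tau_act (tau_var r [^]\<^bsub>tau_ring r\<^esub> r)) (carrier M)"
    and "c = PIdl\<^bsub>A\<^esub> p +>\<^bsub>A\<^esub> p\<^sub>0"
    and "m dvd n"
    and "R\<^sub>0 = generate_ring E (insert (\<pi> [^]\<^bsub>E\<^esub> m) \<kappa>\<^sub>E)"
    and "R = E \<lparr>carrier := ring_centralizer E R\<^sub>0\<rparr>"
    and "\<mu> = (\<lambda>\<zeta>. \<lambda>v\<in>carrier M. \<zeta> * v)"
    and "L = \<mu> ` carrier (GF m)"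
    and "K = R \<lparr>carrier := tensor_image R L \<kappa>\<^sub>E\<rparr>"
    and "gcd m d = 1"
    and "\<sigma> = (\<lambda>x\<in>carrier K. \<pi> \<otimes>\<^bsub>R\<^esub> x \<otimes>\<^bsub>R\<^esub> inv\<^bsub>R\<^esub> \<pi>)"
    and "Frob = (\<lambda>x\<in>carrier K. x [^]\<^bsub>K\<^esub> CARD('f))"
    and "S = twisted_UP K \<sigma>"
    and "y = up_ring.monom S \<one>\<^bsub>K\<^esub> 1"
    and "modulus = y [^]\<^bsub>S\<^esub> n \<ominus>\<^bsub>S\<^esub> up_ring.monom S (scalar_op M c) 0"
    and "I = Idl\<^bsub>S\<^esub> {modulus}"
  shows
    "\<comment> \<open>the memberships asserted in the set-up\<close>
     (c \<in> Units \<kappa> \<and> \<pi> \<in> Units R \<and> L \<subseteq> carrier R \<and> carrier K \<subseteq> carrier R) \<and>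
     \<comment> \<open>(1)\<close>
     (field K \<and> K \<simeq> (GF (m * d) :: 'f alg_closure ring)) \<and>
     \<comment> \<open>(2)\<close>
     ((\<lambda>x. \<pi> \<otimes>\<^bsub>R\<^esub> x \<otimes>\<^bsub>R\<^esub> inv\<^bsub>R\<^esub> \<pi>) ` carrier K = carrier K \<and>
      \<sigma> \<in> carrier (ring_AutoGroup K) \<and>
      (\<forall>x\<in>\<kappa>\<^sub>E. \<sigma> x = x) \<and>
      (\<forall>\<zeta>\<in>carrier (GF m). \<sigma> (\<mu> \<zeta>) = \<mu> (\<zeta> ^ (CARD('f) ^ r))) \<and>
      (\<forall>\<sigma>'\<in>carrier (ring_AutoGroup K).
         (\<forall>x\<in>\<kappa>\<^sub>E. \<sigma>' x = x) \<and>
         (\<forall>\<zeta>\<in>carrier (GF m). \<sigma>' (\<mu> \<zeta>) = \<mu> (\<zeta> ^ (CARD('f) ^ r))) \<longrightarrow> \<sigma>' = \<sigma>) \<and>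
      Frob \<in> carrier (ring_AutoGroup K) \<and>
      (\<exists>!e. e < m * d \<and> [e = r] (mod m) \<and> [e = 0] (mod d)) \<and>
      (\<forall>e::nat. [e = r] (mod m) \<and> [e = 0] (mod d) \<longrightarrow>
         \<sigma> = Frob [^]\<^bsub>ring_AutoGroup K\<^esub> e) \<and>
      group.ord (ring_AutoGroup K) \<sigma> = m \<and>
      {x \<in> carrier K. \<sigma> x = x} = \<kappa>\<^sub>E) \<and>
     \<comment> \<open>(3)\<close>
     ((\<exists>\<psi> \<in> ring_iso (S Quot I) R.
         (\<forall>x\<in>carrier K. \<psi> (I +>\<^bsub>S\<^esub> up_ring.monom S x 0) = x) \<and>
         \<psi> (I +>\<^bsub>S\<^esub> y) = \<pi>) \<and>
      is_internal_direct_sum R {..<n} (\<lambda>i. (\<lambda>x. x \<otimes>\<^bsub>R\<^esub> \<pi> [^]\<^bsub>R\<^esub> i) ` carrier K) \<and>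
      modulus \<in> ring_centralizer S (carrier S))"
proof -
  have "coprime n r" "coprime m d"
    using assms(5,26) by (simp_all add: coprime_iff_gcd_eq_1)
  interpret D: drinfeld_setting_subfield n r d t p\<^sub>0 p m
    by unfold_locales (use assms(1-12,20) \<open>coprime n r\<close> \<open>coprime m d\<close> in auto)
  \<comment> \<open>The objects of the theorem are identified with those of the locale.\<close>
  note phi = assms(8)
  have \<kappa>: "\<kappa> = poly_ring Quot (PIdl\<^bsub>poly_ring\<^esub> p)"
    unfolding assms(14) assms(13) ..
  have M: "carrier M = D.torsion"
    unfolding assms(15) by (rule D.carrier_drinfeld_torsion[OF phi])
  have c: "c = residue p p\<^sub>0"
    unfolding assms(19) assms(13) residue_def ..
  have E: "E = D.End_ring"
    unfolding assms(16) \<kappa> assms(15) by (rule D.module_End_drinfeld_torsion[OF phi])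
  have scalar: "scalar_op M (residue p a) = D.poly_op (lift_poly a)" for a
    unfolding assms(15) by (rule D.scalar_op_drinfeld_torsion[OF phi])
  have \<kappa>\<^sub>E: "\<kappa>\<^sub>E = range (\<lambda>a. D.poly_op (lift_poly a))"
    unfolding assms(17) \<kappa> carrier_residue_ring image_image scalar ..
  have \<pi>: "\<pi> = D.\<pi>"
    unfolding assms(18) M D.\<pi>_def by (rule restrict_ext) (rule tau_act_tau_var_pow[OF D.r_pos])
  have R: "R = D.Cent_ring m"
    unfolding assms(22) assms(21) E \<pi> \<kappa>\<^sub>E D.centralizer_R0 ..
  have \<mu>: "\<mu> = (\<lambda>z. D.poly_op [:z:])"
    unfolding assms(23) M D.poly_op_const ..
  have L: "L = (\<lambda>z. D.poly_op [:z:]) ` carrier (GF m)"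
    unfolding assms(24) \<mu> ..
  have K: "K = D.K_ring"
    unfolding assms(25) R L \<kappa>\<^sub>E D.tensor_image_eq_Kc ..
  have carrier_K: "carrier K = D.Kc"
    unfolding K by simp
  have \<sigma>: "\<sigma> = D.X.twist"
    unfolding assms(27) carrier_K R \<pi> D.X.twist_def ..
  have Frob: "Frob = D.Frob"
    unfolding assms(28) K D.Frob_def by simp
  have S: "S = D.X.S"
    unfolding assms(29) K \<sigma> ..
  have y: "y = up_ring.monom D.X.S \<one>\<^bsub>D.Cent_ring m\<^esub> 1"
    unfolding assms(30) S K by simp
  have modulus: "modulus = D.X.modulus"
    unfolding assms(31) D.X.modulus_def y S c scalar ..
  have GFm: "z \<in> carrier (GF m) \<longleftrightarrow> frob m z = z" for z :: "'f alg_closure"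
    by (simp add: carrier_GF)

  have memberships: "c \<in> Units \<kappa> \<and> \<pi> \<in> Units R \<and> L \<subseteq> carrier R \<and> carrier K \<subseteq> carrier R"
  proof (intro conjI)
    obtain b s where "b * p\<^sub>0 + s * p = 1"
      using D.p0_invertible by blast
    then show "c \<in> Units \<kappa>"
      unfolding c \<kappa> by (rule residue_in_Units)
    show "\<pi> \<in> Units R"
      unfolding \<pi> R by (rule D.\<pi>_Units)
    show KR: "carrier K \<subseteq> carrier R"
      unfolding carrier_K R using D.Kc_centr by simp
    have "L \<subseteq> D.Kc"
      unfolding L by (auto simp: GFm intro!: D.KcI)
    with KR show "L \<subseteq> carrier R"
      unfolding carrier_K by blast
  qed
  have part1: "field K \<and> K \<simeq> (GF (m * d) :: 'f alg_closure ring)"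
    unfolding K using D.field_K_ring D.K_ring_iso_GF by blast
  show ?thesis
  proof (rule conjI[OF memberships conjI[OF part1]], intro conjI)
    show "(\<lambda>x. \<pi> \<otimes>\<^bsub>R\<^esub> x \<otimes>\<^bsub>R\<^esub> inv\<^bsub>R\<^esub> \<pi>) ` carrier K = carrier K"
      unfolding carrier_K R \<pi> by (rule D.conj_image)
    show "\<sigma> \<in> carrier (ring_AutoGroup K)"
      unfolding \<sigma> K by (rule D.twist_in_AutoGroup)
    show "\<forall>x\<in>\<kappa>\<^sub>E. \<sigma> x = x"
      unfolding \<kappa>\<^sub>E \<sigma> using D.twist_scalar by blast
    show "\<forall>\<zeta>\<in>carrier (GF m). \<sigma> (\<mu> \<zeta>) = \<mu> (\<zeta> ^ (CARD('f) ^ r))"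
      unfolding \<sigma> \<mu> GFm frob_def[symmetric] using D.twist_const GFm by blast
    show "\<forall>\<sigma>'\<in>carrier (ring_AutoGroup K).
         (\<forall>x\<in>\<kappa>\<^sub>E. \<sigma>' x = x) \<and>
         (\<forall>\<zeta>\<in>carrier (GF m). \<sigma>' (\<mu> \<zeta>) = \<mu> (\<zeta> ^ (CARD('f) ^ r))) \<longrightarrow> \<sigma>' = \<sigma>"
    proof (intro ballI impI, elim conjE)
      fix \<sigma>' assume s: "\<sigma>' \<in> carrier (ring_AutoGroup K)" "\<forall>x\<in>\<kappa>\<^sub>E. \<sigma>' x = x"
        "\<forall>\<zeta>\<in>carrier (GF m). \<sigma>' (\<mu> \<zeta>) = \<mu> (\<zeta> ^ (CARD('f) ^ r))"
      show "\<sigma>' = \<sigma>"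
        unfolding \<sigma>
      proof (rule D.twist_unique)
        show "\<sigma>' \<in> carrier (ring_AutoGroup D.K_ring)"
          using s(1) unfolding K .
        show "\<sigma>' (D.poly_op (lift_poly a)) = D.poly_op (lift_poly a)" for a
          using s(2) unfolding \<kappa>\<^sub>E by blast
        show "\<sigma>' (D.poly_op [:z:]) = D.poly_op [:frob r z:]" if "frob m z = z" for z
          using s(3) that unfolding \<mu> frob_def[symmetric] by (simp add: GFm)
      qed
    qed
    show "Frob \<in> carrier (ring_AutoGroup K)"
      unfolding Frob K by (rule D.Frob_in_AutoGroup)
    show "\<exists>!e. e < m * d \<and> [e = r] (mod m) \<and> [e = 0] (mod d)"
      using D.m_pos D.d_pos \<open>coprime m d\<close> by (intro binary_chinese_remainder_unique_nat) auto
    show "\<forall>e::nat. [e = r] (mod m) \<and> [e = 0] (mod d) \<longrightarrow> \<sigma> = Frob [^]\<^bsub>ring_AutoGroup K\<^esub> e"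
      unfolding \<sigma> Frob K using D.twist_eq_Frob_pow by blast
    show "group.ord (ring_AutoGroup K) \<sigma> = m"
      unfolding K \<sigma> by (rule D.ord_twist)
    show "{x \<in> carrier K. \<sigma> x = x} = \<kappa>\<^sub>E"
      unfolding carrier_K \<sigma> \<kappa>\<^sub>E by (rule D.fixed_points_twist)
    show "\<exists>\<psi> \<in> ring_iso (S Quot I) R.
         (\<forall>x\<in>carrier K. \<psi> (I +>\<^bsub>S\<^esub> up_ring.monom S x 0) = x) \<and>
         \<psi> (I +>\<^bsub>S\<^esub> y) = \<pi>"
      unfolding assms(32) carrier_K R S y \<pi> modulus by (rule D.X.quotient_iso)
    show "is_internal_direct_sum R {..<n} (\<lambda>i. (\<lambda>x. x \<otimes>\<^bsub>R\<^esub> \<pi> [^]\<^bsub>R\<^esub> i) ` carrier K)"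
      unfolding carrier_K R \<pi> by (rule D.X.internal_direct_sum)
    show "modulus \<in> ring_centralizer S (carrier S)"
      unfolding S modulus by (rule D.X.modulus_central)
  qed
qed

end
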